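(* Let $\mathbb K$ be an algebraically closed field of characteristic $\ne 2$, let $n\ge2$ and $\mathfrak g=\mathfrak{sp}_{2n}$. Then for any nilpotent element $e\in\mathfrak g$, the set $(\mathfrak g_e^* )_{\rm sing}$ has codimension $\ge 2$ in $\mathfrak g_e^*$.
   Context: $\mathfrak g_e$ is the centraliser of $e$ in $\mathfrak g$. For a finite-dimensional Lie algebra $\mathfrak q$ and $\gamma\in\mathfrak q^*$, $\mathfrak q^\gamma=\{x\in\mathfrak q:\gamma([x,\mathfrak q])=0\}$, ${\rm ind}\,\mathfrak q=\min_\gamma\dim\mathfrak q^\gamma$, and $(\mathfrak q^* )_{\rm sing}=\{\gamma\in\mathfrak q^*:\dim\mathfrak q^\gamma>{\rm ind}\,\mathfrak q\}$. *)

theory Defs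
  imports "HOL-Analysis.Finite_Cartesian_Product" "HOL-Computational_Algebra.Polynomial"
begin

definition alg_closed :: "'k::field itself \<Rightarrow> bool" where
  "alg_closed _ \<longleftrightarrow> (\<forall>p::'k poly. degree p > 0 \<longrightarrow> (\<exists>x. poly p x = 0))"

definition smat :: "'k::field \<Rightarrow> 'k^'m^'m \<Rightarrow> 'k^'m^'m" where
  "smat c A = (\<chi> i j. c * A $ i $ j)"

definition lie_br :: "'k::field^'m^'m \<Rightarrow> 'k^'m^'m \<Rightarrow> 'k^'m^'m" where
  "lie_br x y = x ** y - y ** x"

definition Jmat :: "'k::field^('n::finite + 'n)^('n + 'n)" where
  "Jmat = (\<chi> i j. case (i, j) of
      (Inl a, Inr b) \<Rightarrow> (if a = b then 1 else 0)
    | (Inr a, Inl b) \<Rightarrow> (if a = b then - 1 else 0)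
    | _ \<Rightarrow> 0)"

definition sp :: "('k::field^('n::finite + 'n)^('n + 'n)) set" where
  "sp = {X. transpose X ** Jmat + Jmat ** X = 0}"

definition nilpotent_mat :: "'k::field^'m^'m \<Rightarrow> bool" where
  "nilpotent_mat e \<longleftrightarrow> (\<exists>k::nat. ((\<lambda>A. A ** e) ^^ k) e = 0)"

definition centraliser :: "('k::field^'m^'m) set \<Rightarrow> 'k^'m^'m \<Rightarrow> ('k^'m^'m) set" where
  "centraliser g e = {x \<in> g. lie_br x e = 0}"

definition lin_indep :: "('k::field^'m^'m) set \<Rightarrow> bool" where
  "lin_indep S \<longleftrightarrow> finite S \<and>
     (\<forall>c. (\<Sum>b\<in>S. smat (c b) b) = 0 \<longrightarrow> (\<forall>b\<in>S. c b = 0))"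

definition mdim :: "('k::field^'m^'m) set \<Rightarrow> nat" where
  "mdim W = Max {card S | S. S \<subseteq> W \<and> lin_indep S}"

definition dual_sp :: "('k::field^'m^'m) set \<Rightarrow> ('k^'m^'m \<Rightarrow> 'k) set" where
  "dual_sp q = {\<gamma>. (\<forall>x\<in>q. \<forall>y\<in>q. \<gamma> (x + y) = \<gamma> x + \<gamma> y)
                 \<and> (\<forall>c. \<forall>x\<in>q. \<gamma> (smat c x) = c * \<gamma> x)
                 \<and> (\<forall>x. x \<notin> q \<longrightarrow> \<gamma> x = 0)}"

definition stab :: "('k::field^'m^'m) set \<Rightarrow> ('k^'m^'m \<Rightarrow> 'k) \<Rightarrow> ('k^'m^'m) set" where
  "stab q \<gamma> = {x \<in> q. \<forall>y\<in>q. \<gamma> (lie_br x y) = 0}"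

definition lie_index :: "('k::field^'m^'m) set \<Rightarrow> nat" where
  "lie_index q = (LEAST d. \<exists>\<gamma>\<in>dual_sp q. mdim (stab q \<gamma>) = d)"

definition sing_dual :: "('k::field^'m^'m) set \<Rightarrow> ('k^'m^'m \<Rightarrow> 'k) set" where
  "sing_dual q = {\<gamma> \<in> dual_sp q. mdim (stab q \<gamma>) > lie_index q}"

inductive_set dual_poly :: "('k::field^'m^'m) set \<Rightarrow> (('k^'m^'m \<Rightarrow> 'k) \<Rightarrow> 'k) set"
  for q where
  const: "(\<lambda>\<gamma>. c) \<in> dual_poly q"
| coord: "x \<in> q \<Longrightarrow> (\<lambda>\<gamma>. \<gamma> x) \<in> dual_poly q"
| add: "f \<in> dual_poly q \<Longrightarrow> g \<in> dual_poly q \<Longrightarrow> (\<lambda>\<gamma>. f \<gamma> + g \<gamma>) \<in> dual_poly q"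
| mult: "f \<in> dual_poly q \<Longrightarrow> g \<in> dual_poly q \<Longrightarrow> (\<lambda>\<gamma>. f \<gamma> * g \<gamma>) \<in> dual_poly q"

definition zclosed :: "('k::field^'m^'m) set \<Rightarrow> ('k^'m^'m \<Rightarrow> 'k) set \<Rightarrow> bool" where
  "zclosed q Z \<longleftrightarrow> (\<exists>F \<subseteq> dual_poly q. Z = {\<gamma> \<in> dual_sp q. \<forall>f\<in>F. f \<gamma> = 0})"

definition zirred :: "('k::field^'m^'m) set \<Rightarrow> ('k^'m^'m \<Rightarrow> 'k) set \<Rightarrow> bool" where
  "zirred q Z \<longleftrightarrow> zclosed q Z \<and> Z \<noteq> {} \<and>
     (\<forall>A B. zclosed q A \<longrightarrow> zclosed q B \<longrightarrow> Z \<subseteq> A \<union> B \<longrightarrow> Z \<subseteq> A \<or> Z \<subseteq> B)"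

text \<open>S has codimension at least c in q^* (dim q^* = dim q): every chain
  Z_0 < Z_1 < ... < Z_k of irreducible closed subsets of q^* contained in S
  satisfies k + c <= dim q^*, i.e. (Krull) dim S + c <= dim q^*.\<close>
definition codim_ge :: "('k::field^'m^'m) set \<Rightarrow> ('k^'m^'m \<Rightarrow> 'k) set \<Rightarrow> nat \<Rightarrow> bool" where
  "codim_ge q S c \<longleftrightarrow>
     (\<forall>k Z. (\<forall>i\<le>k. zirred q (Z i) \<and> Z i \<subseteq> S) \<and> (\<forall>i<k. Z i \<subset> Z (Suc i))
        \<longrightarrow> k + c \<le> mdim q)"

end

theory Submission
  imports Defs "HOL-Analysis.Determinants" "HOL-Library.Function_Algebras"
begin

text \<open>
  Let \<open>q\<close> be the centraliser of \<open>e\<close> in \<open>sp\<close>. It suffices to find a plane in the dual of \<open>q\<close> all of whose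
  nonzero elements are regular. The minors of the form \<open>\<gamma> [x, y]\<close> then have no common zero on the plane
  besides \<open>0\<close>, so on the singular set high powers of the two coordinates of the plane reduce to terms of
  lower degree in them. Hence the functions of degree at most \<open>m\<close> on the singular set span a space of
  dimension \<open>O(m\<^sup>d)\<close> with \<open>d = dim q - 2\<close>, while a chain of \<open>k + 1\<close> irreducible closed sets yields \<open>k\<close> functions
  with independent monomials, which forces \<open>k \<le> d\<close>.

  For the plane, write \<open>e\<close> in symplectic Jordan strings generated by \<open>w a\<close> and consider the functionals
  \<open>x \<mapsto> \<Sum> c a b \<langle>w a, x (w b)\<rangle>\<close> with \<open>c\<close> symmetric, once essentially diagonal and once essentially tridiagonal.
  For every combination, an element \<open>x\<close> of the stabiliser in the centraliser of \<open>e\<close> in \<open>gl\<close> is determined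
  by the image of a single vector under \<open>x\<close> or its adjoint, so this stabiliser has dimension at most \<open>2 n\<close>.
  It is the sum of its skew and self-adjoint parts, and a version of Vinberg's inequality shows that both
  have dimension at least \<open>n\<close>. So the skew part has dimension exactly \<open>n\<close>, which is the index.
\<close>

text \<open>Codimension is measured by chains alone, and counting functions of bounded degree turns
  it into linear algebra. On the line \<alpha> + t \<beta> the minors are polynomials in t; without
  a common zero they generate the unit ideal, which yields a power of one coordinate of the plane.
  Exchanging \<alpha> and \<beta> yields a power of the other.

  Two diagonal functionals would not do for the plane: some combination of them has a vanishing
  entry, and the argument for the diagonal case requires distinct nonzero ones. With a tridiagonal
  second generator, every combination that involves it has a nonzero subdiagonal, so only the
  multiples of the diagonal generator need the other argument.

  The stabiliser is computed in \<open>gl\<close> because the centraliser there contains the simple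
  test maps \<open>trunc_op\<close>, which isolate single equations. Returning to \<open>sp\<close>
  costs nothing: for symmetric \<open>c\<close> the skew and the self-adjoint part of the
  centraliser are orthogonal with respect to the form of the functional.\<close>

hide_const (open) Transposition.transpose

section \<open>Linear algebra\<close>

context vector_space
begin

text \<open>For families rather than sets: injectivity is part of the conclusion, so the image still
  has \<open>card I\<close> elements.\<close>

lemma independent_family:
  assumes I: "finite I" and a: "\<And>c. (\<Sum>i\<in>I. scale (c i) (a i)) = 0 \<Longrightarrow> \<forall>i\<in>I. c i = 0"
  shows "inj_on a I" and "independent (a ` I)"
proof -
  show inj: "inj_on a I"
  proof (rule inj_onI)
    fix i j assume ij: "i \<in> I" "j \<in> I" "a i = a j"
    show "i = j"
    proof (rule ccontr)
      assume ne: "i \<noteq> j"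
      define c :: "_ \<Rightarrow> 'a" where "c l = (if l = i then 1 else if l = j then -1 else 0)" for l
      have "(\<Sum>l\<in>I. scale (c l) (a l)) = (\<Sum>l\<in>{i,j}. scale (c l) (a l))"
        by (rule sum.mono_neutral_right) (use I ij in \<open>auto simp: c_def\<close>)
      also have "\<dots> = 0" using ne ij by (simp add: c_def)
      finally have "c i = 0" using a ij by blast
      then show False by (simp add: c_def)
    qed
  qed
  show "independent (a ` I)"
  proof (rule independent_if_scalars_zero)
    fix f x assume s: "(\<Sum>x\<in>a ` I. scale (f x) x) = 0" and x: "x \<in> a ` I"
    have "(\<Sum>i\<in>I. scale (f (a i)) (a i)) = 0" using s inj by (simp add: sum.reindex)
    then show "f x = 0" using a[of "\<lambda>i. f (a i)"] x by auto
  qed (use I in simp)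
qed

end

context finite_dimensional_vector_space
begin

text \<open>Mostly used to bound the dimension of a centraliser or stabiliser \<open>K\<close> from
  above: a family that is independent modulo \<open>K\<close> bounds the codimension of
  \<open>K\<close> from below.\<close>

lemma card_add_dim_le:
  assumes "independent B" "B \<subseteq> W" "subspace W" "subspace K" "K \<subseteq> W" "span B \<inter> K \<subseteq> {0}"
  shows "card B + dim K \<le> dim W"
proof -
  have eq: "span B \<inter> K = {0}"
    using assms(6) span_zero subspace_0[OF assms(4)] by blast
  have "dim {x + y |x y. x \<in> span B \<and> y \<in> K} + dim (span B \<inter> K) = dim (span B) + dim K"
    by (rule dim_sums_Int) (use assms in auto)
  moreover have "dim (span B \<inter> K) = 0"
    using eq by simp
  moreover have "dim {x + y |x y. x \<in> span B \<and> y \<in> K} \<le> dim W"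
  proof (rule dim_subset)
    have "span B \<subseteq> W" using assms(2,3) by (rule span_minimal)
    then show "{x + y |x y. x \<in> span B \<and> y \<in> K} \<subseteq> W"
      using assms(3,5) by (auto intro: subspace_add)
  qed
  ultimately show ?thesis
    using dim_eq_card_independent[OF assms(1)] by simp
qed

lemma complement_exists:
  assumes "subspace W" "subspace K" "K \<subseteq> W"
  obtains B where "independent B" "finite B" "B \<subseteq> W" "span B \<inter> K = {0}" "card B + dim K = dim W"
    "\<forall>w\<in>W. \<exists>b\<in>span B. \<exists>k\<in>K. w = b + k"
proof -
  obtain C where C: "C \<subseteq> K" "independent C" "K \<subseteq> span C" "card C = dim K"
    using basis_exists by blast
  obtain D where D: "C \<subseteq> D" "D \<subseteq> W" "independent D" "W \<subseteq> span D"
    using maximal_independent_subset_extend[of C W] C assms(3) by blast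
  have fin: "finite D" using D(3) by (rule finiteI_independent)
  have spC: "span C = K" using C assms(2) by (intro span_subspace)
  have spD: "span D = W" using D assms(1) by (intro span_subspace)
  have Un: "(D - C) \<union> C = D" using D(1) by blast
  have int: "span (D - C) \<inter> K = {0}"
  proof -
    have "{x + y |x y. x \<in> span (D - C) \<and> y \<in> span C} = span D"
      using span_Un[of "D - C" C] Un by simp
    then have "dim (span D) + dim (span (D - C) \<inter> span C) = dim (span (D - C)) + dim (span C)"
      using dim_sums_Int[of "span (D - C)" "span C"] by simp
    moreover have "dim (span D) = card D" "dim (span C) = card C" "dim (span (D - C)) = card (D - C)"
      using D(3) C(2) independent_mono[OF D(3), of "D - C"] by (auto simp: dim_eq_card_independent)
    moreover have "card D = card (D - C) + card C"
      using card_Diff_subset[of C D] D(1) fin finite_subset card_mono[OF fin D(1)] by fastforce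
    ultimately have "dim (span (D - C) \<inter> span C) = 0" by simp
    then have "span (D - C) \<inter> span C \<subseteq> {0}" by simp
    then show ?thesis using spC span_zero by (metis IntI subset_antisym insert_subset empty_subsetI)
  qed
  have "card (D - C) + dim K = dim W"
    using card_Diff_subset[of C D] D(1) fin finite_subset[OF D(1) fin] card_mono[OF fin D(1)] C(4)
      basis_card_eq_dim[OF D(2,4,3)] by simp
  moreover have "\<forall>w\<in>W. \<exists>b\<in>span (D - C). \<exists>k\<in>K. w = b + k"
    using span_Un[of "D - C" C] Un spC spD by auto
  ultimately show ?thesis
    using that[of "D - C"] int D fin independent_mono[OF D(3), of "D - C"] by blast
qed

text \<open>Eigenvectors to distinct eigenvalues are independent, because \<open>T - d\<close> kills
  the term of \<open>d\<close> and rescales the others by nonzero factors. So there are at most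
  \<open>dimension\<close> eigenvalues.\<close>

lemma finite_eigenvalues:
  assumes "Vector_Spaces.linear scale scale T"
  shows "finite {c. \<exists>v. v \<noteq> 0 \<and> T v = scale c v}" (is "finite ?E")
proof -
  interpret T: Vector_Spaces.linear scale scale T by fact
  define ev where "ev c = (SOME v. v \<noteq> 0 \<and> T v = scale c v)" for c
  have ev: "ev c \<noteq> 0 \<and> T (ev c) = scale c (ev c)" if "c \<in> ?E" for c
    using someI_ex[of "\<lambda>v. v \<noteq> 0 \<and> T v = scale c v"] that unfolding ev_def by blast
  have ind: "\<forall>a. (\<Sum>c\<in>F. scale (a c) (ev c)) = 0 \<longrightarrow> (\<forall>c\<in>F. a c = 0)" if "finite F" "F \<subseteq> ?E" for F
    using that
  proof (induction F rule: finite_induct)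
    case empty
    then show ?case by simp
  next
    case (insert d F)
    show ?case
    proof (intro allI impI)
      fix a assume z: "(\<Sum>c\<in>insert d F. scale (a c) (ev c)) = 0"
      have "T (\<Sum>c\<in>insert d F. scale (a c) (ev c)) = (\<Sum>c\<in>insert d F. scale (c * a c) (ev c))"
        unfolding T.sum
      proof (rule sum.cong)
        fix c assume "c \<in> insert d F"
        then have "T (ev c) = scale c (ev c)" using insert.prems ev by blast
        then show "T (scale (a c) (ev c)) = scale (c * a c) (ev c)"
          by (simp add: T.scale mult.commute)
      qed simp
      then have "(\<Sum>c\<in>insert d F. scale (c * a c) (ev c)) = 0"
        using z by (simp add: T.zero)
      moreover have "(\<Sum>c\<in>insert d F. scale (d * a c) (ev c)) = 0"
        using z by (simp only: scale_scale[symmetric] scale_sum_right[symmetric] scale_zero_right)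
      ultimately have "(\<Sum>c\<in>insert d F. scale ((c - d) * a c) (ev c)) = 0"
        by (simp only: left_diff_distrib scale_left_diff_distrib sum_subtractf diff_self)
      then have "(\<Sum>c\<in>F. scale ((c - d) * a c) (ev c)) = 0"
        using insert.hyps by simp
      then have "\<forall>c\<in>F. (c - d) * a c = 0"
        using insert.IH[rule_format, of "\<lambda>c. (c - d) * a c"] insert.prems by blast
      then have F: "\<forall>c\<in>F. a c = 0" using insert.hyps by auto
      then have "scale (a d) (ev d) = 0" using z insert.hyps by simp
      moreover have "ev d \<noteq> 0" using ev insert.prems by blast
      ultimately show "\<forall>c\<in>insert d F. a c = 0" using F by simp
    qed
  qed
  show ?thesis
  proof (rule ccontr)
    assume "infinite ?E"
    then obtain F where F: "F \<subseteq> ?E" "finite F" "card F = Suc dimension"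
      using infinite_arbitrarily_large by blast
    have inj: "inj_on ev F" and "independent (ev ` F)"
      using independent_family[OF F(2), of ev] ind[OF F(2,1)] by blast+
    then have "card (ev ` F) \<le> dimension"
      using independent_card_le_dim[of "ev ` F" UNIV] dimension_def by simp
    then show False using F card_image[OF inj] by simp
  qed
qed

text \<open>Writing the perturbation as \<open>b i = T (a i)\<close>, a dependency at the parameter \<open>s\<close> yields an
  eigenvector of \<open>T\<close> with eigenvalue \<open>- 1 / s\<close>.\<close>
lemma finite_dependent_perturbation:
  assumes I: "finite I" and a: "\<And>c. (\<Sum>i\<in>I. scale (c i) (a i)) = 0 \<Longrightarrow> \<forall>i\<in>I. c i = 0"
  shows "finite {s. \<exists>c. (\<Sum>i\<in>I. scale (c i) (a i + scale s (b i))) = 0 \<and> (\<exists>i\<in>I. c i \<noteq> 0)}"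
proof -
  have inj: "inj_on a I" and ind: "independent (a ` I)"
    using independent_family[OF I a] by auto
  interpret p: vector_space_pair scale scale by unfold_locales
  obtain T where T: "Vector_Spaces.linear scale scale T" "\<forall>x\<in>a ` I. T x = b (the_inv_into I a x)"
    using p.linear_independent_extend[OF ind, of "\<lambda>x. b (the_inv_into I a x)"] by blast
  interpret T: Vector_Spaces.linear scale scale T by fact
  have Ta: "T (a i) = b i" if "i \<in> I" for i
    using T(2) that the_inv_into_f_f[OF inj] by auto
  have "{s. \<exists>c. (\<Sum>i\<in>I. scale (c i) (a i + scale s (b i))) = 0 \<and> (\<exists>i\<in>I. c i \<noteq> 0)}
      \<subseteq> (\<lambda>c. - inverse c) ` {c. \<exists>v. v \<noteq> 0 \<and> T v = scale c v}"
  proof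
    fix s assume "s \<in> {s. \<exists>c. (\<Sum>i\<in>I. scale (c i) (a i + scale s (b i))) = 0 \<and> (\<exists>i\<in>I. c i \<noteq> 0)}"
    then obtain c where c: "(\<Sum>i\<in>I. scale (c i) (a i + scale s (b i))) = 0" "\<exists>i\<in>I. c i \<noteq> 0" by blast
    define v where "v = (\<Sum>i\<in>I. scale (c i) (a i))"
    have v: "v \<noteq> 0" using a c(2) unfolding v_def by blast
    have "T v = (\<Sum>i\<in>I. scale (c i) (b i))"
      unfolding v_def T.sum by (rule sum.cong) (auto simp: T.scale Ta)
    moreover have "(\<Sum>i\<in>I. scale (c i) (a i + scale s (b i))) = v + scale s (\<Sum>i\<in>I. scale (c i) (b i))"
      unfolding v_def by (simp add: scale_right_distrib sum.distrib scale_sum_right mult.commute)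
    ultimately have e: "v + scale s (T v) = 0" using c(1) by simp
    then have s: "s \<noteq> 0" using v by auto
    have "scale (- inverse s) v = scale (- inverse s) (v + scale s (T v)) + T v"
      using s by (simp add: scale_right_distrib)
    then have "T v = scale (- inverse s) v" using e by simp
    moreover have "s = - inverse (- inverse s)" using s by (simp add: field_simps)
    ultimately show "s \<in> (\<lambda>c. - inverse c) ` {c. \<exists>v. v \<noteq> 0 \<and> T v = scale c v}"
      using v by blast
  qed
  then show ?thesis
    using finite_eigenvalues[OF T(1)] finite_subset finite_imageI by blast
qed

end

section \<open>Square matrices as a vector space\<close>

lemma smat_nth [simp]: "smat c A $ i $ j = c * A $ i $ j"
  by (simp add: smat_def)

definition mat_unit :: "'m::finite \<Rightarrow> 'm \<Rightarrow> 'k::field^'m^'m" where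
  "mat_unit i j = (\<chi> a b. if a = i \<and> b = j then 1 else 0)"

lemma mat_unit_nth [simp]: "mat_unit i j $ a $ b = (if a = i \<and> b = j then 1 else 0)"
  by (simp add: mat_unit_def)

lemma vector_space_smat: "vector_space (smat :: 'k::field \<Rightarrow> 'k^'m^'m \<Rightarrow> 'k^'m^'m)"
  by unfold_locales (simp_all add: vec_eq_iff algebra_simps)

interpretation mat: vector_space "smat :: 'k::field \<Rightarrow> 'k^'m^'m \<Rightarrow> 'k^'m^'m"
  by (rule vector_space_smat)

lemma mat_expand:
  "(A :: 'k::field^'m^'m) = (\<Sum>(i,j)\<in>UNIV. smat (A $ i $ j) (mat_unit i j))"
proof -
  have "(\<Sum>p\<in>UNIV. case p of (i, j) \<Rightarrow> smat (A $ i $ j) (mat_unit i j)) $ a $ b = A $ a $ b" for a b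
  proof -
    have "(\<Sum>p\<in>UNIV. case p of (i, j) \<Rightarrow> smat (A $ i $ j) (mat_unit i j)) $ a $ b
        = (\<Sum>p\<in>UNIV. if p = (a, b) then A $ a $ b else 0)"
      unfolding sum_component by (rule sum.cong) (auto split: prod.splits)
    then show ?thesis by simp
  qed
  then show ?thesis by (simp add: vec_eq_iff)
qed

interpretation mat: finite_dimensional_vector_space
  "smat :: 'k::field \<Rightarrow> 'k^'m^'m \<Rightarrow> 'k^'m^'m" "(\<lambda>(i, j). mat_unit i j) ` UNIV"
proof
  let ?B = "(\<lambda>(i, j). mat_unit i j :: 'k^'m^'m) ` UNIV"
  have inj: "inj (\<lambda>(i, j). mat_unit i j :: 'k^'m^'m)"
    by (auto simp: inj_on_def vec_eq_iff split: if_splits)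
  show "finite ?B" by simp
  show "mat.independent ?B"
  proof (rule mat.independent_if_scalars_zero)
    fix f x assume s: "(\<Sum>x\<in>?B. smat (f x) x) = 0" and x: "x \<in> ?B"
    from x obtain a b where ab: "x = mat_unit a b" by auto
    have "(\<Sum>x\<in>?B. smat (f x) x) = (\<Sum>(i,j)\<in>UNIV. smat (f (mat_unit i j)) (mat_unit i j))"
      unfolding sum.reindex[OF inj] by (simp add: comp_def case_prod_unfold)
    then have "(\<Sum>(i,j)\<in>UNIV. smat (f (mat_unit i j)) (mat_unit i j)) $ a $ b = 0"
      using s by simp
    moreover have "(\<Sum>(i,j)\<in>UNIV. smat (f (mat_unit i j)) (mat_unit i j)) $ a $ b
        = (\<Sum>p\<in>UNIV. if p = (a, b) then f (mat_unit a b) else 0)"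
      unfolding sum_component by (rule sum.cong) (auto split: prod.splits)
    ultimately show "f x = 0" using ab by simp
  qed simp
  show "mat.span ?B = UNIV"
  proof -
    have "A \<in> mat.span ?B" for A :: "'k^'m^'m"
      by (subst mat_expand, rule mat.span_sum) (auto intro: mat.span_scale[OF mat.span_base])
    then show ?thesis by blast
  qed
qed

lemma lin_indep_iff: "lin_indep S \<longleftrightarrow> mat.independent S"
proof
  assume "lin_indep S"
  then show "mat.independent S"
    unfolding lin_indep_def by (intro mat.independent_if_scalars_zero) auto
next
  assume i: "mat.independent S"
  then have f: "finite S" by (rule mat.finiteI_independent)
  show "lin_indep S"
    unfolding lin_indep_def using f mat.independentD[OF i f order.refl] by blast
qed

lemma mdim_eq_dim: "mdim W = mat.dim W"
proof -
  obtain B where B: "B \<subseteq> W" "mat.independent B" "W \<subseteq> mat.span B" "card B = mat.dim W"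
    using mat.basis_exists by blast
  have le: "card S \<le> mat.dim W" if "S \<subseteq> W" "lin_indep S" for S
    using that mat.independent_card_le_dim by (simp add: lin_indep_iff)
  then have "finite {card S |S. S \<subseteq> W \<and> lin_indep S}"
    by (intro finite_subset[OF _ finite_atMost[of "mat.dim W"]]) auto
  then show ?thesis
    unfolding mdim_def using B le by (intro Max_eqI) (auto simp: lin_indep_iff intro!: exI[of _ B])
qed

section \<open>Chains of irreducible sets\<close>

text \<open>The monomial in \<open>f 0, \<dots>, f (k - 1)\<close> whose exponents are the digits of \<open>N\<close> to the base \<open>m\<close>.\<close>
fun chain_monom :: "nat \<Rightarrow> (nat \<Rightarrow> 'p \<Rightarrow> 'k::field) \<Rightarrow> nat \<Rightarrow> nat \<Rightarrow> 'p \<Rightarrow> 'k" where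
  "chain_monom m f 0 N p = 1"
| "chain_monom m f (Suc k) N p = chain_monom m f k (N mod m ^ k) p * f k p ^ (N div m ^ k)"

definition subalgebra :: "('p \<Rightarrow> 'k::field) set \<Rightarrow> bool" where
  "subalgebra A \<longleftrightarrow> (\<forall>c. (\<lambda>p. c) \<in> A) \<and> (\<forall>f\<in>A. \<forall>g\<in>A. (\<lambda>p. f p + g p) \<in> A \<and> (\<lambda>p. f p * g p) \<in> A)"

lemma subalgebra_sum:
  assumes "subalgebra A" "\<And>i. i \<in> I \<Longrightarrow> f i \<in> A"
  shows "(\<lambda>p. \<Sum>i\<in>I. f i p) \<in> A"
  using assms(2)
proof (induction I rule: infinite_finite_induct)
  case (insert i I)
  then show ?case using assms(1) by (simp add: subalgebra_def)
qed (use assms(1) in \<open>auto simp: subalgebra_def\<close>)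

lemma subalgebra_power:
  assumes "subalgebra A" "f \<in> A"
  shows "(\<lambda>p. f p ^ n) \<in> A"
  by (induction n) (use assms in \<open>auto simp: subalgebra_def\<close>)

text \<open>Splits off the leading digit \<open>j\<close> of \<open>N = j * n + l\<close>; for
  \<open>n = m ^ k\<close> this follows the recursion of \<open>chain_monom\<close>.\<close>

lemma sum_lessThan_mult:
  fixes g :: "nat \<Rightarrow> 'a::comm_monoid_add"
  shows "(\<Sum>N<m * n. g N) = (\<Sum>j<m. \<Sum>l<n. g (j * n + l))"
proof -
  have "(\<Sum>N\<in>{j * n..<j * n + n}. g N) = (\<Sum>l<n. g (j * n + l))" for j
    by (subst sum.atLeastLessThan_shift_0) (simp add: comp_def lessThan_atLeast0)
  then show ?thesis by (simp add: sum.nat_group[symmetric])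
qed

text \<open>As \<open>Z k\<close> is irreducible and \<open>f (k - 1)\<close> does not vanish on it, that function can be cancelled from a
  relation; restricting to \<open>Z (k - 1)\<close>, where it vanishes, kills all terms that still contain it.\<close>
lemma chain_monom_independent:
  fixes Z :: "nat \<Rightarrow> 'p set" and f :: "nat \<Rightarrow> 'p \<Rightarrow> 'k::field"
  assumes A: "subalgebra A"
    and prime: "\<And>i g h. i \<le> k \<Longrightarrow> g \<in> A \<Longrightarrow> h \<in> A \<Longrightarrow> \<forall>p\<in>Z i. g p * h p = 0 \<Longrightarrow>
      (\<forall>p\<in>Z i. g p = 0) \<or> (\<forall>p\<in>Z i. h p = 0)"
    and fA: "\<And>i. i < k \<Longrightarrow> f i \<in> A"
    and fz: "\<And>i p. i < k \<Longrightarrow> p \<in> Z i \<Longrightarrow> f i p = 0"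
    and fnz: "\<And>i. i < k \<Longrightarrow> \<exists>p\<in>Z (Suc i). f i p \<noteq> 0"
    and mono: "\<And>i. i < k \<Longrightarrow> Z i \<subseteq> Z (Suc i)"
    and ne: "Z 0 \<noteq> {}" and m: "m > 0"
    and eq: "\<And>p. p \<in> Z k \<Longrightarrow> (\<Sum>N<m ^ k. c N * chain_monom m f k N p) = 0"
  shows "\<forall>N<m ^ k. c N = 0"
  using prime fA fz fnz mono eq
proof (induction k arbitrary: c)
  case 0
  then show ?case using ne by auto
next
  case (Suc k)
  define n where "n = m ^ k"
  have n: "n > 0" using m by (simp add: n_def)
  \<comment> \<open>The coefficient of \<open>f k ^ j\<close> in the relation; it involves only the
    functions below \<open>f k\<close>.\<close>
  define P where "P j p = (\<Sum>l<n. c (j * n + l) * chain_monom m f k l p)" for j p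
  have mA: "i \<le> k \<Longrightarrow> (\<lambda>p. chain_monom m f i N p) \<in> A" for i N
  proof (induction i arbitrary: N)
    case 0
    then show ?case using A by (simp add: subalgebra_def)
  next
    case (Suc i)
    then have "(\<lambda>p. f i p ^ (N div m ^ i)) \<in> A"
      using Suc.prems \<open>\<And>i. i < Suc k \<Longrightarrow> f i \<in> A\<close> by (intro subalgebra_power[OF A]) auto
    then show ?case using Suc A by (simp add: subalgebra_def)
  qed
  have PA: "P j \<in> A" for j
  proof -
    have "(\<lambda>p. c (j * n + l) * chain_monom m f k l p) \<in> A" for l
    proof -
      have "(\<lambda>p. c (j * n + l)) \<in> A" "chain_monom m f k l \<in> A"
        using A mA[of k l] by (auto simp: subalgebra_def)
      then show ?thesis using A by (simp add: subalgebra_def)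
    qed
    then have "(\<lambda>p. \<Sum>l<n. c (j * n + l) * chain_monom m f k l p) \<in> A"
      by (intro subalgebra_sum[OF A])
    then show ?thesis by (simp add: P_def[abs_def])
  qed
  have sumP: "(\<Sum>j<m. f k p ^ j * P j p) = 0" if "p \<in> Z (Suc k)" for p
  proof -
    have "(\<Sum>N<m ^ Suc k. c N * chain_monom m f (Suc k) N p)
        = (\<Sum>j<m. \<Sum>l<n. c (j * n + l) * chain_monom m f (Suc k) (j * n + l) p)"
      by (simp add: n_def[symmetric] sum_lessThan_mult del: chain_monom.simps)
    also have "\<dots> = (\<Sum>j<m. f k p ^ j * P j p)"
      unfolding P_def sum_distrib_left
      by (intro sum.cong refl) (simp add: n_def[symmetric] algebra_simps)
    finally show ?thesis using Suc.prems(6)[OF that] by simp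
  qed
  have c0: "\<forall>l<n. c (j * n + l) = 0" if "j < m" for j
    using that
  proof (induction j rule: less_induct)
    case (less j)
    \<comment> \<open>Once the coefficients below \<open>j\<close> are known to vanish, the relation
      reads \<open>f k ^ j * (P j + f k * R) = 0\<close> on \<open>Z (Suc k)\<close>.\<close>
    define R where "R p = (\<Sum>i\<in>{Suc j..<m}. f k p ^ (i - Suc j) * P i p)" for p
    have fk: "f k \<in> A" using Suc.prems(2) by simp
    have "(\<lambda>p. f k p ^ (i - Suc j) * P i p) \<in> A" for i
      using subalgebra_power[OF A fk] PA A by (simp add: subalgebra_def)
    then have RA: "R \<in> A"
      unfolding R_def[abs_def] by (intro subalgebra_sum[OF A])
    have hA: "(\<lambda>p. P j p + f k p * R p) \<in> A"
    proof -
      have "(\<lambda>p. f k p * R p) \<in> A" using fk RA A by (simp add: subalgebra_def)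
      then show ?thesis using PA A by (simp add: subalgebra_def)
    qed
    have P0: "P i p = 0" if "i < j" for i p
      using less.IH[OF that] less.prems that by (simp add: P_def)
    have "f k p ^ j * (P j p + f k p * R p) = 0" if "p \<in> Z (Suc k)" for p
    proof -
      have "(\<Sum>i<m. f k p ^ i * P i p) = (\<Sum>i\<in>{j..<m}. f k p ^ i * P i p)"
        by (rule sum.mono_neutral_right) (auto simp: P0)
      also have "\<dots> = f k p ^ j * P j p + (\<Sum>i\<in>{Suc j..<m}. f k p ^ i * P i p)"
        using less.prems by (simp add: sum.atLeast_Suc_lessThan)
      also have "(\<Sum>i\<in>{Suc j..<m}. f k p ^ i * P i p) = f k p ^ j * (f k p * R p)"
        unfolding R_def sum_distrib_left
      proof (rule sum.cong)
        fix i assume "i \<in> {Suc j..<m}"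
        then have "i = j + Suc (i - Suc j)" by simp
        then have "f k p ^ i = f k p ^ j * (f k p * f k p ^ (i - Suc j))"
          by (metis power_add power_Suc)
        then show "f k p ^ i * P i p = f k p ^ j * (f k p * (f k p ^ (i - Suc j) * P i p))"
          by (simp only: mult.assoc)
      qed simp
      finally show ?thesis using sumP[OF that] by (simp add: distrib_left)
    qed
    then have "(\<forall>p\<in>Z (Suc k). f k p ^ j = 0) \<or> (\<forall>p\<in>Z (Suc k). P j p + f k p * R p = 0)"
      using Suc.prems(1)[OF order.refl subalgebra_power[OF A fk] hA] by blast
    moreover have "\<not> (\<forall>p\<in>Z (Suc k). f k p ^ j = 0)"
      using Suc.prems(4)[of k] by auto
    ultimately have h0: "\<forall>p\<in>Z (Suc k). P j p + f k p * R p = 0" by blast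
    have "P j p = 0" if "p \<in> Z k" for p
    proof -
      have "p \<in> Z (Suc k)" "f k p = 0"
        using Suc.prems(5)[of k] Suc.prems(3)[of k p] that by auto
      then show ?thesis using h0 by auto
    qed
    then have "\<forall>l<m ^ k. c (j * n + l) = 0"
      unfolding P_def n_def using Suc.prems by (intro Suc.IH) (auto simp: n_def)
    then show ?case by (simp add: n_def)
  qed
  show ?case
  proof (intro allI impI)
    fix N assume N: "N < m ^ Suc k"
    have "N div n < m" using N n by (simp add: n_def less_mult_imp_div_less)
    moreover have "N mod n < n" using n by simp
    ultimately have "c (N div n * n + N mod n) = 0" using c0 by blast
    then show "c N = 0" by simp
  qed
qed

section \<open>Functions of bounded degree on a set\<close>

definition fscale :: "'k::field \<Rightarrow> ('p \<Rightarrow> 'k) \<Rightarrow> 'p \<Rightarrow> 'k" where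
  "fscale c f p = c * f p"

interpretation fn: vector_space "fscale :: 'k::field \<Rightarrow> ('p \<Rightarrow> 'k) \<Rightarrow> 'p \<Rightarrow> 'k"
  by unfold_locales (auto simp: fscale_def fun_eq_iff algebra_simps)

lemma sum_fun_apply: "(\<Sum>i\<in>I. f i) p = (\<Sum>i\<in>I. f i p)" for f :: "'i \<Rightarrow> 'p \<Rightarrow> 'k::comm_monoid_add"
  by (induction I rule: infinite_finite_induct) auto

text \<open>In the application \<open>x1\<close> and \<open>x2\<close> are the coordinates along the
  plane, \<open>y b\<close> the remaining ones, and \<open>S\<close> is the singular set.\<close>

locale plane_coords =
  fixes S :: "'p set" and x1 x2 :: "'p \<Rightarrow> 'k::field" and B :: "'b set" and y :: "'b \<Rightarrow> 'p \<Rightarrow> 'k"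
  assumes finite_B: "finite B"
begin

definition Mon :: "nat \<Rightarrow> nat \<Rightarrow> ('b \<Rightarrow> nat) \<Rightarrow> 'p \<Rightarrow> 'k" where
  "Mon i j a p = x1 p ^ i * x2 p ^ j * (\<Prod>b\<in>B. y b p ^ a b)"

definition Mons :: "nat \<Rightarrow> nat \<Rightarrow> ('p \<Rightarrow> 'k) set" where
  "Mons D m = {Mon i j a | i j a. i + j < D \<and> i + j + sum a B \<le> m}"

text \<open>Functions that agree on \<open>S\<close> with a polynomial of degree at most \<open>m\<close> whose degree in \<open>x1, x2\<close> is
  strictly less than \<open>D\<close>, so that \<open>low 0 m\<close> consists of the functions vanishing on \<open>S\<close>.\<close>
definition low :: "nat \<Rightarrow> nat \<Rightarrow> ('p \<Rightarrow> 'k) set" where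
  "low D m = {f. \<exists>g\<in>fn.span (Mons D m). \<forall>p\<in>S. f p = g p}"

lemma lowI: "g \<in> fn.span (Mons D m) \<Longrightarrow> (\<And>p. p \<in> S \<Longrightarrow> f p = g p) \<Longrightarrow> f \<in> low D m"
  by (auto simp: low_def)

lemma low_cong: "f \<in> low D m \<Longrightarrow> (\<And>p. p \<in> S \<Longrightarrow> g p = f p) \<Longrightarrow> g \<in> low D m"
  by (auto simp: low_def)

lemma low_mono: "f \<in> low D m \<Longrightarrow> D \<le> D' \<Longrightarrow> m \<le> m' \<Longrightarrow> f \<in> low D' m'"
proof -
  assume f: "f \<in> low D m" "D \<le> D'" "m \<le> m'"
  then have "Mons D m \<subseteq> Mons D' m'" by (fastforce simp: Mons_def)
  then have "fn.span (Mons D m) \<subseteq> fn.span (Mons D' m')" by (rule fn.span_mono)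
  then show ?thesis using f(1) by (auto simp: low_def)
qed

lemma low_zero: "(\<And>p. p \<in> S \<Longrightarrow> f p = 0) \<Longrightarrow> f \<in> low D m"
  by (rule lowI[OF fn.span_zero]) simp

lemma low_add: "f \<in> low D m \<Longrightarrow> g \<in> low D m \<Longrightarrow> (\<lambda>p. f p + g p) \<in> low D m"
proof -
  assume "f \<in> low D m" "g \<in> low D m"
  then obtain f' g' where "f' \<in> fn.span (Mons D m)" "\<forall>p\<in>S. f p = f' p"
    "g' \<in> fn.span (Mons D m)" "\<forall>p\<in>S. g p = g' p" by (auto simp: low_def)
  then show ?thesis by (intro lowI[of "f' + g'"] fn.span_add) auto
qed

lemma low_scale: "f \<in> low D m \<Longrightarrow> (\<lambda>p. c * f p) \<in> low D m"
proof -
  assume "f \<in> low D m"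
  then obtain f' where "f' \<in> fn.span (Mons D m)" "\<forall>p\<in>S. f p = f' p" by (auto simp: low_def)
  then show ?thesis by (intro lowI[of "fscale c f'"] fn.span_scale) (auto simp: fscale_def)
qed

lemma low_sum: "(\<And>i. i \<in> I \<Longrightarrow> f i \<in> low D m) \<Longrightarrow> (\<lambda>p. \<Sum>i\<in>I. f i p) \<in> low D m"
  by (induction I rule: infinite_finite_induct) (auto intro: low_zero low_add)

lemma Mon_mult: "Mon i j a p * Mon i' j' a' p = Mon (i + i') (j + j') (\<lambda>b. a b + a' b) p"
  by (simp add: Mon_def power_add prod.distrib algebra_simps)

text \<open>One degree bound is weak (at most \<open>D\<close>) and one strict (below
  \<open>D'\<close>), so their sum is strict again. In this form the case \<open>D' = 0\<close>, a
  factor equal to zero, needs no exception.\<close>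

lemma span_Mons_mult:
  assumes "f \<in> fn.span (Mons (Suc D) m)" "g \<in> fn.span (Mons D' m')"
  shows "(\<lambda>p. f p * g p) \<in> fn.span (Mons (D + D') (m + m'))"
  using assms(1)
proof (induction rule: fn.span_induct_alt)
  case base
  then show ?case using fn.span_zero by (simp add: zero_fun_def)
next
  case (step c f h)
  have "(\<lambda>p. f p * g p) \<in> fn.span (Mons (D + D') (m + m'))"
    using assms(2)
  proof (induction rule: fn.span_induct_alt)
    case base
    then show ?case using fn.span_zero by (simp add: zero_fun_def)
  next
    case (step c' g h)
    from \<open>f \<in> Mons (Suc D) m\<close> obtain i j a where
      f: "f = Mon i j a" "i + j < Suc D" "i + j + sum a B \<le> m" by (auto simp: Mons_def)
    from \<open>g \<in> Mons D' m'\<close> obtain i' j' a' where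
      g: "g = Mon i' j' a'" "i' + j' < D'" "i' + j' + sum a' B \<le> m'" by (auto simp: Mons_def)
    have "(\<lambda>p. f p * g p) \<in> Mons (D + D') (m + m')"
      unfolding Mons_def mem_Collect_eq
      by (rule exI[of _ "i + i'"], rule exI[of _ "j + j'"], rule exI[of _ "\<lambda>b. a b + a' b"])
        (use f g in \<open>auto simp: Mon_mult sum.distrib\<close>)
    then have "fscale c' (\<lambda>p. f p * g p) + (\<lambda>p. f p * h p) \<in> fn.span (Mons (D + D') (m + m'))"
      using step by (intro fn.span_add[OF fn.span_scale[OF fn.span_base]])
    moreover have "fscale c' (\<lambda>p. f p * g p) + (\<lambda>p. f p * h p) = (\<lambda>p. f p * (fscale c' g + h) p)"
      by (rule ext) (simp add: fscale_def algebra_simps)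
    ultimately show ?case by (simp only:)
  qed
  then have "fscale c (\<lambda>p. f p * g p) + (\<lambda>p. h p * g p) \<in> fn.span (Mons (D + D') (m + m'))"
    using step by (intro fn.span_add fn.span_scale)
  moreover have "fscale c (\<lambda>p. f p * g p) + (\<lambda>p. h p * g p) = (\<lambda>p. (fscale c f + h) p * g p)"
    by (rule ext) (simp add: fscale_def algebra_simps)
  ultimately show ?case by (simp only:)
qed

lemma low_mult: "f \<in> low (Suc D) m \<Longrightarrow> g \<in> low D' m' \<Longrightarrow> (\<lambda>p. f p * g p) \<in> low (D + D') (m + m')"
proof -
  assume "f \<in> low (Suc D) m" "g \<in> low D' m'"
  then obtain f' g' where "f' \<in> fn.span (Mons (Suc D) m)" "\<forall>p\<in>S. f p = f' p"
    "g' \<in> fn.span (Mons D' m')" "\<forall>p\<in>S. g p = g' p" by (auto simp: low_def)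
  then show ?thesis by (intro lowI[OF span_Mons_mult, of f' D m g']) auto
qed

lemma low_Mon: "i + j < D \<Longrightarrow> i + j + sum a B \<le> m \<Longrightarrow> Mon i j a \<in> low D m"
  by (rule lowI[OF fn.span_base]) (auto simp: Mons_def)

lemma low_const: "0 < D \<Longrightarrow> (\<lambda>p. c) \<in> low D m"
  using low_scale[OF low_Mon[of 0 0 D "\<lambda>_. 0" m], of c] by (simp add: Mon_def)

lemma low_x1: "1 < D \<Longrightarrow> 0 < m \<Longrightarrow> x1 \<in> low D m"
  using low_Mon[of 1 0 D "\<lambda>_. 0" m] by (simp add: Mon_def[abs_def])

lemma low_x2: "1 < D \<Longrightarrow> 0 < m \<Longrightarrow> x2 \<in> low D m"
  using low_Mon[of 0 1 D "\<lambda>_. 0" m] by (simp add: Mon_def[abs_def])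

lemma low_y: "b \<in> B \<Longrightarrow> 0 < D \<Longrightarrow> 0 < m \<Longrightarrow> y b \<in> low D m"
proof -
  assume b: "b \<in> B" "0 < D" "0 < m"
  have "(\<Prod>b'\<in>B. y b' p ^ (if b' = b then 1 else 0)) = y b p" for p
    using b finite_B by (simp add: if_distrib[of "\<lambda>n. _ ^ n"] prod.delta cong: if_cong)
  then have "y b = Mon 0 0 (\<lambda>b'. if b' = b then 1 else 0)"
    by (simp add: Mon_def fun_eq_iff)
  moreover have "sum (\<lambda>b'. if b' = b then 1 else 0 :: nat) B \<le> m" using b finite_B by simp
  ultimately show ?thesis using low_Mon[of 0 0 D "\<lambda>b'. if b' = b then 1 else 0" m] b by simp
qed

lemma low_power:
  assumes "f \<in> low (Suc D) m"
  shows "(\<lambda>p. f p ^ n) \<in> low (Suc (n * D)) (n * m)"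
proof (induction n)
  case 0
  then show ?case using low_const[of 1 1 0] by simp
next
  case (Suc n)
  then show ?case using low_mult[OF assms Suc] by (simp add: algebra_simps)
qed

text \<open>The reduced monomials: both exponents along the plane are below the constant
  \<open>M\<close>, so only the \<open>card B\<close> other exponents can grow with
  \<open>m\<close>.\<close>

definition red_gens :: "nat \<Rightarrow> nat \<Rightarrow> ('p \<Rightarrow> 'k) set" where
  "red_gens M m = (\<lambda>((i, j), a). Mon i j a) ` (({..<M} \<times> {..<M}) \<times> (B \<rightarrow>\<^sub>E {..m}))"

lemma finite_red_gens: "finite (red_gens M m)"
  unfolding red_gens_def by (intro finite_imageI finite_cartesian_product finite_PiE finite_B) auto

lemma card_red_gens: "card (red_gens M m) \<le> M * M * (m + 1) ^ card B"
proof -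
  have fin: "finite (({..<M} \<times> {..<M}) \<times> (B \<rightarrow>\<^sub>E {..m}))"
    by (intro finite_cartesian_product finite_PiE finite_B) auto
  have "card (red_gens M m) \<le> card (({..<M} \<times> {..<M}) \<times> (B \<rightarrow>\<^sub>E {..m}))"
    unfolding red_gens_def by (rule card_image_le[OF fin])
  also have "\<dots> = M * M * (m + 1) ^ card B"
    using finite_B by (simp add: card_cartesian_product card_PiE)
  finally show ?thesis .
qed

text \<open>If one of the two plane exponents of a monomial is at least \<open>M\<close>, its factor
  \<open>x1 ^ M\<close> or \<open>x2 ^ M\<close> is replaced by a function of plane degree below
  \<open>M\<close> and total degree at most \<open>M\<close>. The plane degree drops and the total
  degree does not rise, so induction on \<open>D\<close> ends at reduced monomials.\<close>

lemma low_reduce: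
  assumes x1: "(\<lambda>p. x1 p ^ M) \<in> low M M" and x2: "(\<lambda>p. x2 p ^ M) \<in> low M M"
  shows "f \<in> low D m \<Longrightarrow> \<exists>g\<in>fn.span (red_gens M m). \<forall>p\<in>S. f p = g p"
proof (induction D arbitrary: f)
  case 0
  then obtain g where g: "g \<in> fn.span (Mons 0 m)" "\<forall>p\<in>S. f p = g p" by (auto simp: low_def)
  have "Mons 0 m = {}" by (simp add: Mons_def)
  then have "g = 0" using g by simp
  then show ?case using g(2) fn.span_zero by (intro bexI[of _ 0]) auto
next
  case (Suc D)
  then obtain g where g: "g \<in> fn.span (Mons (Suc D) m)" "\<forall>p\<in>S. f p = g p" by (auto simp: low_def)
  from g(1) have "\<exists>h\<in>fn.span (red_gens M m). \<forall>p\<in>S. g p = h p"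
  proof (induction rule: fn.span_induct_alt)
    case base
    then show ?case using fn.span_zero by (intro bexI[of _ 0]) auto
  next
    case (step c u v)
    from step(1) obtain i j a where
      u: "u = Mon i j a" "i + j < Suc D" "i + j + sum a B \<le> m" by (auto simp: Mons_def)
    have "\<exists>h\<in>fn.span (red_gens M m). \<forall>p\<in>S. u p = h p"
    proof (cases "i < M \<and> j < M")
      case True
      have "a b \<le> m" if "b \<in> B" for b
        using member_le_sum[OF that, of a] finite_B u(3) by simp
      then have "restrict a B \<in> B \<rightarrow>\<^sub>E {..m}" by auto
      then have "Mon i j (restrict a B) \<in> red_gens M m"
        unfolding red_gens_def using True by (intro image_eqI[of _ _ "((i, j), restrict a B)"]) auto
      moreover have "Mon i j (restrict a B) = u" by (simp add: u(1) Mon_def fun_eq_iff)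
      ultimately show ?thesis using fn.span_base by blast
    next
      case False
      have low_D: "u \<in> low D m"
        if g: "(\<lambda>p. g p ^ M) \<in> low M M" and u': "\<And>p. u p = Mon i' j' a p * g p ^ M"
          and ij: "i' + j' + M = i + j" for g i' j'
      proof -
        have "(\<lambda>p. Mon i' j' a p * g p ^ M) \<in> low (i' + j' + M) (m - M + M)"
          using u ij by (intro low_mult g low_Mon) auto
        then have "(\<lambda>p. Mon i' j' a p * g p ^ M) \<in> low D m" by (rule low_mono) (use u ij in auto)
        then show ?thesis by (rule low_cong) (simp add: u')
      qed
      have "u \<in> low D m"
      proof (cases "i < M")
        case False
        then have "x1 p ^ (i - M) * x1 p ^ M = x1 p ^ i" for p by (simp flip: power_add)
        then show ?thesis
          using False by (intro low_D[OF x1, of "i - M" j]) (auto simp: u(1) Mon_def mult_ac)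
      next
        case True
        then have j: "M \<le> j" using \<open>\<not> (i < M \<and> j < M)\<close> by simp
        then have "x2 p ^ (j - M) * x2 p ^ M = x2 p ^ j" for p by (simp flip: power_add)
        then show ?thesis
          using j by (intro low_D[OF x2, of i "j - M"]) (auto simp: u(1) Mon_def mult_ac)
      qed
      then show ?thesis by (rule Suc.IH)
    qed
    then obtain h h' where h: "h \<in> fn.span (red_gens M m)" "\<forall>p\<in>S. u p = h p"
      "h' \<in> fn.span (red_gens M m)" "\<forall>p\<in>S. v p = h' p" using step by blast
    then show ?case
      by (intro bexI[of _ "fscale c h + h'"] fn.span_add fn.span_scale) (auto simp: fscale_def)
  qed
  then show ?case using g(2) by auto
qed

text \<open>There are \<open>k\<close> digits, each at most \<open>m\<close>, so the degree is
  linear in \<open>m\<close>.\<close>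

lemma low_chain_monom:
  assumes "\<And>i. i < k \<Longrightarrow> f i \<in> low (Suc D) D" "N < m ^ k"
  shows "chain_monom m f k N \<in> low (Suc (k * (m * D))) (k * (m * D))"
  using assms
proof (induction k arbitrary: N)
  case 0
  then show ?case using low_const[of 1 1 0] by (simp add: fun_eq_iff[symmetric])
next
  case (Suc k)
  have m: "m ^ k > 0" using Suc.prems(2) by (cases "m = 0") auto
  have "N div m ^ k \<le> m" using Suc.prems(2) m less_mult_imp_div_less[of N m "m ^ k"] by simp
  then have "N div m ^ k * D \<le> m * D" by simp
  then have "(\<lambda>p. f k p ^ (N div m ^ k)) \<in> low (Suc (m * D)) (m * D)"
    by (intro low_mono[OF low_power[OF Suc.prems(1)[of k]]]) auto
  moreover have "chain_monom m f k (N mod m ^ k) \<in> low (Suc (k * (m * D))) (k * (m * D))"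
    using Suc m by simp
  ultimately have "(\<lambda>p. chain_monom m f k (N mod m ^ k) p * f k p ^ (N div m ^ k))
      \<in> low (k * (m * D) + Suc (m * D)) (k * (m * D) + m * D)"
    by (intro low_mult)
  moreover have "chain_monom m f (Suc k) N = (\<lambda>p. chain_monom m f k (N mod m ^ k) p * f k p ^ (N div m ^ k))"
    by (simp add: fun_eq_iff)
  ultimately show ?case by (simp add: algebra_simps)
qed

text \<open>The \<open>m ^ k\<close> monomials are independent on \<open>Z k\<close>, yet lie in a
  space of dimension \<open>O(m ^ card B)\<close>; for large \<open>m\<close> this excludes
  \<open>k > card B\<close>.\<close>

lemma chain_length_le:
  fixes Z :: "nat \<Rightarrow> 'p set"
  assumes A: "subalgebra A"
    and prime: "\<And>i g h. i \<le> k \<Longrightarrow> g \<in> A \<Longrightarrow> h \<in> A \<Longrightarrow> \<forall>p\<in>Z i. g p * h p = 0 \<Longrightarrow>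
      (\<forall>p\<in>Z i. g p = 0) \<or> (\<forall>p\<in>Z i. h p = 0)"
    and fA: "\<And>i. i < k \<Longrightarrow> f i \<in> A"
    and fz: "\<And>i p. i < k \<Longrightarrow> p \<in> Z i \<Longrightarrow> f i p = 0"
    and fnz: "\<And>i. i < k \<Longrightarrow> \<exists>p\<in>Z (Suc i). f i p \<noteq> 0"
    and mono: "\<And>i. i < k \<Longrightarrow> Z i \<subseteq> Z (Suc i)"
    and ne: "Z 0 \<noteq> {}" and ZS: "Z k \<subseteq> S"
    and deg: "\<And>g. g \<in> A \<Longrightarrow> \<exists>D. g \<in> low (Suc D) D"
    and x1: "(\<lambda>p. x1 p ^ M) \<in> low M M" and x2: "(\<lambda>p. x2 p ^ M) \<in> low M M"
  shows "k \<le> card B"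
proof (rule ccontr)
  assume "\<not> k \<le> card B"
  then have k: "Suc (card B) \<le> k" by simp
  have "\<forall>i\<in>{..<k}. \<exists>D. f i \<in> low (Suc D) D" using deg fA by simp
  then obtain d where d: "\<And>i. i < k \<Longrightarrow> f i \<in> low (Suc (d i)) (d i)" by (metis lessThan_iff)
  define D where "D = (\<Sum>i<k. d i)"
  have fD: "f i \<in> low (Suc D) D" if "i < k" for i
  proof -
    have "d i \<le> D" unfolding D_def using that by (intro member_le_sum) auto
    then show ?thesis using low_mono[OF d[OF that]] by simp
  qed
  \<comment> \<open>Large enough that the constant \<open>M * M * (k * D + 1) ^ card B\<close> in
    front of \<open>m ^ card B\<close> is smaller than one further factor \<open>m\<close>.\<close>
  define m where "m = Suc (M * M * (k * D + 1) ^ card B)"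
  have m: "m > 0" by (simp add: m_def)
  \<comment> \<open>Reductions are valid on \<open>S\<close> only; cutting functions off outside
    \<open>S\<close> makes them identities in the space of all functions.\<close>
  define r where "r g p = (if p \<in> S then g p else 0)" for g :: "'p \<Rightarrow> 'k" and p
  define g where "g N = r (chain_monom m f k N)" for N
  define R where "R = r ` red_gens M (k * (m * D))"
  have r_lin: "r h \<in> fn.span R" if "h \<in> fn.span (red_gens M (k * (m * D)))" for h
    using that
  proof (induction rule: fn.span_induct_alt)
    case base
    have "r 0 = 0" by (simp add: r_def fun_eq_iff)
    then show ?case by (simp only: fn.span_zero)
  next
    case (step c u v)
    have "r (fscale c u + v) = fscale c (r u) + r v" by (auto simp: r_def fscale_def fun_eq_iff)
    moreover have "r u \<in> R" using step by (simp add: R_def)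
    ultimately show ?case
      using step fn.span_add[OF fn.span_scale[OF fn.span_base]] by (simp only:)
  qed
  have gR: "g N \<in> fn.span R" if N: "N < m ^ k" for N
  proof -
    obtain h where h: "h \<in> fn.span (red_gens M (k * (m * D)))" "\<forall>p\<in>S. chain_monom m f k N p = h p"
      using low_reduce[OF x1 x2 low_chain_monom[where f = f, OF fD N]] by blast
    then have "g N = r h" by (auto simp: g_def r_def fun_eq_iff)
    then show ?thesis using r_lin[OF h(1)] by simp
  qed
  have ind: "\<forall>N<m ^ k. c N = 0" if "(\<Sum>N<m ^ k. fscale (c N) (g N)) = 0" for c
  proof (rule chain_monom_independent[OF A prime fA fz fnz mono ne m])
    fix p assume p: "p \<in> Z k"
    have "(\<Sum>N<m ^ k. fscale (c N) (g N)) p = 0" using that by simp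
    then show "(\<Sum>N<m ^ k. c N * chain_monom m f k N p) = 0"
      using p ZS by (auto simp: sum_fun_apply fscale_def g_def r_def)
  qed
  have inj: "inj_on g {..<m ^ k}" and "fn.independent (g ` {..<m ^ k})"
    using fn.independent_family[of "{..<m ^ k}" g] ind by auto
  moreover have "g ` {..<m ^ k} \<subseteq> fn.span R" using gR by auto
  moreover have finR: "finite R" by (simp add: R_def finite_red_gens)
  ultimately have "card (g ` {..<m ^ k}) \<le> card R" using fn.independent_span_bound by blast
  also have "card R \<le> M * M * (k * (m * D) + 1) ^ card B"
    unfolding R_def using card_image_le[OF finite_red_gens] card_red_gens order.trans by blast
  also have "\<dots> \<le> M * M * (m * (k * D + 1)) ^ card B"
    using m by (intro mult_left_mono power_mono) (auto simp: algebra_simps)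
  also have "\<dots> = M * M * (k * D + 1) ^ card B * m ^ card B"
    by (simp only: power_mult_distrib mult_ac)
  also have "\<dots> < m * m ^ card B"
    using m by (intro mult_strict_right_mono) (auto simp: m_def)
  also have "\<dots> \<le> m ^ k" using k m by (metis power_Suc power_increasing less_eq_Suc_le One_nat_def)
  finally show False using inj by (simp add: card_image)
qed

end

section \<open>Binary forms in the coordinates of the plane\<close>

context plane_coords
begin

text \<open>The homogenisation \<open>x1\<^sup>M f (x2 / x1)\<close>.\<close>
definition hom :: "nat \<Rightarrow> 'k poly \<Rightarrow> 'p \<Rightarrow> 'k" where
  "hom M f p = (\<Sum>k\<le>M. coeff f k * x1 p ^ (M - k) * x2 p ^ k)"

lemma hom_Suc: "degree f \<le> M \<Longrightarrow> hom (Suc M) f p = x1 p * hom M f p"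
  by (simp add: hom_def sum_distrib_left coeff_eq_0)
    (rule sum.cong, auto simp: Suc_diff_le mult_ac)

lemma hom_pCons: "hom (Suc M) (pCons 0 f) p = x2 p * hom M f p"
  unfolding hom_def sum.atMost_Suc_shift sum_distrib_left
  by (simp add: mult_ac)

lemma hom_add: "hom M (f + g) p = hom M f p + hom M g p"
  by (simp add: hom_def sum.distrib algebra_simps)

lemma hom_smult: "hom M (smult c f) p = c * hom M f p"
  by (simp add: hom_def sum_distrib_left algebra_simps)

lemma hom_sum: "hom M (\<Sum>i\<in>I. f i) p = (\<Sum>i\<in>I. hom M (f i) p)"
  by (induction I rule: infinite_finite_induct) (auto simp: hom_add, auto simp: hom_def)

lemma hom_linear_mult:
  assumes "degree f \<le> M"
  shows "hom (Suc M) ([:a, b:] * f) p = (a * x1 p + b * x2 p) * hom M f p"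
proof -
  have "[:a, b:] * f = smult a f + pCons 0 (smult b f)" by simp
  then show ?thesis using assms by (simp only: hom_add hom_pCons hom_smult hom_Suc) (simp add: algebra_simps)
qed

lemma hom_low: "hom M f \<in> low (Suc M) M"
proof -
  have "(\<lambda>p. \<Sum>k\<le>M. coeff f k * Mon (M - k) k (\<lambda>_. 0) p) \<in> low (Suc M) M"
    by (intro low_sum low_scale low_Mon) auto
  then show ?thesis by (rule low_cong) (simp add: hom_def Mon_def mult.assoc)
qed

lemma hom_low_Suc:
  assumes "degree f \<le> M" "hom M f \<in> low M M"
  shows "hom (Suc M) f \<in> low (Suc M) (Suc M)"
proof -
  have "(\<lambda>p. x1 p * hom M f p) \<in> low (1 + M) (1 + M)"
    using low_x1[of 2 1] assms(2) by (intro low_mult) (auto simp: numeral_2_eq_2)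
  then show ?thesis by (rule low_cong[THEN low_mono]) (auto simp: hom_Suc assms(1))
qed

lemma hom_low_mono:
  assumes "M \<le> M'" "degree f \<le> M" "hom M f \<in> low M M"
  shows "hom M' f \<in> low M' M'"
  using assms
proof (induction M' rule: dec_induct)
  case base
  then show ?case by simp
next
  case (step n)
  then show ?case by (intro hom_low_Suc) auto
qed

text \<open>The dehomogenised binary forms that, on \<open>S\<close>, agree with something of
  smaller plane degree. The degree \<open>M\<close> is left free because multiplying by
  \<open>x1\<close> preserves this property; hence the set is closed under addition and is an
  ideal.\<close>

definition low_ideal :: "'k poly set" where
  "low_ideal = {f. \<exists>M\<ge>degree f. hom M f \<in> low M M}"

lemma low_ideal_add:
  assumes "f \<in> low_ideal" "g \<in> low_ideal"
  shows "f + g \<in> low_ideal"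
proof -
  from assms obtain M M' where M: "degree f \<le> M" "hom M f \<in> low M M" "degree g \<le> M'" "hom M' g \<in> low M' M'"
    by (auto simp: low_ideal_def)
  let ?M = "max M M'"
  have "(\<lambda>p. hom ?M f p + hom ?M g p) \<in> low ?M ?M"
    using M by (intro low_add hom_low_mono[of M ?M] hom_low_mono[of M' ?M]) auto
  then have "hom ?M (f + g) \<in> low ?M ?M" by (rule low_cong) (simp add: hom_add)
  moreover have "degree (f + g) \<le> ?M" using M by (intro degree_add_le) auto
  ultimately show ?thesis by (auto simp: low_ideal_def)
qed

lemma low_ideal_smult:
  assumes "f \<in> low_ideal"
  shows "smult c f \<in> low_ideal"
proof -
  from assms obtain M where M: "degree f \<le> M" "hom M f \<in> low M M"
    by (auto simp: low_ideal_def)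
  have "hom M (smult c f) \<in> low M M"
    by (rule low_cong[OF low_scale[OF M(2), of c]]) (simp add: hom_smult)
  moreover have "degree (smult c f) \<le> M" using M(1) degree_smult_le order.trans by blast
  ultimately show ?thesis by (auto simp: low_ideal_def)
qed

lemma low_ideal_pCons:
  assumes "f \<in> low_ideal"
  shows "pCons 0 f \<in> low_ideal"
proof -
  from assms obtain M where M: "degree f \<le> M" "hom M f \<in> low M M"
    by (auto simp: low_ideal_def)
  have "(\<lambda>p. x2 p * hom M f p) \<in> low (1 + M) (1 + M)"
    using low_x2[of 2 1] M(2) by (intro low_mult) (auto simp: numeral_2_eq_2)
  then have "hom (Suc M) (pCons 0 f) \<in> low (Suc M) (Suc M)"
    by (rule low_cong[THEN low_mono]) (auto simp: hom_pCons)
  moreover have "degree (pCons 0 f) \<le> Suc M" using M(1) degree_pCons_le[of 0 f] by simp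
  ultimately show ?thesis unfolding low_ideal_def by blast
qed

lemma low_ideal_mult:
  assumes "f \<in> low_ideal"
  shows "g * f \<in> low_ideal"
proof (induction g)
  case 0
  have "smult 0 f \<in> low_ideal" by (rule low_ideal_smult[OF assms])
  then show ?case by simp
next
  case (pCons a g)
  then show ?case using low_ideal_add[OF low_ideal_smult[OF assms, of a] low_ideal_pCons[OF pCons.IH]]
    by simp
qed

text \<open>An ideal of polynomials in one variable is generated by an element of least degree. If
  that were not constant, its root would be a common zero. So 1 lies in the ideal, and the
  homogenisation of 1 is a power of \<open>x1\<close>.\<close>

lemma x1_power_low:
  assumes ac: "alg_closed TYPE('k)" and nr: "\<And>t. \<exists>f\<in>low_ideal. poly f t \<noteq> 0"
  shows "\<exists>M0. \<forall>M\<ge>M0. (\<lambda>p. x1 p ^ M) \<in> low M M"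
proof -
  obtain f0 where "f0 \<in> low_ideal" "f0 \<noteq> 0" using nr[of 0] by force
  then obtain g where g: "g \<in> low_ideal" "g \<noteq> 0"
    and min: "\<And>f. f \<in> low_ideal \<Longrightarrow> f \<noteq> 0 \<Longrightarrow> degree g \<le> degree f"
    using ex_has_least_nat[of "\<lambda>f. f \<in> low_ideal \<and> f \<noteq> 0" f0 degree] by blast
  have dvd: "g dvd f" if "f \<in> low_ideal" for f
  proof -
    have "f mod g = f + (- (f div g)) * g" by (simp add: minus_div_mult_eq_mod[symmetric])
    then have "f mod g \<in> low_ideal" using low_ideal_add[OF that low_ideal_mult[OF g(1)]] by metis
    then have "f mod g = 0" using min[of "f mod g"] degree_mod_less'[OF g(2), of f] by fastforce
    then show ?thesis by (simp add: dvd_eq_mod_eq_0)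
  qed
  have "degree g = 0"
  proof (rule ccontr)
    assume "degree g \<noteq> 0"
    then obtain t where "poly g t = 0" using ac by (auto simp: alg_closed_def)
    then have "poly f t = 0" if "f \<in> low_ideal" for f using dvd[OF that] by auto
    then show False using nr by blast
  qed
  then obtain c where c: "g = [:c:]" by (meson degree_eq_zeroE)
  then have "smult (inverse c) g = 1" using g(2) by (simp add: one_pCons)
  then have "1 \<in> low_ideal" using low_ideal_smult[OF g(1)] by metis
  then obtain M where M: "hom M 1 \<in> low M M" by (auto simp: low_ideal_def)
  have hom1: "hom M' 1 p = x1 p ^ M'" for M' p
  proof -
    have "hom M' 1 p = (\<Sum>k\<le>M'. if k = 0 then x1 p ^ M' else 0)"
      unfolding hom_def by (rule sum.cong) auto
    then show ?thesis by simp
  qed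
  have "(\<lambda>p. x1 p ^ M') \<in> low M' M'" if "M' \<ge> M" for M'
    using hom_low_mono[OF that _ M] by (rule low_cong) (auto simp: hom1)
  then show ?thesis by blast
qed

end

text \<open>Dehomogenising favours \<open>x1\<close>; by this symmetry the result for
  \<open>x1\<close> also serves \<open>x2\<close>.\<close>

lemma low_swap_subset:
  assumes "finite B"
  shows "plane_coords.low S x1 x2 B y D m \<subseteq> plane_coords.low S x2 x1 B y D m"
proof -
  interpret p: plane_coords S x1 x2 B y using assms by unfold_locales
  interpret r: plane_coords S x2 x1 B y using assms by unfold_locales
  have eq: "p.Mon i j a = r.Mon j i a" for i j a
    by (simp add: p.Mon_def r.Mon_def fun_eq_iff)
  have "p.Mons D m \<subseteq> r.Mons D m"
    unfolding p.Mons_def r.Mons_def eq by (auto simp: add.commute) (metis add.commute)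
  then show ?thesis
    unfolding p.low_def r.low_def using fn.span_mono by blast
qed

section \<open>Planes of regular functionals\<close>

lemma matrix_add_rdistrib: "(x + y) ** z = x ** z + y ** z"
  for x y z :: "'k::semiring_1^'m^'m"
  by (simp add: vec_eq_iff matrix_matrix_mult_def sum.distrib algebra_simps)

lemma matrix_diff_mult: "(x - y) ** z = x ** z - y ** z"
  and matrix_mult_diff: "z ** (x - y) = z ** x - z ** y"
  for x y z :: "'k::field^'m^'m"
  by (simp_all add: vec_eq_iff matrix_matrix_mult_def sum_subtractf algebra_simps)

lemma lie_br_add_left: "lie_br (x + y) z = lie_br x z + lie_br y z"
  by (simp add: lie_br_def matrix_add_ldistrib matrix_add_rdistrib algebra_simps)

lemma lie_br_add_right: "lie_br z (x + y) = lie_br z x + lie_br z y"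
  by (simp add: lie_br_def matrix_add_ldistrib matrix_add_rdistrib algebra_simps)

lemma smat_mult_left: "smat c x ** y = smat c (x ** y)"
  by (simp add: vec_eq_iff matrix_matrix_mult_def sum_distrib_left mult.assoc)

lemma smat_mult_right: "x ** smat c y = smat c (x ** y)"
  by (simp add: vec_eq_iff matrix_matrix_mult_def sum_distrib_left mult_ac)

lemma lie_br_smat_left: "lie_br (smat c x) z = smat c (lie_br x z)"
  by (simp add: lie_br_def smat_mult_left smat_mult_right mat.scale_right_diff_distrib)

lemma lie_br_smat_right: "lie_br z (smat c x) = smat c (lie_br z x)"
  by (simp add: lie_br_def smat_mult_left smat_mult_right mat.scale_right_diff_distrib)

lemma lie_br_skew: "lie_br x y = - lie_br y x"
  by (simp add: lie_br_def)

lemma lie_br_zero [simp]: "lie_br 0 y = 0" "lie_br y 0 = 0"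
  by (simp_all add: lie_br_def)

lemma lie_br_sum_left: "lie_br (\<Sum>i\<in>I. smat (c i) (u i)) y = (\<Sum>i\<in>I. smat (c i) (lie_br (u i) y))"
  by (induction I rule: infinite_finite_induct) (auto simp: lie_br_add_left lie_br_smat_left)

lemma lie_br_sum_right: "lie_br y (\<Sum>i\<in>I. smat (c i) (u i)) = (\<Sum>i\<in>I. smat (c i) (lie_br y (u i)))"
  by (induction I rule: infinite_finite_induct) (auto simp: lie_br_add_right lie_br_smat_right)

lemma
  assumes "\<gamma> \<in> dual_sp q"
  shows dual_add: "x \<in> q \<Longrightarrow> y \<in> q \<Longrightarrow> \<gamma> (x + y) = \<gamma> x + \<gamma> y"
    and dual_smat: "x \<in> q \<Longrightarrow> \<gamma> (smat c x) = c * \<gamma> x"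
  using assms by (auto simp: dual_sp_def)

lemma dual_zero:
  assumes "\<gamma> \<in> dual_sp q" "mat.subspace q"
  shows "\<gamma> 0 = 0"
  using dual_smat[OF assms(1), of 0 0] mat.subspace_0[OF assms(2)] by simp

lemma subspace_dual_kernel:
  assumes "\<gamma> \<in> dual_sp q" "mat.subspace q"
  shows "mat.subspace {x \<in> q. \<gamma> x = 0}"
  by (rule mat.subspaceI)
    (auto simp: dual_zero[OF assms] dual_add[OF assms(1)] dual_smat[OF assms(1)] mat.subspace_0[OF assms(2)]
      intro: mat.subspace_add[OF assms(2)] mat.subspace_scale[OF assms(2)])

lemma dual_neg:
  assumes "\<gamma> \<in> dual_sp q" "x \<in> q"
  shows "\<gamma> (- x) = - \<gamma> x"
proof -
  have "smat (- 1) x = - x" by (simp add: vec_eq_iff)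
  then show ?thesis using dual_smat[OF assms, of "- 1"] by simp
qed

lemma dual_diff:
  assumes "\<gamma> \<in> dual_sp q" "mat.subspace q" "x \<in> q" "y \<in> q"
  shows "\<gamma> (x - y) = \<gamma> x - \<gamma> y"
  using dual_add[OF assms(1,3), of "- y"] dual_neg[OF assms(1,4)] mat.subspace_neg[OF assms(2,4)] by simp

lemma dual_sum:
  assumes "\<gamma> \<in> dual_sp q" "mat.subspace q" "\<And>i. i \<in> I \<Longrightarrow> u i \<in> q"
  shows "\<gamma> (\<Sum>i\<in>I. smat (c i) (u i)) = (\<Sum>i\<in>I. c i * \<gamma> (u i))"
  using assms(3)
proof (induction I rule: infinite_finite_induct)
  case (insert i I)
  have "(\<Sum>i\<in>I. smat (c i) (u i)) \<in> q"
    using insert.prems by (intro mat.subspace_sum[OF assms(2)] mat.subspace_scale[OF assms(2)]) auto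
  then show ?case
    using insert dual_add[OF assms(1)] dual_smat[OF assms(1)] mat.subspace_scale[OF assms(2)] by simp
qed (use dual_zero[OF assms(1,2)] in auto)

lemma dual_comb:
  assumes "\<alpha> \<in> dual_sp q" "\<beta> \<in> dual_sp q"
  shows "(\<lambda>x. s * \<alpha> x + t * \<beta> x) \<in> dual_sp q"
  using assms unfolding dual_sp_def by (auto simp: algebra_simps)

lemma stab_subset: "stab q \<gamma> \<subseteq> q"
  by (auto simp: stab_def)

text \<open>\<open>W\<close> may differ from \<open>q\<close>: the form is also needed on the
  self-adjoint part of the centraliser, which is not closed under brackets but has its brackets in
  the skew part.\<close>

lemma subspace_form_kernel:
  assumes W: "mat.subspace W" and q: "mat.subspace q" and br: "\<And>x y. x \<in> W \<Longrightarrow> y \<in> W \<Longrightarrow> lie_br x y \<in> q"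
    and \<gamma>: "\<gamma> \<in> dual_sp q"
  shows "mat.subspace {x \<in> W. \<forall>y\<in>W. \<gamma> (lie_br x y) = 0}" (is "mat.subspace ?K")
proof (rule mat.subspaceI)
  show "0 \<in> ?K" using mat.subspace_0[OF W] dual_zero[OF \<gamma> q] by simp
  show "x + y \<in> ?K" if "x \<in> ?K" "y \<in> ?K" for x y
    using that mat.subspace_add[OF W, of x y] by (auto simp: lie_br_add_left dual_add[OF \<gamma> br br])
  show "smat c x \<in> ?K" if "x \<in> ?K" for c x
    using that mat.subspace_scale[OF W, of x c] by (auto simp: lie_br_smat_left dual_smat[OF \<gamma> br])
qed

lemma subspace_stab:
  assumes "mat.subspace q" "\<And>x y. x \<in> q \<Longrightarrow> y \<in> q \<Longrightarrow> lie_br x y \<in> q" "\<gamma> \<in> dual_sp q"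
  shows "mat.subspace (stab q \<gamma>)"
  unfolding stab_def using assms(1,1,2,3) by (rule subspace_form_kernel)

lemma lie_index_le: "\<gamma> \<in> dual_sp q \<Longrightarrow> lie_index q \<le> mdim (stab q \<gamma>)"
  unfolding lie_index_def by (rule Least_le) blast

text \<open>The vectors \<open>b1\<close>, \<open>b2\<close> are dual to \<alpha>, \<beta>. So
  evaluation at \<open>b1\<close> and \<open>b2\<close> gives the two coordinates on the plane,
  while evaluation at elements of \<open>B\<close> vanishes there.\<close>

locale regular_plane = 
  fixes q :: "('k::field^'m^'m) set" and \<alpha> \<beta> :: "'k^'m^'m \<Rightarrow> 'k" and b1 b2 :: "'k^'m^'m"
    and B :: "('k^'m^'m) set"
  assumes ac: "alg_closed TYPE('k)"
    and sub: "mat.subspace q" and closed: "\<And>x y. x \<in> q \<Longrightarrow> y \<in> q \<Longrightarrow> lie_br x y \<in> q"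
    and dual: "\<alpha> \<in> dual_sp q" "\<beta> \<in> dual_sp q"
    and reg: "\<And>s t. (s, t) \<noteq> (0, 0) \<Longrightarrow> mdim (stab q (\<lambda>x. s * \<alpha> x + t * \<beta> x)) \<le> lie_index q"
    and b: "b1 \<in> q" "b2 \<in> q" "\<alpha> b1 = 1" "\<beta> b1 = 0" "\<alpha> b2 = 0" "\<beta> b2 = 1"
    and B: "finite B" "B \<subseteq> q" "mat.span B = {x \<in> q. \<alpha> x = 0 \<and> \<beta> x = 0}"
begin

sublocale plane_coords "sing_dual q" "\<lambda>\<gamma>. \<gamma> b1" "\<lambda>\<gamma>. \<gamma> b2" B "\<lambda>b \<gamma>. \<gamma> b"
  using B(1) by unfold_locales

lemma sing_dual_dual: "\<gamma> \<in> sing_dual q \<Longrightarrow> \<gamma> \<in> dual_sp q"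
  by (simp add: sing_dual_def)

lemma coord_low_kernel:
  assumes "z \<in> mat.span B"
  shows "(\<lambda>\<gamma>. \<gamma> z) \<in> low 1 1"
proof -
  obtain c where c: "z = (\<Sum>b\<in>B. smat (c b) b)" using assms mat.span_finite[OF B(1)] by auto
  have "(\<lambda>\<gamma>. \<Sum>b\<in>B. c b * \<gamma> b) \<in> low 1 1"
    by (intro low_sum low_scale low_y) auto
  then show ?thesis
  proof (rule low_cong)
    fix \<gamma> assume "\<gamma> \<in> sing_dual q"
    then show "\<gamma> z = (\<Sum>b\<in>B. c b * \<gamma> b)"
      unfolding c using B(2) by (intro dual_sum[OF _ sub] sing_dual_dual) auto
  qed
qed

definition ker_part :: "'k^'m^'m \<Rightarrow> 'k^'m^'m" where
  "ker_part z = z - (smat (\<alpha> z) b1 + smat (\<beta> z) b2)"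

lemma ker_part:
  assumes "z \<in> q"
  shows "ker_part z \<in> mat.span B"
    and "\<gamma> \<in> dual_sp q \<Longrightarrow> \<gamma> z = (\<alpha> z * \<gamma> b1 + \<beta> z * \<gamma> b2) + \<gamma> (ker_part z)"
proof -
  have m: "smat (\<alpha> z) b1 \<in> q" "smat (\<beta> z) b2 \<in> q" "smat (\<alpha> z) b1 + smat (\<beta> z) b2 \<in> q"
    using sub b by (auto intro: mat.subspace_scale mat.subspace_add)
  have e: "\<gamma> (ker_part z) = \<gamma> z - (\<alpha> z * \<gamma> b1 + \<beta> z * \<gamma> b2)" if "\<gamma> \<in> dual_sp q" for \<gamma>
    unfolding ker_part_def using that m b assms sub by (simp add: dual_diff dual_add dual_smat)
  show "\<gamma> z = (\<alpha> z * \<gamma> b1 + \<beta> z * \<gamma> b2) + \<gamma> (ker_part z)" if "\<gamma> \<in> dual_sp q" for \<gamma>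
    using e[OF that] by simp
  show "ker_part z \<in> mat.span B"
    using e[OF dual(1)] e[OF dual(2)] b m mat.subspace_diff[OF sub assms m(3)]
    unfolding B(3) by (simp add: ker_part_def)
qed

lemma linear_low: "(\<lambda>\<gamma>. a * \<gamma> b1 + c * \<gamma> b2) \<in> low 2 1"
  by (intro low_add low_scale low_x1 low_x2) auto

lemma coord_low:
  assumes "z \<in> q"
  shows "(\<lambda>\<gamma>. \<gamma> z) \<in> low 2 1"
proof -
  have "(\<lambda>\<gamma>. (\<alpha> z * \<gamma> b1 + \<beta> z * \<gamma> b2) + \<gamma> (ker_part z)) \<in> low 2 1"
    by (intro low_add linear_low low_mono[OF coord_low_kernel] ker_part assms) auto
  then show ?thesis by (rule low_cong) (rule ker_part(2)[OF assms sing_dual_dual])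
qed

lemma dual_poly_low:
  assumes "f \<in> dual_poly q"
  shows "\<exists>D. f \<in> low (Suc D) D"
  using assms
proof (induction rule: dual_poly.induct)
  case (const c)
  then show ?case using low_const[of "Suc 0" c 0] by blast
next
  case (coord x)
  then show ?case using coord_low[of x] by (metis One_nat_def Suc_1)
next
  case (add f g)
  then obtain D D' where D: "f \<in> low (Suc D) D" "g \<in> low (Suc D') D'" by blast
  let ?D = "max D D'"
  have "(\<lambda>\<gamma>. f \<gamma> + g \<gamma>) \<in> low (Suc ?D) ?D"
    by (intro low_add low_mono[OF D(1)] low_mono[OF D(2)]) auto
  then show ?case by blast
next
  case (mult f g)
  then obtain D D' where D: "f \<in> low (Suc D) D" "g \<in> low (Suc D') D'" by blast
  have "(\<lambda>\<gamma>. f \<gamma> * g \<gamma>) \<in> low (Suc (D + D')) (D + D')"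
    using low_mult[OF D] by simp
  then show ?case by blast
qed

text \<open>Each factor is a linear form in the plane coordinates plus a term of plane degree 0.
  Expanding, everything except the product of the linear forms loses plane degree, and that product
  is the homogenisation of a product of linear polynomials.\<close>

lemma prod_coords_low:
  assumes "finite I" "\<And>i. i \<in> I \<Longrightarrow> z i \<in> q"
  shows "(\<lambda>\<gamma>. (\<Prod>i\<in>I. \<gamma> (z i)) - hom (card I) (\<Prod>i\<in>I. [:\<alpha> (z i), \<beta> (z i):]) \<gamma>) \<in> low (card I) (card I)
    \<and> degree (\<Prod>i\<in>I. [:\<alpha> (z i), \<beta> (z i):]) \<le> card I"
  using assms
proof (induction I rule: finite_induct)
  case empty
  then show ?case by (auto intro: low_zero simp: hom_def)
  next
  case (insert i I)
  define f where "f = (\<Prod>i\<in>I. [:\<alpha> (z i), \<beta> (z i):])"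
  define n where "n = card I"
  define P where "P \<gamma> = (\<Prod>i\<in>I. \<gamma> (z i))" for \<gamma> :: "'k^'m^'m \<Rightarrow> 'k"
  define l where "l \<gamma> = P \<gamma> - hom n f \<gamma>" for \<gamma>
  have IH: "l \<in> low n n" "degree f \<le> n"
    using insert by (auto simp: l_def[abs_def] P_def[abs_def] f_def n_def)
  have zi: "z i \<in> q" using insert.prems by simp
  have "P \<in> low (Suc n) n"
  proof -
    have "(\<lambda>\<gamma>. hom n f \<gamma> + l \<gamma>) \<in> low (Suc n) n"
      by (intro low_add hom_low low_mono[OF IH(1)]) auto
    then show ?thesis by (rule low_cong) (simp add: l_def)
  qed
  moreover have "(\<lambda>\<gamma>. \<gamma> (ker_part (z i))) \<in> low (Suc 0) 1"
    using coord_low_kernel[OF ker_part(1)[OF zi]] by simp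
  ultimately have "(\<lambda>\<gamma>. \<gamma> (ker_part (z i)) * P \<gamma>) \<in> low (0 + Suc n) (1 + n)"
    by (intro low_mult)
  moreover have "(\<lambda>\<gamma>. (\<alpha> (z i) * \<gamma> b1 + \<beta> (z i) * \<gamma> b2) * l \<gamma>) \<in> low (1 + n) (1 + n)"
    using linear_low IH(1) by (intro low_mult) (auto simp: numeral_2_eq_2)
  ultimately have "(\<lambda>\<gamma>. \<gamma> (ker_part (z i)) * P \<gamma> + (\<alpha> (z i) * \<gamma> b1 + \<beta> (z i) * \<gamma> b2) * l \<gamma>) \<in> low (Suc n) (Suc n)"
    by (intro low_add) simp_all
  then have "(\<lambda>\<gamma>. \<gamma> (z i) * P \<gamma> - hom (Suc n) ([:\<alpha> (z i), \<beta> (z i):] * f) \<gamma>) \<in> low (Suc n) (Suc n)"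
  proof (rule low_cong)
    fix \<gamma> assume "\<gamma> \<in> sing_dual q"
    then have e: "\<gamma> (z i) = (\<alpha> (z i) * \<gamma> b1 + \<beta> (z i) * \<gamma> b2) + \<gamma> (ker_part (z i))"
      using ker_part(2)[OF zi] sing_dual_dual by blast
    show "\<gamma> (z i) * P \<gamma> - hom (Suc n) ([:\<alpha> (z i), \<beta> (z i):] * f) \<gamma>
        = \<gamma> (ker_part (z i)) * P \<gamma> + (\<alpha> (z i) * \<gamma> b1 + \<beta> (z i) * \<gamma> b2) * l \<gamma>"
      unfolding hom_linear_mult[OF IH(2)] l_def by (subst e) (simp only: algebra_simps)
  qed
  moreover have "degree ([:\<alpha> (z i), \<beta> (z i):] * f) \<le> Suc n"
  proof -
    have "degree ([:\<alpha> (z i), \<beta> (z i):] * f) \<le> degree [:\<alpha> (z i), \<beta> (z i):] + degree f"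
      by (rule degree_mult_le)
    also have "\<dots> \<le> 1 + n" using IH(2) by (intro add_mono) auto
    finally show ?thesis by simp
  qed
  ultimately show ?case
    unfolding P_def f_def n_def using insert.hyps by simp
  qed

text \<open>A principal minor of the form \<open>\<gamma> [x, y]\<close>, padded by an identity block so that its index type
  does not depend on its size.\<close>
definition minor_mat :: "'i::finite set \<Rightarrow> ('i \<Rightarrow> 'k^'m^'m) \<Rightarrow> ('k^'m^'m \<Rightarrow> 'k) \<Rightarrow> 'k^'i^'i" where
  "minor_mat I u \<gamma> = (\<chi> i j. if i \<in> I then \<gamma> (if j \<in> I then lie_br (u i) (u j) else 0)
     else if i = j then 1 else 0)"

text \<open>The matrix is block diagonal with an identity block outside \<open>I\<close>, so kernel
  vectors of the transpose are supported on \<open>I\<close> and are coefficient vectors of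
  combinations of the \<open>u i\<close>.\<close>

lemma minor_kernel:
  assumes \<gamma>: "\<gamma> \<in> dual_sp q" and u: "\<And>i. u i \<in> q"
  shows "det (minor_mat I u \<gamma>) = 0 \<longleftrightarrow>
    (\<exists>c. (\<exists>i\<in>I. c i \<noteq> 0) \<and> (\<forall>j\<in>I. \<gamma> (lie_br (\<Sum>i\<in>I. smat (c i) (u i)) (u j)) = 0))"
proof -
  let ?A = "minor_mat I u \<gamma>"
  have ev: "\<gamma> (lie_br (\<Sum>i\<in>I. smat (c i) (u i)) (u j)) = (\<Sum>i\<in>I. c i * \<gamma> (lie_br (u i) (u j)))" for c j
    unfolding lie_br_sum_left using u closed by (intro dual_sum[OF \<gamma> sub]) auto
  have row: "(transpose ?A *v c) $ j = (if j \<in> I then \<Sum>i\<in>I. c $ i * \<gamma> (lie_br (u i) (u j)) else c $ j)" for c j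
  proof -
    have "(transpose ?A *v c) $ j = (\<Sum>i\<in>UNIV. ?A $ i $ j * c $ i)"
      by (simp add: matrix_vector_mult_def Finite_Cartesian_Product.transpose_def)
    also have "\<dots> = (\<Sum>i\<in>I. ?A $ i $ j * c $ i) + (\<Sum>i\<in>- I. ?A $ i $ j * c $ i)"
      by (subst sum.union_disjoint[symmetric]) auto
    also have "(\<Sum>i\<in>- I. ?A $ i $ j * c $ i) = (\<Sum>i\<in>- I. if i = j then c $ j else 0)"
      by (rule sum.cong) (auto simp: minor_mat_def)
    finally show ?thesis by (auto simp: minor_mat_def dual_zero[OF \<gamma> sub] mult.commute)
  qed
  have "det ?A = 0 \<longleftrightarrow> \<not> invertible (transpose ?A)"
    by (simp add: invertible_det_nz)
  also have "\<dots> \<longleftrightarrow> (\<exists>c. transpose ?A *v c = 0 \<and> c \<noteq> 0)"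
    unfolding invertible_left_inverse using matrix_left_invertible_ker[of "transpose ?A"] by blast
  also have "\<dots> \<longleftrightarrow> (\<exists>c. (\<exists>i\<in>I. c i \<noteq> 0) \<and> (\<forall>j\<in>I. (\<Sum>i\<in>I. c i * \<gamma> (lie_br (u i) (u j))) = 0))"
  proof
    assume "\<exists>c. transpose ?A *v c = 0 \<and> c \<noteq> 0"
    then obtain c where c: "transpose ?A *v c = 0" "c \<noteq> 0" by blast
    have r: "(if j \<in> I then \<Sum>i\<in>I. c $ i * \<gamma> (lie_br (u i) (u j)) else c $ j) = 0" for j
      using row[of c j] c(1) by simp
    have "c $ j = 0" if "j \<notin> I" for j using r[of j] that by simp
    then have "\<exists>i\<in>I. c $ i \<noteq> 0" using c(2) by (metis vec_eq_iff zero_index)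
    moreover have "\<forall>j\<in>I. (\<Sum>i\<in>I. c $ i * \<gamma> (lie_br (u i) (u j))) = 0"
      using r by (metis (full_types))
    ultimately show "\<exists>c. (\<exists>i\<in>I. c i \<noteq> 0) \<and> (\<forall>j\<in>I. (\<Sum>i\<in>I. c i * \<gamma> (lie_br (u i) (u j))) = 0)" by blast
  next
    assume "\<exists>c. (\<exists>i\<in>I. c i \<noteq> 0) \<and> (\<forall>j\<in>I. (\<Sum>i\<in>I. c i * \<gamma> (lie_br (u i) (u j))) = 0)"
    then obtain c where c: "\<exists>i\<in>I. c i \<noteq> 0" "\<forall>j\<in>I. (\<Sum>i\<in>I. c i * \<gamma> (lie_br (u i) (u j))) = 0" by blast
    define v :: "'k^'a" where "v = (\<chi> i. if i \<in> I then c i else 0)"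
    have "transpose ?A *v v = 0"
      unfolding vec_eq_iff row using c(2) by (auto simp: v_def)
    moreover have "v \<noteq> 0" using c(1) by (auto simp: v_def vec_eq_iff)
    ultimately show "\<exists>c. transpose ?A *v c = 0 \<and> c \<noteq> 0" by blast
  qed
  finally show ?thesis by (simp add: ev)
qed

text \<open>A nonzero minor would make the span of the \<open>u i\<close> meet the stabiliser
  trivially, so the stabiliser would have dimension at most \<open>lie_index q\<close>.\<close>

lemma minor_sing:
  assumes \<gamma>: "\<gamma> \<in> sing_dual q" and u: "\<And>i. u i \<in> q" and I: "card I = mdim q - lie_index q"
  shows "det (minor_mat I u \<gamma>) = 0"
proof (rule ccontr)
  note g = sing_dual_dual[OF \<gamma>]
  assume nz: "det (minor_mat I u \<gamma>) \<noteq> 0"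
  have key: "\<forall>i\<in>I. c i = 0" if "(\<Sum>i\<in>I. smat (c i) (u i)) \<in> stab q \<gamma>" for c
    using nz that u unfolding minor_kernel[OF g u] by (auto simp: stab_def)
  note st = subspace_stab[OF sub closed g]
  have fin: "finite I" by simp
  have ind: "inj_on u I" "mat.independent (u ` I)"
    using mat.independent_family[OF fin, of u] key mat.subspace_0[OF st] by auto
  have "mat.span (u ` I) \<inter> stab q \<gamma> \<subseteq> {0}"
  proof
    fix x assume x: "x \<in> mat.span (u ` I) \<inter> stab q \<gamma>"
    then obtain c where c: "x = (\<Sum>v\<in>u ` I. smat (c v) v)" using mat.span_finite[of "u ` I"] by auto
    then have "x = (\<Sum>i\<in>I. smat (c (u i)) (u i))" using ind(1) by (simp add: sum.reindex)
    then show "x \<in> {0}" using key[of "\<lambda>i. c (u i)"] x by simp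
  qed
  then have "card (u ` I) + mat.dim (stab q \<gamma>) \<le> mat.dim q"
    using ind u sub st stab_subset[of q \<gamma>] by (intro mat.card_add_dim_le) auto
  moreover have "mat.dim (stab q \<gamma>) > lie_index q"
    using \<gamma> by (simp add: sing_dual_def mdim_eq_dim)
  ultimately show False using I ind(1) by (simp add: card_image mdim_eq_dim)
qed

text \<open>The form is nondegenerate on a complement of its kernel, and such a complement has the
  right dimension. Therefore principal minors are enough.\<close>

lemma minor_regular:
  assumes g: "\<gamma> \<in> dual_sp q" and r: "mdim (stab q \<gamma>) \<le> lie_index q"
  shows "\<exists>(I :: ('m \<times> 'm) set) u. (\<forall>i. u i \<in> q) \<and> card I = mdim q - lie_index q \<and> det (minor_mat I u \<gamma>) \<noteq> 0"
proof -
  note st = subspace_stab[OF sub closed g]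
  have eq: "mdim (stab q \<gamma>) = lie_index q" using r lie_index_le[OF g] by simp
  obtain C where C: "mat.independent C" "finite C" "C \<subseteq> q" "mat.span C \<inter> stab q \<gamma> = {0}"
    "card C + mat.dim (stab q \<gamma>) = mat.dim q"
    "\<forall>w\<in>q. \<exists>b\<in>mat.span C. \<exists>k\<in>stab q \<gamma>. w = b + k"
    by (rule mat.complement_exists[OF sub st stab_subset])
  \<comment> \<open>There are at most as many vectors as matrix units, so subsets of one fixed index
    type accommodate every complement.\<close>
  have "card C \<le> CARD('m \<times> 'm)"
  proof -
    have "card C \<le> mat.dim C" using C(1) by (simp add: mat.dim_eq_card_independent)
    also have "\<dots> \<le> card (range (\<lambda>(i, j). mat_unit i j :: 'k^'m^'m))"
      using mat.dim_subset_UNIV[of C] by (simp add: mat.dimension_def)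
    also have "\<dots> \<le> CARD('m \<times> 'm)" by (intro card_image_le) simp
    finally show ?thesis .
  qed
  then obtain I :: "('m \<times> 'm) set" where I: "card I = card C" using ex_card by blast
  then obtain h where h: "bij_betw h I C" using C(2) by (metis finite finite_same_card_bij)
  define u where "u i = (if i \<in> I then h i else 0)" for i
  have uq: "u i \<in> q" for i
    using h C(3) mat.subspace_0[OF sub] by (auto simp: u_def bij_betw_def)
  have uI: "u ` I = C" "inj_on u I" using h by (auto simp: u_def bij_betw_def inj_on_def)
  have "det (minor_mat I u \<gamma>) \<noteq> 0"
  proof
    assume "det (minor_mat I u \<gamma>) = 0"
    then obtain c where c: "\<exists>i\<in>I. c i \<noteq> 0"
      "\<forall>j\<in>I. \<gamma> (lie_br (\<Sum>i\<in>I. smat (c i) (u i)) (u j)) = 0"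
      unfolding minor_kernel[OF g uq] by blast
    define x where "x = (\<Sum>i\<in>I. smat (c i) (u i))"
    have xC: "x \<in> mat.span C"
      unfolding x_def uI(1)[symmetric] by (intro mat.span_sum mat.span_scale mat.span_base imageI)
    have xq: "x \<in> q" using xC C(3) sub mat.span_minimal by blast
    have "\<gamma> (lie_br x y) = 0" if "y \<in> q" for y
    proof -
      obtain v s where vs: "v \<in> mat.span C" "s \<in> stab q \<gamma>" "y = v + s" using C(6) \<open>y \<in> q\<close> by blast
      have vq: "v \<in> q" using vs(1) C(3) sub mat.span_minimal by blast
      obtain d where d: "v = (\<Sum>w\<in>C. smat (d w) w)" using vs(1) mat.span_finite[OF C(2)] by auto
      have v': "v = (\<Sum>i\<in>I. smat (d (u i)) (u i))"
        unfolding d uI(1)[symmetric] sum.reindex[OF uI(2)] by (simp add: comp_def)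
      have "lie_br x v = (\<Sum>i\<in>I. smat (d (u i)) (lie_br x (u i)))"
        unfolding v' by (rule lie_br_sum_right)
      then have "\<gamma> (lie_br x v) = (\<Sum>i\<in>I. d (u i) * \<gamma> (lie_br x (u i)))"
        using dual_sum[OF g sub, of I "\<lambda>i. lie_br x (u i)"] closed xq uq by simp
      then have "\<gamma> (lie_br x v) = 0" using c(2) by (simp add: x_def)
      moreover have "\<gamma> (lie_br x s) = 0"
      proof -
        have "\<gamma> (lie_br s x) = 0" using vs(2) xq by (auto simp: stab_def)
        moreover have "lie_br s x \<in> q" using closed xq vs(2) stab_subset[of q \<gamma>] by blast
        ultimately show ?thesis using dual_neg[OF g, of "lie_br s x"] lie_br_skew[of x s] by simp
      qed
      moreover have "s \<in> q" using vs(2) stab_subset by blast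
      ultimately show ?thesis
        using vs(3) dual_add[OF g closed[OF xq vq] closed[OF xq \<open>s \<in> q\<close>]] by (simp add: lie_br_add_right)
    qed
    then have "x \<in> stab q \<gamma>" using xq by (simp add: stab_def)
    then have "x = 0" using xC C(4) by blast
    then have "(\<Sum>v\<in>C. smat (c (the_inv_into I u v)) v) = 0"
      unfolding x_def uI(1)[symmetric] sum.reindex[OF uI(2)] comp_def
      by (simp cong: sum.cong add: the_inv_into_f_f[OF uI(2)])
    then have "\<forall>v\<in>C. c (the_inv_into I u v) = 0"
      using mat.independentD[OF C(1,2) order.refl, of "\<lambda>v. c (the_inv_into I u v)"] by blast
    then have "\<forall>i\<in>I. c i = 0" using uI(1) the_inv_into_f_f[OF uI(2)] by force
    then show False using c(1) by blast
  qed
  moreover have "card I = mdim q - lie_index q" using I C(5) eq by (simp add: mdim_eq_dim)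
  ultimately show ?thesis using uq by blast
qed

text \<open>The part of top plane degree of a minor is the homogenisation of its restriction to the
  line \<alpha> + t \<beta>. The minor vanishes on the singular set, so there this top part equals
  terms of lower plane degree.\<close>

lemma minor_low_ideal:
  fixes I :: "'i::finite set"
  assumes u: "\<And>i. u i \<in> q" and I: "card I = mdim q - lie_index q"
  shows "\<exists>P\<in>low_ideal. \<forall>t. poly P t = det (minor_mat I u (\<lambda>x. \<alpha> x + t * \<beta> x))"
proof -
  \<comment> \<open>The zero entries in the rows of \<open>I\<close> are read as values at the
    matrix 0. So every term of the determinant contains exactly \<open>card I\<close> evaluations of
    the functional.\<close>
  define z where "z i j = (if j \<in> I then lie_br (u i) (u j) else 0)" for i j
  have zq: "z i j \<in> q" for i j using u closed mat.subspace_0[OF sub] by (simp add: z_def)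
  define \<kappa> :: "('i \<Rightarrow> 'i) \<Rightarrow> 'k" where
    "\<kappa> \<pi> = of_int (sign \<pi>) * (\<Prod>i\<in>- I. if i = \<pi> i then 1 else 0)" for \<pi>
  define L where "L \<pi> = (\<Prod>i\<in>I. [:\<alpha> (z i (\<pi> i)), \<beta> (z i (\<pi> i)):])" for \<pi>
  define P where "P = (\<Sum>\<pi> | \<pi> permutes UNIV. smult (\<kappa> \<pi>) (L \<pi>))"
  define r where "r = card I"
  have det: "det (minor_mat I u \<gamma>) = (\<Sum>\<pi> | \<pi> permutes UNIV. \<kappa> \<pi> * (\<Prod>i\<in>I. \<gamma> (z i (\<pi> i))))" for \<gamma>
    unfolding det_def
  proof (rule sum.cong)
    fix \<pi>
    have "(\<Prod>i\<in>UNIV. minor_mat I u \<gamma> $ i $ \<pi> i)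
        = (\<Prod>i\<in>I. minor_mat I u \<gamma> $ i $ \<pi> i) * (\<Prod>i\<in>- I. minor_mat I u \<gamma> $ i $ \<pi> i)"
      by (subst prod.union_disjoint[symmetric]) auto
    also have "(\<Prod>i\<in>I. minor_mat I u \<gamma> $ i $ \<pi> i) = (\<Prod>i\<in>I. \<gamma> (z i (\<pi> i)))"
      by (rule prod.cong) (auto simp: minor_mat_def z_def)
    also have "(\<Prod>i\<in>- I. minor_mat I u \<gamma> $ i $ \<pi> i) = (\<Prod>i\<in>- I. if i = \<pi> i then 1 else 0)"
      by (rule prod.cong) (auto simp: minor_mat_def)
    finally show "of_int (sign \<pi>) * (\<Prod>i\<in>UNIV. minor_mat I u \<gamma> $ i $ \<pi> i)
        = \<kappa> \<pi> * (\<Prod>i\<in>I. \<gamma> (z i (\<pi> i)))"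
      by (simp add: \<kappa>_def mult_ac)
  qed simp
  have "poly P t = det (minor_mat I u (\<lambda>x. \<alpha> x + t * \<beta> x))" for t
    by (simp add: P_def L_def det poly_sum poly_prod)
  moreover have "P \<in> low_ideal"
  proof -
    have dL: "degree (L \<pi>) \<le> r" for \<pi>
      unfolding L_def r_def by (rule prod_coords_low[THEN conjunct2]) (auto simp: zq)
    have "degree P \<le> r"
      unfolding P_def
    proof (rule degree_sum_le)
      show "degree (smult (\<kappa> \<pi>) (L \<pi>)) \<le> r" for \<pi>
        using degree_smult_le[of "\<kappa> \<pi>" "L \<pi>"] dL[of \<pi>] by simp
    qed (simp add: finite_permutations)
    moreover have "hom r P \<in> low r r"
    proof -
      have "(\<lambda>\<gamma>. (- 1) * (\<Sum>\<pi> | \<pi> permutes UNIV. \<kappa> \<pi> * ((\<Prod>i\<in>I. \<gamma> (z i (\<pi> i))) - hom r (L \<pi>) \<gamma>))) \<in> low r r"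
      proof (rule low_scale, rule low_sum, rule low_scale)
        fix \<pi>
        show "(\<lambda>\<gamma>. (\<Prod>i\<in>I. \<gamma> (z i (\<pi> i))) - hom r (L \<pi>) \<gamma>) \<in> low r r"
          unfolding r_def L_def by (rule prod_coords_low[THEN conjunct1]) (auto simp: zq)
      qed
      then show ?thesis
      proof (rule low_cong)
        fix \<gamma> assume \<gamma>: "\<gamma> \<in> sing_dual q"
        have "(\<Sum>\<pi> | \<pi> permutes UNIV. \<kappa> \<pi> * ((\<Prod>i\<in>I. \<gamma> (z i (\<pi> i))) - hom r (L \<pi>) \<gamma>))
            = det (minor_mat I u \<gamma>) - hom r P \<gamma>"
          by (simp add: det P_def hom_sum hom_smult right_diff_distrib sum_subtractf)
        then show "hom r P \<gamma> = (- 1) * (\<Sum>\<pi> | \<pi> permutes UNIV. \<kappa> \<pi> * ((\<Prod>i\<in>I. \<gamma> (z i (\<pi> i))) - hom r (L \<pi>) \<gamma>))"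
          using minor_sing[OF \<gamma> u I] by simp
      qed
    qed
    ultimately show ?thesis by (auto simp: low_ideal_def)
  qed
  ultimately show ?thesis by blast
qed

lemma b1_power_low: "\<exists>M0. \<forall>M\<ge>M0. (\<lambda>\<gamma>. \<gamma> b1 ^ M) \<in> low M M"
proof (rule x1_power_low[OF ac])
  fix t
  have "(\<lambda>x. 1 * \<alpha> x + t * \<beta> x) \<in> dual_sp q" by (rule dual_comb[OF dual])
  moreover have "mdim (stab q (\<lambda>x. 1 * \<alpha> x + t * \<beta> x)) \<le> lie_index q" by (rule reg) simp
  ultimately obtain I :: "('m \<times> 'm) set" and u where "\<forall>i. u i \<in> q" "card I = mdim q - lie_index q"
    "det (minor_mat I u (\<lambda>x. 1 * \<alpha> x + t * \<beta> x)) \<noteq> 0" using minor_regular by blast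
  moreover from this obtain P where "P \<in> low_ideal" "\<forall>t. poly P t = det (minor_mat I u (\<lambda>x. \<alpha> x + t * \<beta> x))"
    using minor_low_ideal[of u I] by blast
  ultimately show "\<exists>f\<in>low_ideal. poly f t \<noteq> 0" by (intro bexI[of _ P]) auto
qed

end

lemma subalgebra_dual_poly: "subalgebra (dual_poly q)"
  unfolding subalgebra_def by (auto intro: dual_poly.intros)

lemma codim_ge_independent_plane:
  fixes q :: "('k::field^'m^'m) set"
  assumes rp: "regular_plane q \<alpha> \<beta> b1 b2 B" and card: "card B + 2 \<le> mdim q"
  shows "codim_ge q (sing_dual q) 2"
proof -
  interpret regular_plane q \<alpha> \<beta> b1 b2 B by fact
  \<comment> \<open>The same plane with its axes exchanged supplies the powers of the second
    coordinate.\<close>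
  interpret sw: regular_plane q \<beta> \<alpha> b2 b1 B
  proof unfold_locales
    show "mdim (stab q (\<lambda>x. s * \<beta> x + t * \<alpha> x)) \<le> lie_index q" if "(s, t) \<noteq> (0, 0)" for s t
      using reg[of t s] that by (auto simp: add.commute[of "s * \<beta> _"])
  qed (use ac sub closed dual b B in auto)
  obtain M1 where M1: "\<forall>M\<ge>M1. (\<lambda>\<gamma>. \<gamma> b1 ^ M) \<in> low M M" using b1_power_low by blast
  obtain M2 where M2: "\<forall>M\<ge>M2. (\<lambda>\<gamma>. \<gamma> b2 ^ M) \<in> sw.low M M" using sw.b1_power_low by blast
  define M where "M = max M1 M2"
  have x1: "(\<lambda>\<gamma>. \<gamma> b1 ^ M) \<in> low M M" using M1 by (simp add: M_def)
  have x2: "(\<lambda>\<gamma>. \<gamma> b2 ^ M) \<in> low M M"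
    using M2 low_swap_subset[OF B(1), of "sing_dual q" "\<lambda>\<gamma>. \<gamma> b2" "\<lambda>\<gamma>. \<gamma> b1" "\<lambda>b \<gamma>. \<gamma> b" M M]
    by (auto simp: M_def)
  show ?thesis
    unfolding codim_ge_def
  proof (intro allI impI)
    fix k and Z :: "nat \<Rightarrow> ('k^'m^'m \<Rightarrow> 'k) set"
    assume H: "(\<forall>i\<le>k. zirred q (Z i) \<and> Z i \<subseteq> sing_dual q) \<and> (\<forall>i<k. Z i \<subset> Z (Suc i))"
    have "\<exists>g\<in>dual_poly q. (\<forall>p\<in>Z i. g p = 0) \<and> (\<exists>p\<in>Z (Suc i). g p \<noteq> 0)" if i: "i < k" for i
    proof -
      \<comment> \<open>\<open>Z i\<close> is cut out by polynomials, so one of them is nonzero at a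
        point of \<open>Z (Suc i)\<close> outside \<open>Z i\<close>.\<close>
      obtain p where p: "p \<in> Z (Suc i)" "p \<notin> Z i" using H i by blast
      have "p \<in> dual_sp q" using H i p(1) sing_dual_dual by (meson Suc_leI subsetD)
      moreover have "zclosed q (Z i)" using H i by (simp add: zirred_def)
      ultimately show ?thesis using p unfolding zclosed_def by blast
    qed
    then obtain f where f: "\<And>i. i < k \<Longrightarrow> f i \<in> dual_poly q \<and> (\<forall>p\<in>Z i. f i p = 0) \<and> (\<exists>p\<in>Z (Suc i). f i p \<noteq> 0)"
      by metis
    have "k \<le> card B"
    proof (rule chain_length_le[OF subalgebra_dual_poly, where Z = Z and f = f and M = M])
      fix i g h assume i: "i \<le> k" and g: "g \<in> dual_poly q" "h \<in> dual_poly q" and z: "\<forall>p\<in>Z i. g p * h p = 0"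
      let ?V = "\<lambda>g. {\<gamma> \<in> dual_sp q. \<forall>f\<in>{g}. f \<gamma> = 0}"
      have "zclosed q (?V g)" "zclosed q (?V h)"
        unfolding zclosed_def using g by blast+
      moreover have "Z i \<subseteq> ?V g \<union> ?V h"
      proof
        fix p assume p: "p \<in> Z i"
        then have "p \<in> dual_sp q" using H i sing_dual_dual by blast
        then show "p \<in> ?V g \<union> ?V h" using z p by auto
      qed
      moreover have "zirred q (Z i)" using H i by blast
      ultimately have "Z i \<subseteq> ?V g \<or> Z i \<subseteq> ?V h" unfolding zirred_def by blast
      then show "(\<forall>p\<in>Z i. g p = 0) \<or> (\<forall>p\<in>Z i. h p = 0)" by blast
    next
      show "Z 0 \<noteq> {}" using H by (simp add: zirred_def)
      show "Z k \<subseteq> sing_dual q" using H by simp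
      show "\<And>i. i < k \<Longrightarrow> Z i \<subseteq> Z (Suc i)" using H by blast
    qed (use f dual_poly_low x1 x2 in auto)
    then show "k + 2 \<le> mdim q" using card by simp
  qed
qed

lemma sing_dual_empty:
  assumes "mdim q \<le> lie_index q"
  shows "sing_dual q = {}"
  using assms order.trans[OF mat.dim_subset[OF stab_subset] assms[unfolded mdim_eq_dim]]
  by (auto simp: sing_dual_def mdim_eq_dim not_less[symmetric])

theorem codim_ge_regular_plane:
  fixes q :: "('k::field^'m^'m) set"
  assumes ac: "alg_closed TYPE('k)"
    and sub: "mat.subspace q" and closed: "\<And>x y. x \<in> q \<Longrightarrow> y \<in> q \<Longrightarrow> lie_br x y \<in> q"
    and dual: "\<alpha> \<in> dual_sp q" "\<beta> \<in> dual_sp q"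
    and reg: "\<And>s t. (s, t) \<noteq> (0, 0) \<Longrightarrow> mdim (stab q (\<lambda>x. s * \<alpha> x + t * \<beta> x)) \<le> lie_index q"
  shows "codim_ge q (sing_dual q) 2"
proof (cases "\<exists>s t. (s, t) \<noteq> (0, 0) \<and> (\<forall>x\<in>q. s * \<alpha> x + t * \<beta> x = 0)")
  \<comment> \<open>The functional that vanishes on \<open>q\<close> has stabiliser
    \<open>q\<close>. As it is regular, the index is the full dimension and nothing is singular.
    This occurs for a single Jordan string, where \<open>hess_coeff\<close> is zero.\<close>
  case True
  then obtain s t where st: "(s, t) \<noteq> (0, 0)" "\<forall>x\<in>q. s * \<alpha> x + t * \<beta> x = 0" by blast
  have "stab q (\<lambda>x. s * \<alpha> x + t * \<beta> x) = q"
    using st(2) closed by (auto simp: stab_def)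
  then have "sing_dual q = {}" using reg[OF st(1)] by (intro sing_dual_empty) simp
  then show ?thesis by (fastforce simp: codim_ge_def zirred_def)
next
  case False
  then have indep: "s = 0 \<and> t = 0" if "\<forall>x\<in>q. s * \<alpha> x + t * \<beta> x = 0" for s t using that by blast
  obtain u where u: "u \<in> q" "\<alpha> u \<noteq> 0" using indep[of 1 0] by auto
  obtain v where v: "v \<in> q" "\<alpha> u * \<beta> v - \<beta> u * \<alpha> v \<noteq> 0"
    using indep[of "- \<beta> u" "\<alpha> u"] u(2) by (auto simp: algebra_simps)
  \<comment> \<open>Cramer's rule: \<open>b1\<close> and \<open>b2\<close> come from inverting the 2
    by 2 matrix of values of \<alpha> and \<beta> at \<open>u\<close> and \<open>v\<close>.\<close>
  define d where "d = \<alpha> u * \<beta> v - \<beta> u * \<alpha> v"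
  have d: "d \<noteq> 0" using v(2) by (simp add: d_def)
  define b1 where "b1 = smat (\<beta> v / d) u + smat (- \<beta> u / d) v"
  define b2 where "b2 = smat (- \<alpha> v / d) u + smat (\<alpha> u / d) v"
  have lin: "f (smat a u + smat c v) = a * f u + c * f v" if "f \<in> dual_sp q" for f a c
    using u v sub by (simp add: dual_add[OF that] dual_smat[OF that] mat.subspace_scale)
  have b: "b1 \<in> q" "b2 \<in> q" "\<alpha> b1 = 1" "\<beta> b1 = 0" "\<alpha> b2 = 0" "\<beta> b2 = 1"
  proof -
    show "b1 \<in> q" "b2 \<in> q"
      unfolding b1_def b2_def
      by (intro mat.subspace_add[OF sub] mat.subspace_scale[OF sub] u(1) v(1))+
    have e: "\<beta> v / d * a + - \<beta> u / d * c = (a * \<beta> v - \<beta> u * c) / d"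
      "- \<alpha> v / d * a + \<alpha> u / d * c = (\<alpha> u * c - \<alpha> v * a) / d" for a c
      by (simp_all add: diff_divide_distrib mult.commute)
    show "\<alpha> b1 = 1" "\<beta> b1 = 0" "\<alpha> b2 = 0" "\<beta> b2 = 1"
      unfolding b1_def b2_def lin[OF dual(1)] lin[OF dual(2)] e
      using d by (simp_all add: d_def mult.commute)
  qed
  define K where "K = {x \<in> q. \<alpha> x = 0 \<and> \<beta> x = 0}"
  have K: "mat.subspace K"
  proof -
    have "K = {x \<in> q. \<alpha> x = 0} \<inter> {x \<in> q. \<beta> x = 0}" by (auto simp: K_def)
    then show ?thesis using subspace_dual_kernel[OF _ sub] dual by (simp add: mat.subspace_inter)
  qed
  obtain B where B: "B \<subseteq> K" "mat.independent B" "K \<subseteq> mat.span B"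
    by (rule mat.basis_exists)
  have span: "mat.span B = K" by (rule mat.span_subspace[OF B(1,3) K])
  have fin: "finite B" using B(2) by (rule mat.finiteI_independent)
  have n2: "b2 \<notin> mat.span B" using b unfolding span K_def by simp
  have n1: "b1 \<notin> mat.span (insert b2 B)"
  proof
    assume "b1 \<in> mat.span (insert b2 B)"
    then obtain c where c: "b1 - smat c b2 \<in> K" unfolding mat.span_breakdown_eq span by blast
    have "\<alpha> (b1 - smat c b2) = 1"
      using b dual_diff[OF dual(1) sub b(1) mat.subspace_scale[OF sub b(2)]] dual_smat[OF dual(1) b(2)]
      by simp
    then show False using c by (simp add: K_def)
  qed
  have "mat.independent (insert b1 (insert b2 B))"
    using B(2) n1 n2 by (intro mat.independent_insertI)
  moreover have "insert b1 (insert b2 B) \<subseteq> q" using b B(1) by (auto simp: K_def)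
  ultimately have "card (insert b1 (insert b2 B)) \<le> mdim q"
    unfolding mdim_eq_dim by (intro mat.independent_card_le_dim)
  moreover have "b2 \<notin> B" "b1 \<notin> insert b2 B" using n1 n2 mat.span_base by blast+
  ultimately have "card B + 2 \<le> mdim q" using fin by simp
  moreover have "regular_plane q \<alpha> \<beta> b1 b2 B"
  proof unfold_locales
    show "B \<subseteq> q" "mat.span B = {x \<in> q. \<alpha> x = 0 \<and> \<beta> x = 0}"
      using B(1) span by (auto simp: K_def)
  qed (fact ac sub closed dual reg b fin)+
  ultimately show ?thesis by (intro codim_ge_independent_plane)
qed

section \<open>The symplectic Lie algebra\<close>

text \<open>Over a finite field, one plus the product of all \<open>X - a\<close> has no
  root.\<close>

lemma infinite_alg_closed:
  assumes "alg_closed TYPE('k::field)"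
  shows "infinite (UNIV :: 'k set)"
proof
  assume fin: "finite (UNIV :: 'k set)"
  define p :: "'k poly" where "p = (\<Prod>a\<in>UNIV. [:- a, 1:]) + 1"
  have "poly (\<Prod>a\<in>UNIV. [:- a, 1:]) x = 0" for x :: 'k
    using fin by (simp add: poly_prod prod_zero_iff)
  then have p1: "poly p x = 1" for x by (simp add: p_def)
  have "degree (\<Prod>a\<in>(UNIV :: 'k set). [:- a, 1:]) = card (UNIV :: 'k set)"
    by (subst degree_prod_eq_sum_degree) auto
  moreover have "card (UNIV :: 'k set) > 0" using fin by (simp add: card_gt_0_iff)
  ultimately have "degree p > 0" unfolding p_def by (subst degree_add_eq_left) auto
  then obtain x where "poly p x = 0" using assms unfolding alg_closed_def by blast
  then show False using p1 by simp
qed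

section \<open>The symplectic form and its adjoint\<close>

definition bil :: "'k::field^('n::finite + 'n) \<Rightarrow> 'k^('n + 'n) \<Rightarrow> 'k" where
  "bil u v = (\<Sum>a\<in>UNIV. u $ Inl a * v $ Inr a - u $ Inr a * v $ Inl a)"

lemma sum_UNIV_Plus: "(\<Sum>i\<in>UNIV. f i) = (\<Sum>a\<in>UNIV. f (Inl a)) + (\<Sum>a\<in>UNIV. f (Inr a))"
  for f :: "'a::finite + 'b::finite \<Rightarrow> 'c::comm_monoid_add"
  by (subst UNIV_Plus_UNIV[symmetric], subst sum.Plus) auto

lemma bil_add_left: "bil (u + v) w = bil u w + bil v w"
  and bil_add_right: "bil w (u + v) = bil w u + bil w v"
  and bil_scale_left: "bil (c *s u) w = c * bil u w"
  and bil_scale_right: "bil w (c *s u) = c * bil w u"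
  by (simp_all add: bil_def sum_distrib_left algebra_simps flip: sum.distrib)

lemma bil_zero [simp]: "bil 0 v = 0" "bil v 0 = 0"
  by (simp_all add: bil_def)

lemma bil_neg: "bil (- u) v = - bil u v" "bil v (- u) = - bil v u"
  by (simp_all add: bil_def algebra_simps flip: sum_negf)

lemma bil_skew: "bil v u = - bil u v"
  by (simp add: bil_def algebra_simps flip: sum_negf)

lemma bil_sum_right: "bil w (\<Sum>i\<in>I. f i) = (\<Sum>i\<in>I. bil w (f i))"
  by (induction I rule: infinite_finite_induct) (auto simp: bil_add_right)

lemma bil_axis: "bil (axis (Inl a) 1) v = v $ Inr a" "bil (axis (Inr a) 1) v = - v $ Inl a"
proof -
  have "bil (axis (Inl a) 1) v = (\<Sum>b\<in>UNIV. if b = a then v $ Inr a else 0)"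
    unfolding bil_def by (rule sum.cong) (auto simp: axis_def)
  then show "bil (axis (Inl a) 1) v = v $ Inr a" by simp
  have "bil (axis (Inr a) 1) v = (\<Sum>b\<in>UNIV. if b = a then - v $ Inl a else 0)"
    unfolding bil_def by (rule sum.cong) (auto simp: axis_def)
  then show "bil (axis (Inr a) 1) v = - v $ Inl a" by simp
qed

lemma bil_nondegenerate:
  assumes "\<And>u. bil u v = 0"
  shows "v = 0"
proof -
  have "v $ i = 0" for i
    using assms[of "axis (Inl _) 1"] assms[of "axis (Inr _) 1"]
    by (cases i) (auto simp: bil_axis)
  then show ?thesis by (simp add: vec_eq_iff)
qed

lemma bil_eqI:
  assumes "\<And>u. bil u v = bil u w"
  shows "v = w"
proof -
  have "v - w = 0"
  proof (rule bil_nondegenerate)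
    fix u show "bil u (v - w) = 0"
      using assms[of u] bil_add_right[of u v "- w"] by (simp add: bil_neg)
  qed
  then show ?thesis by simp
qed

lemma matrix_eq_iff_mult: "A = B \<longleftrightarrow> (\<forall>v. A *v v = B *v v)"
  for A B :: "'k::field^'m^'m"
proof
  assume "\<forall>v. A *v v = B *v v"
  then have "(*v) A = (*v) B" by blast
  then have "matrix ((*v) A) = matrix ((*v) B)" by (rule arg_cong)
  then show "A = B" by simp
qed simp

text \<open>The adjoint with respect to \<open>bil\<close>: since \<open>Jmat\<close> squares to -1,
  this is the transpose conjugated by \<open>Jmat\<close>.\<close>

definition sp_adj :: "'k::field^('n::finite + 'n)^('n + 'n) \<Rightarrow> 'k^('n + 'n)^('n + 'n)" where
  "sp_adj x = - (Jmat ** transpose x ** Jmat)"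

lemma Jmat_mult_vec:
  "(Jmat *v v) $ Inl a = v $ Inr a" "(Jmat *v v) $ Inr a = - v $ Inl a"
proof -
  have "(Jmat *v v) $ Inl a = (\<Sum>b\<in>UNIV. if b = a then v $ Inr a else 0)"
    unfolding matrix_vector_mult_def vec_lambda_beta sum_UNIV_Plus
    unfolding Jmat_def by (simp add: if_distrib[of "\<lambda>x. x * _"] cong: if_cong)
  then show "(Jmat *v v) $ Inl a = v $ Inr a" by simp
  have "(Jmat *v v) $ Inr a = (\<Sum>b\<in>UNIV. if b = a then - v $ Inl a else 0)"
    unfolding matrix_vector_mult_def vec_lambda_beta sum_UNIV_Plus
    unfolding Jmat_def by (simp add: if_distrib[of "\<lambda>x. x * _"] cong: if_cong)
  then show "(Jmat *v v) $ Inr a = - v $ Inl a" by simp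
qed

lemma Jmat_Jmat_vec: "Jmat *v (Jmat *v v) = - v"
proof -
  have "(Jmat *v (Jmat *v v)) $ i = (- v) $ i" for i
    by (cases i) (auto simp: Jmat_mult_vec)
  then show ?thesis by (simp add: vec_eq_iff)
qed

lemma bil_dot: "bil u v = (\<Sum>i\<in>UNIV. u $ i * (Jmat *v v) $ i)"
  by (simp add: bil_def sum_UNIV_Plus Jmat_mult_vec sum_subtractf sum_negf)

lemma dot_matrix_mult: "(\<Sum>i\<in>UNIV. (x *v u) $ i * w $ i) = (\<Sum>i\<in>UNIV. u $ i * (transpose x *v w) $ i)"
  for x :: "'k::field^'m^'m"
  unfolding matrix_vector_mult_def vec_lambda_beta sum_distrib_left sum_distrib_right
  by (subst sum.swap) (simp add: Finite_Cartesian_Product.transpose_def mult_ac)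

lemma neg_mat_mult_vec: "(- A) *v v = - (A *v v)"
  for A :: "'k::field^'m^'m"
  by (simp add: vec_eq_iff matrix_vector_mult_def sum_negf)

lemma neg_mult_vec: "A *v (- v) = - (A *v v)"
  for A :: "'k::field^'m^'m"
  by (simp add: vec_eq_iff matrix_vector_mult_def sum_negf)

lemma bil_adj: "bil (x *v u) v = bil u (sp_adj x *v v)"
proof -
  have "Jmat *v (sp_adj x *v v) = transpose x *v (Jmat *v v)"
    unfolding sp_adj_def neg_mat_mult_vec neg_mult_vec matrix_vector_mul_assoc[symmetric] Jmat_Jmat_vec
    by simp
  then show ?thesis by (simp add: bil_dot dot_matrix_mult)
qed

lemma sp_adj_eqI:
  assumes "\<And>u v. bil (x *v u) v = bil u (y *v v)"
  shows "sp_adj x = y"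
  unfolding matrix_eq_iff_mult
proof
  fix v
  show "sp_adj x *v v = y *v v" by (rule bil_eqI) (simp only: assms bil_adj[symmetric])
qed

lemma smat_mult_vec: "smat c A *v v = c *s (A *v v)"
  by (simp add: vec_eq_iff matrix_vector_mult_def sum_distrib_left mult.assoc)

lemma bil_adj': "bil u (x *v v) = bil (sp_adj x *v u) v"
  by (metis bil_adj bil_skew neg_equal_iff_equal)

lemma sp_adj_add: "sp_adj (x + y) = sp_adj x + sp_adj y"
  by (rule sp_adj_eqI) (simp add: matrix_vector_mult_add_rdistrib bil_add_left bil_add_right bil_adj)

lemma sp_adj_smat: "sp_adj (smat c x) = smat c (sp_adj x)"
  by (rule sp_adj_eqI) (simp add: smat_mult_vec bil_scale_left bil_scale_right bil_adj)

lemma sp_adj_mult: "sp_adj (x ** y) = sp_adj y ** sp_adj x"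
  by (rule sp_adj_eqI) (simp add: matrix_vector_mul_assoc[symmetric] bil_adj)

lemma sp_adj_adj: "sp_adj (sp_adj x) = x"
  by (rule sp_adj_eqI) (simp add: bil_adj')

lemma smat_minus_one: "smat (- 1) x = - x"
  by (simp add: vec_eq_iff)

lemma sp_adj_neg: "sp_adj (- x) = - sp_adj x"
  using sp_adj_smat[of "- 1" x] by (simp add: smat_minus_one)

lemma sp_adj_diff: "sp_adj (x - y) = sp_adj x - sp_adj y"
  using sp_adj_add[of x "- y"] by (simp add: sp_adj_neg)

lemma sp_adj_one: "sp_adj (mat 1) = mat 1"
  by (rule sp_adj_eqI) simp

lemma sp_iff: "x \<in> sp \<longleftrightarrow> sp_adj x = - x"
proof -
  have "x \<in> sp \<longleftrightarrow> (\<forall>v. (transpose x ** Jmat + Jmat ** x) *v v = 0)"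
    unfolding sp_def matrix_eq_iff_mult by simp
  also have "\<dots> \<longleftrightarrow> (\<forall>v. transpose x *v (Jmat *v v) + Jmat *v (x *v v) = 0)"
    by (simp add: matrix_vector_mult_add_rdistrib matrix_vector_mul_assoc)
  also have "\<dots> \<longleftrightarrow> (\<forall>v. Jmat *v (transpose x *v (Jmat *v v)) = x *v v)"
  proof -
    have "transpose x *v (Jmat *v v) + Jmat *v (x *v v) = 0
      \<longleftrightarrow> Jmat *v (transpose x *v (Jmat *v v)) = x *v v" (is "?l + ?r = 0 \<longleftrightarrow> _") for v
    proof
      assume "?l + ?r = 0"
      then have "Jmat *v ?l = - (Jmat *v ?r)" by (metis add_eq_0_iff2 neg_mult_vec)
      then show "Jmat *v ?l = x *v v" by (simp add: Jmat_Jmat_vec)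
    next
      assume "Jmat *v ?l = x *v v"
      then have "Jmat *v (Jmat *v ?l) = ?r" by simp
      then show "?l + ?r = 0" unfolding Jmat_Jmat_vec by (metis add.right_inverse)
    qed
    then show ?thesis by blast
  qed
  also have "\<dots> \<longleftrightarrow> (\<forall>v. sp_adj x *v v = (- x) *v v)"
    unfolding sp_adj_def neg_mat_mult_vec matrix_vector_mul_assoc[symmetric] by simp
  finally show ?thesis unfolding matrix_eq_iff_mult .
qed

text \<open>The skew matrices for \<epsilon> = - 1 and the self-adjoint ones for \<epsilon> = 1.
  Vinberg's inequality is needed for both and is proved once.\<close>

definition eps_space :: "'k::field \<Rightarrow> ('k^('n::finite + 'n)^('n + 'n)) set" where
  "eps_space \<epsilon> = {x. sp_adj x = smat \<epsilon> x}"

lemma sp_eq_eps: "sp = eps_space (- 1)"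
  by (auto simp: eps_space_def sp_iff smat_minus_one)

lemma subspace_eps: "mat.subspace (eps_space \<epsilon>)"
  unfolding eps_space_def
  by (intro mat.subspaceI)
    (auto simp: sp_adj_add sp_adj_smat mat.scale_right_distrib mult.commute
      intro: trans[OF sp_adj_smat[of 0 0, simplified]])

lemma subspace_sp: "mat.subspace sp"
  unfolding sp_eq_eps by (rule subspace_eps)

lemma subspace_centraliser:
  assumes "mat.subspace W"
  shows "mat.subspace (centraliser W e)"
  using assms unfolding centraliser_def
  by (intro mat.subspaceI)
    (auto simp: lie_br_add_left lie_br_smat_left mat.subspace_0 mat.subspace_add mat.subspace_scale)

lemma sp_adj_lie_br: "sp_adj (lie_br x y) = lie_br (sp_adj y) (sp_adj x)"
  by (simp add: lie_br_def sp_adj_diff sp_adj_mult)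

lemma eps_lie_br_sp:
  assumes "x \<in> eps_space \<epsilon>" "e \<in> sp"
  shows "lie_br e x \<in> eps_space \<epsilon>"
proof -
  have "sp_adj (lie_br e x) = lie_br (smat \<epsilon> x) (smat (- 1) e)"
    using assms by (simp add: eps_space_def sp_iff sp_adj_lie_br smat_minus_one del: mat.scale_minus_left)
  also have "\<dots> = smat \<epsilon> (smat (- 1) (lie_br x e))"
    by (simp only: lie_br_smat_left lie_br_smat_right mat.scale_left_commute)
  also have "\<dots> = smat \<epsilon> (lie_br e x)" by (simp only: smat_minus_one lie_br_skew[of e x])
  finally show ?thesis by (simp add: eps_space_def)
qed

text \<open>The adjoint reverses brackets, and the two signs cancel. Hence a functional on the skew
  centraliser also defines a form on the self-adjoint one.\<close>

lemma lie_br_eps_eps: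
  assumes "x \<in> eps_space \<epsilon>" "y \<in> eps_space \<epsilon>" "\<epsilon> * \<epsilon> = 1"
  shows "lie_br x y \<in> sp"
proof -
  have "sp_adj (lie_br x y) = smat \<epsilon> (smat \<epsilon> (lie_br y x))"
    using assms(1,2) by (simp only: eps_space_def mem_Collect_eq sp_adj_lie_br lie_br_smat_left lie_br_smat_right)
  also have "\<dots> = lie_br y x" using assms(3) by simp
  finally show ?thesis unfolding sp_iff using lie_br_skew[of y x] by simp
qed

lemma jacobi_centraliser:
  assumes "lie_br x e = 0" "lie_br y e = 0"
  shows "lie_br (lie_br x y) e = 0"
proof -
  have "x ** e = e ** x" "y ** e = e ** y" using assms by (auto simp: lie_br_def)
  then have "x ** y ** e = e ** (x ** y)" "y ** x ** e = e ** (y ** x)"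
    by (metis matrix_mul_assoc)+
  then show ?thesis by (simp add: lie_br_def matrix_diff_mult matrix_mult_diff)
qed

lemma lie_br_eps_centraliser:
  assumes "x \<in> centraliser (eps_space \<epsilon>) e" "y \<in> centraliser (eps_space \<epsilon>) e" "\<epsilon> * \<epsilon> = 1"
  shows "lie_br x y \<in> centraliser sp e"
  using assms lie_br_eps_eps[of x \<epsilon> y] jacobi_centraliser[of x e y] by (simp add: centraliser_def)

section \<open>Vinberg's inequality\<close>

lemma centraliser_subset: "centraliser W z \<subseteq> W"
  by (auto simp: centraliser_def)

text \<open>Bracketing \<open>R\<close> with \<open>e + s \<xi>\<close> gives \<open>s\<close> times
  the bracket with \<xi>. After division by \<open>s\<close>, the images of \<open>R\<close> and
  \<open>C\<close> form a perturbation of the independent family in \<open>inj\<close>, and so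
  remain independent for almost all \<open>s\<close>. Then the span of \<open>R\<close> and
  \<open>C\<close> meets the centraliser of \<open>e + s \<xi>\<close> trivially.\<close>

lemma generic_centraliser_dim:
  assumes W: "mat.subspace W" and R: "R \<subseteq> W" and C: "C \<subseteq> W" and disj: "R \<inter> C = {}"
    and indep: "mat.independent (R \<union> C)"
    and Re: "\<And>r. r \<in> R \<Longrightarrow> lie_br e r = 0"
    and inj: "\<And>c. (\<Sum>r\<in>R. smat (c r) (lie_br \<xi> r)) + (\<Sum>b\<in>C. smat (c b) (lie_br e b)) = 0 \<Longrightarrow>
        \<forall>b\<in>R \<union> C. c b = 0"
  shows "finite {s. s \<noteq> 0 \<and> card (R \<union> C) + mat.dim (centraliser W (e + smat s \<xi>)) > mat.dim W}" (is "finite ?S")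
proof -
  have fin: "finite (R \<union> C)" using indep by (rule mat.finiteI_independent)
  then have finR: "finite R" "finite C" by auto
  define a where "a b = (if b \<in> R then lie_br \<xi> b else lie_br e b)" for b
  define a' where "a' b = (if b \<in> R then 0 else lie_br \<xi> b)" for b
  have a: "\<forall>b\<in>R \<union> C. c b = 0" if "(\<Sum>b\<in>R \<union> C. smat (c b) (a b)) = 0" for c
  proof -
    have "(\<Sum>b\<in>R \<union> C. smat (c b) (a b)) = (\<Sum>r\<in>R. smat (c r) (lie_br \<xi> r)) + (\<Sum>b\<in>C. smat (c b) (lie_br e b))"
      unfolding sum.union_disjoint[OF finR disj]
      by (rule arg_cong2[of _ _ _ _ "(+)"]; rule sum.cong) (use disj in \<open>auto simp: a_def\<close>)
    then show ?thesis using inj that by simp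
  qed
  let ?bad = "{s. \<exists>c. (\<Sum>b\<in>R \<union> C. smat (c b) (a b + smat s (a' b))) = 0 \<and> (\<exists>b\<in>R \<union> C. c b \<noteq> 0)}"
  have "finite ?bad" by (rule mat.finite_dependent_perturbation[OF fin a])
  moreover have "?S \<subseteq> ?bad"
  proof (rule subsetI, rule ccontr)
    fix s assume s: "s \<in> ?S"
      and good: "s \<notin> ?bad"
    have s0: "s \<noteq> 0" using s by simp
    have "mat.span (R \<union> C) \<inter> centraliser W (e + smat s \<xi>) \<subseteq> {0}"
    proof
      fix x assume x: "x \<in> mat.span (R \<union> C) \<inter> centraliser W (e + smat s \<xi>)"
      then obtain c where c: "x = (\<Sum>b\<in>R \<union> C. smat (c b) b)" using mat.span_finite[OF fin] by auto
      \<comment> \<open>Moves the factor \<open>s\<close> from the brackets with \<open>R\<close>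
        into the coefficients.\<close>
      define d where "d b = (if b \<in> R then s * c b else c b)" for b
      have "lie_br (e + smat s \<xi>) x = 0"
        using x lie_br_skew[of "e + smat s \<xi>" x] by (simp add: centraliser_def)
      moreover have "lie_br (e + smat s \<xi>) x = (\<Sum>b\<in>R \<union> C. smat (d b) (a b + smat s (a' b)))"
        unfolding c lie_br_sum_right
      proof (rule sum.cong)
        fix b assume "b \<in> R \<union> C"
        then show "smat (c b) (lie_br (e + smat s \<xi>) b) = smat (d b) (a b + smat s (a' b))"
          using Re[of b] by (auto simp: d_def a_def a'_def lie_br_add_left lie_br_smat_left mult.commute)
      qed simp
      ultimately have "\<forall>b\<in>R \<union> C. d b = 0" using good by auto
      then have "\<forall>b\<in>R \<union> C. c b = 0" using s0 by (auto simp: d_def split: if_splits)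
      then show "x \<in> {0}" unfolding c by simp
    qed
    then have "card (R \<union> C) + mat.dim (centraliser W (e + smat s \<xi>)) \<le> mat.dim W"
      using indep R C W subspace_centraliser[OF W] centraliser_subset[of W "e + smat s \<xi>"]
      by (intro mat.card_add_dim_le) auto
    then show False using s by simp
  qed
  ultimately show ?thesis by (rule finite_subset[rotated])
qed

section \<open>Matrices with independent powers\<close>

primrec mpow :: "'k::field^'m^'m \<Rightarrow> nat \<Rightarrow> 'k^'m^'m" where
  "mpow x 0 = mat 1"
| "mpow x (Suc k) = x ** mpow x k"

lemma mpow_commute: "x ** mpow x k = mpow x k ** x"
  by (induction k) (simp_all, metis matrix_mul_assoc)

lemma sp_adj_mpow: "x \<in> sp \<Longrightarrow> sp_adj (mpow x k) = smat ((- 1) ^ k) (mpow x k)"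
proof (induction k)
  case (Suc k)
  then have "sp_adj (mpow x (Suc k)) = smat ((- 1) ^ k) (mpow x k) ** smat (- 1) x"
    unfolding smat_minus_one by (simp add: sp_adj_mult sp_iff)
  also have "\<dots> = smat ((- 1) ^ Suc k) (mpow x (Suc k))"
    by (simp add: smat_mult_left smat_mult_right mpow_commute mult.commute
        del: mat.scale_minus_left power_Suc) simp
  finally show ?case .
qed (simp add: sp_adj_one)

text \<open>The determinant of the vectors \<open>(y + u z)\<^sup>k (1, \<dots>, 1)\<close> is a polynomial in \<open>u\<close>, and a Vandermonde
  determinant at \<open>u = 0\<close>.\<close>
lemma finite_dependent_powers:
  fixes d :: "'m::finite \<Rightarrow> 'k::field" and z :: "'k^'m^'m"
  assumes d: "inj d"
  defines "y \<equiv> (\<chi> i j. if i = j then d i else 0)"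
  shows "finite {u. \<exists>c. (\<Sum>k<CARD('m). smat (c k) (mpow (y + smat u z) k)) = 0 \<and> (\<exists>k<CARD('m). c k \<noteq> 0)}" (is "finite ?bad")
proof -
  obtain idx :: "'m \<Rightarrow> nat" where idx: "bij_betw idx UNIV {..<CARD('m)}"
    using finite_same_card_bij[of "UNIV :: 'm set" "{..<CARD('m)}"] by auto
  define Y :: "'k poly^'m^'m" where "Y = (\<chi> i j. [:y $ i $ j, z $ i $ j:])"
  define pv where "pv k = (((*v) Y) ^^ k) (\<chi> i. 1)" for k
  have ev: "poly (pv k $ r) u = (mpow (y + smat u z) k *v (\<chi> i. 1)) $ r" for k r u
  proof (induction k arbitrary: r)
    case 0
    then show ?case by (simp add: pv_def)
  next
    case (Suc k)
    have "pv (Suc k) = Y *v pv k" by (simp add: pv_def)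
    then have "poly (pv (Suc k) $ r) u = (\<Sum>j\<in>UNIV. poly (Y $ r $ j) u * poly (pv k $ j) u)"
      by (simp only: matrix_vector_mult_def vec_lambda_beta poly_sum poly_mult)
    also have "\<dots> = (\<Sum>j\<in>UNIV. (y + smat u z) $ r $ j * (mpow (y + smat u z) k *v (\<chi> i. 1)) $ j)"
      unfolding Suc.IH by (simp add: Y_def)
    also have "\<dots> = ((y + smat u z) *v (mpow (y + smat u z) k *v (\<chi> i. 1))) $ r"
      by (simp only: matrix_vector_mult_def vec_lambda_beta)
    finally show ?case by (simp add: matrix_vector_mul_assoc)
  qed
  define D where "D = (\<chi> r c. pv (idx c) $ r)"
  have det: "poly (det D) u = det (\<chi> r c. (mpow (y + smat u z) (idx c) *v (\<chi> i. 1)) $ r)" for u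
    by (simp add: det_def poly_sum poly_prod D_def ev)
  have Dc: "(\<chi> r c. (mpow (y + smat u z) (idx c) *v (\<chi> i. 1)) $ r) *v (\<chi> i. c (idx i))
      = (\<Sum>k<CARD('m). smat (c k) (mpow (y + smat u z) k)) *v (\<chi> i. 1)" (is "?A u *v _ = _") for u c
  proof -
    have "(?A u *v (\<chi> i. c (idx i))) $ r = (\<Sum>k<CARD('m). c k * (mpow (y + smat u z) k *v (\<chi> i. 1)) $ r)" for r
      using sum.reindex_bij_betw[OF idx, of "\<lambda>k. c k * (mpow (y + smat u z) k *v (\<chi> i. 1)) $ r"]
      by (simp add: matrix_vector_mult_def mult.commute)
    moreover have "(sum f K *v v) $ r = (\<Sum>k\<in>K. (f k *v v) $ r)" for f :: "nat \<Rightarrow> 'k^'m^'m" and K v r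
      by (induction K rule: infinite_finite_induct) (auto simp: matrix_vector_mult_add_rdistrib)
    ultimately show ?thesis by (simp add: vec_eq_iff smat_mult_vec)
  qed
  have sing: "poly (det D) u = 0 \<longleftrightarrow> (\<exists>v. ?A u *v v = 0 \<and> v \<noteq> 0)" for u
    using invertible_det_nz[of "?A u"] matrix_left_invertible_ker[of "?A u"]
    unfolding det invertible_left_inverse by blast
  have ydiag: "(mpow y k *v (\<chi> i. 1)) $ r = d r ^ k" for k r
  proof (induction k arbitrary: r)
    case (Suc k)
    have "(mpow y (Suc k) *v (\<chi> i. 1)) $ r = (\<Sum>j\<in>UNIV. y $ r $ j * (mpow y k *v (\<chi> i. 1)) $ j)"
      by (simp add: matrix_vector_mul_assoc[symmetric]) (simp only: matrix_vector_mult_def vec_lambda_beta)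
    also have "\<dots> = (\<Sum>j\<in>UNIV. if j = r then d r ^ Suc k else 0)"
      unfolding Suc.IH by (rule sum.cong) (auto simp: y_def)
    finally show ?case by simp
  qed simp
  have "poly (det D) 0 \<noteq> 0"
  proof
    assume "poly (det D) 0 = 0"
    then obtain v where v: "?A 0 *v v = 0" "v \<noteq> 0" using sing by blast
    \<comment> \<open>A kernel vector of the Vandermonde matrix is a nonzero polynomial of degree
      below \<open>CARD('m)\<close> with all the distinct values \<open>d r\<close> as
      roots.\<close>
    define p where "p = (\<Sum>c\<in>UNIV. monom (v $ c) (idx c))"
    have "poly p (d r) = 0" for r
    proof -
      have "(?A 0 *v v) $ r = poly p (d r)"
        by (simp add: ydiag) (simp add: matrix_vector_mult_def p_def poly_sum poly_monom mult.commute)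
      then show ?thesis using v(1) by simp
    qed
    then have "range d \<subseteq> {x. poly p x = 0}" by auto
    moreover have p0: "p \<noteq> 0"
    proof -
      obtain c where c: "v $ c \<noteq> 0" using v(2) by (metis vec_eq_iff zero_index)
      have "coeff p (idx c) = (\<Sum>c'\<in>UNIV. if c' = c then v $ c else 0)"
        unfolding p_def coeff_sum using idx by (intro sum.cong) (auto simp: bij_betw_def inj_eq)
      then show ?thesis using c by auto
    qed
    ultimately have "card (range d) \<le> degree p"
      using card_mono[OF poly_roots_finite[OF p0]] card_poly_roots_bound[OF p0] le_trans by blast
    moreover have "degree p \<le> CARD('m) - 1"
      unfolding p_def
    proof (rule degree_sum_le)
      fix c :: 'm
      have "idx c < CARD('m)" using idx by (auto simp: bij_betw_def)
      then show "degree (monom (v $ c) (idx c)) \<le> CARD('m) - 1"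
        using degree_monom_le[of "v $ c" "idx c"] by linarith
    qed simp
    moreover have "0 < CARD('m)" by simp
    ultimately show False using card_image[OF d] by linarith
  qed
  then have "finite {u. poly (det D) u = 0}" by (intro poly_roots_finite) auto
  moreover have "?bad \<subseteq> {u. poly (det D) u = 0}"
  proof
    fix u assume "u \<in> ?bad"
    then obtain c k where c: "(\<Sum>k<CARD('m). smat (c k) (mpow (y + smat u z) k)) = 0"
      and k: "k < CARD('m)" "c k \<noteq> 0" by blast
    obtain i where "idx i = k" using idx k by (metis bij_betw_def imageE lessThan_iff)
    then have "(\<chi> i. c (idx i)) \<noteq> 0" using k by (auto simp: vec_eq_iff)
    then show "u \<in> {u. poly (det D) u = 0}" using Dc[where c = c and u = u] c sing[of u] by auto
  qed
  ultimately show ?thesis by (rule finite_subset[rotated])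
qed

text \<open>Square roots of distinct nonzero elements: equality up to sign of two of them makes
  their squares equal. Needed for distinct eigenvalues in \<open>sp\<close> and for the entries of
  the diagonal functional.\<close>

lemma signed_distinct_values:
  assumes ac: "alg_closed TYPE('k::field)" and two: "(2 :: 'k) \<noteq> 0"
  shows "\<exists>f :: nat \<Rightarrow> 'k. inj f \<and> (\<forall>i j. f i \<noteq> - f j)"
proof -
  have "infinite (UNIV - {0 :: 'k})" using infinite_alg_closed[OF ac] by simp
  then obtain g :: "nat \<Rightarrow> 'k" where g: "inj g" "range g \<subseteq> UNIV - {0}"
    using infinite_countable_subset by blast
  have "\<exists>x. x * x = g i" for i
  proof -
    have "degree [:- g i, 0, 1:] > 0" by simp
    then obtain x where "poly [:- g i, 0, 1:] x = 0" using ac unfolding alg_closed_def by blast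
    then show ?thesis by (auto simp: algebra_simps)
  qed
  then obtain f where f: "\<And>i. f i * f i = g i" by metis
  have eq: "i = j" if "f i = f j \<or> f i = - f j" for i j
  proof -
    have "g i = g j" using that f[of i] f[of j] by auto
    then show ?thesis using injD[OF g(1)] by blast
  qed
  have "f i \<noteq> - f j" for i j
  proof
    assume a: "f i = - f j"
    then have "2 * f i = 0" using eq[of i j] by (metis add.right_inverse mult_2)
    then show False using two f[of i] g(2) by auto
  qed
  then show ?thesis using eq by (metis injI)
qed

lemma centraliser_smat:
  assumes "c \<noteq> 0"
  shows "centraliser W (smat c z) = centraliser W z"
  using assms by (auto simp: centraliser_def lie_br_smat_right)

text \<open>If the first 2 n powers of a skew \<open>T\<close> are independent, the n even ones are
  self-adjoint, the n odd ones are skew, and all commute with \<open>T\<close>. Such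
  \<open>T\<close> exist arbitrarily close to \<open>z\<close> on a line through it, and
  centralisers can only grow in the limit.\<close>

lemma eps_centraliser_dim_ge:
  fixes z :: "'k::field^('n::finite + 'n)^('n + 'n)"
  assumes ac: "alg_closed TYPE('k)" and two: "(2::'k) \<noteq> 0" and z: "z \<in> sp" and \<epsilon>: "\<epsilon> = 1 \<or> \<epsilon> = - 1"
  shows "CARD('n) \<le> mat.dim (centraliser (eps_space \<epsilon>) z)"
proof -
  let ?W = "eps_space \<epsilon> :: ('k^('n + 'n)^('n + 'n)) set"
  note inf = infinite_alg_closed[OF ac]
  obtain f :: "nat \<Rightarrow> 'k" where f: "inj f" "\<And>i j. f i \<noteq> - f j"
    using signed_distinct_values[OF ac two] by blast
  obtain h :: "'n \<Rightarrow> nat" where h: "inj h"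
    using ex_bij_betw_finite_nat[of "UNIV :: 'n set"] by (auto simp: bij_betw_def)
  \<comment> \<open>The opposite signs put the diagonal matrix into \<open>sp\<close>; the choice of
    \<open>f\<close> keeps its 2 n entries distinct.\<close>
  define d :: "'n + 'n \<Rightarrow> 'k" where "d i = (case i of Inl a \<Rightarrow> f (h a) | Inr a \<Rightarrow> - f (h a))" for i
  have d: "inj d"
  proof (rule injI)
    fix i j assume "d i = d j"
    then show "i = j"
      using f(2) injD[OF f(1)] injD[OF h] by (auto simp: d_def split: sum.splits) (metis minus_minus)+
  qed
  define y :: "'k^('n + 'n)^('n + 'n)" where "y = (\<chi> i j. if i = j then d i else 0)"
  have yv: "(y *v v) $ i = d i * v $ i" for v i
    by (simp add: y_def matrix_vector_mult_def if_distrib[of "\<lambda>x. x * _"] cong: if_cong)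
  have ysp: "y \<in> sp"
    unfolding sp_iff
    by (rule sp_adj_eqI) (auto simp: bil_def neg_mat_mult_vec yv d_def intro!: sum.cong)
  have dim_good: "CARD('n) \<le> mat.dim (centraliser ?W T)"
    if T: "T \<in> sp" and good: "\<not> (\<exists>c. (\<Sum>k<CARD('n + 'n). smat (c k) (mpow T k)) = 0 \<and> (\<exists>k<CARD('n + 'n). c k \<noteq> 0))" for T
  proof -
    have key: "\<forall>k<CARD('n + 'n). c k = 0" if "(\<Sum>k<CARD('n + 'n). smat (c k) (mpow T k)) = 0" for c
      using good that by blast
    have ind: "inj_on (mpow T) {..<CARD('n + 'n)}" "mat.independent (mpow T ` {..<CARD('n + 'n)})"
      using mat.independent_family[of "{..<CARD('n + 'n)}" "mpow T"] key by auto
    define \<delta> :: nat where "\<delta> = (if \<epsilon> = 1 then 0 else 1)"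
    have \<delta>: "\<delta> \<le> 1" "(- 1) ^ \<delta> = \<epsilon>" using \<epsilon> by (auto simp: \<delta>_def)
    define E where "E = (\<lambda>i. 2 * i + \<delta>) ` {..<CARD('n)}"
    have E: "E \<subseteq> {..<CARD('n + 'n)}" using \<delta>(1) by (auto simp: E_def)
    have cardE: "card E = CARD('n)" unfolding E_def by (subst card_image) (auto simp: inj_on_def)
    have "mpow T ` E \<subseteq> centraliser ?W T"
    proof -
      have "mpow T (2 * i + \<delta>) \<in> centraliser ?W T" for i
        using sp_adj_mpow[OF T, of "2 * i + \<delta>"] \<delta>(2) mpow_commute[of T "2 * i + \<delta>"]
        by (simp add: centraliser_def eps_space_def lie_br_def power_add)
      then show ?thesis by (auto simp: E_def)
    qed
    then have "card (mpow T ` E) \<le> mat.dim (centraliser ?W T)"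
      using mat.independent_mono[OF ind(2) image_mono[OF E]] by (intro mat.independent_card_le_dim)
    moreover have "card (mpow T ` E) = CARD('n)"
      using cardE card_image[OF inj_on_subset[OF ind(1) E]] by simp
    ultimately show ?thesis by simp
  qed
  let ?bad1 = "{u. \<exists>c. (\<Sum>k<CARD('n + 'n). smat (c k) (mpow (y + smat u z) k)) = 0 \<and> (\<exists>k<CARD('n + 'n). c k \<noteq> 0)}"
  have fin1: "finite ?bad1" unfolding y_def by (rule finite_dependent_powers[OF d])
  note Wz = subspace_centraliser[OF subspace_eps, of \<epsilon> z]
  obtain C where C: "mat.independent C" "finite C" "C \<subseteq> ?W" "mat.span C \<inter> centraliser ?W z = {0}"
    "card C + mat.dim (centraliser ?W z) = mat.dim ?W"
    by (rule mat.complement_exists[OF subspace_eps Wz centraliser_subset])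
  let ?bad2 = "{s. s \<noteq> 0 \<and> card ({} \<union> C) + mat.dim (centraliser ?W (z + smat s y)) > mat.dim ?W}"
  have fin2: "finite ?bad2"
  proof (rule generic_centraliser_dim[OF subspace_eps])
    fix c assume "(\<Sum>r\<in>{}. smat (c r) (lie_br y r)) + (\<Sum>b\<in>C. smat (c b) (lie_br z b)) = 0"
    then have "lie_br z (\<Sum>b\<in>C. smat (c b) b) = 0" by (simp add: lie_br_sum_right)
    then have "lie_br (\<Sum>b\<in>C. smat (c b) b) z = 0" using lie_br_skew[of "\<Sum>b\<in>C. smat (c b) b" z] by simp
    moreover have "(\<Sum>b\<in>C. smat (c b) b) \<in> mat.span C" by (intro mat.span_sum mat.span_scale mat.span_base)
    moreover have "mat.span C \<subseteq> ?W" using C(3) subspace_eps by (rule mat.span_minimal)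
    ultimately have "(\<Sum>b\<in>C. smat (c b) b) = 0" using C(4) unfolding centraliser_def by blast
    then show "\<forall>b\<in>{} \<union> C. c b = 0"
      using mat.independentD[OF C(1,2) order.refl, of c] by simp
  qed (use C in auto)
  \<comment> \<open>\<open>z + smat s y\<close> and \<open>y + smat (inverse s) z\<close> are
    proportional and have the same centraliser. The first form is a perturbation of
    \<open>z\<close>, the second one of \<open>y\<close>, so \<open>s\<close> and
    \<open>inverse s\<close> each avoid a finite set.\<close>
  have "finite (insert 0 (?bad2 \<union> inverse ` ?bad1))" using fin1 fin2 by simp
  then obtain s where s: "s \<notin> insert 0 (?bad2 \<union> inverse ` ?bad1)" using ex_new_if_finite[OF inf] by blast
  have s0: "s \<noteq> 0" using s by simp
  have "inverse s \<notin> ?bad1"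
  proof
    assume "inverse s \<in> ?bad1"
    then have "inverse (inverse s) \<in> inverse ` ?bad1" by (rule imageI)
    then show False using s by simp
  qed
  moreover have "y + smat (inverse s) z \<in> sp"
    using ysp z subspace_sp by (auto intro: mat.subspace_add mat.subspace_scale)
  ultimately have "CARD('n) \<le> mat.dim (centraliser ?W (y + smat (inverse s) z))"
    by (intro dim_good) auto
  also have "centraliser ?W (y + smat (inverse s) z) = centraliser ?W (smat s (y + smat (inverse s) z))"
    by (rule centraliser_smat[OF s0, symmetric])
  also have "smat s (y + smat (inverse s) z) = z + smat s y"
    using s0 by (simp add: mat.scale_right_distrib add.commute)
  also have "mat.dim (centraliser ?W (z + smat s y)) \<le> mat.dim (centraliser ?W z)"
    using s C(5) by auto
  finally show ?thesis .
qed

section \<open>Functionals as traces\<close>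

lemma trace_lie_br: "trace (lie_br x y ** z) = trace (x ** lie_br y z)"
proof -
  have "trace (y ** x ** z) = trace (x ** (z ** y))"
    using trace_mul_sym[of y "x ** z"] by (simp add: matrix_mul_assoc)
  then show ?thesis by (simp add: lie_br_def matrix_diff_mult matrix_mult_diff trace_sub matrix_mul_assoc)
qed

lemma trace_sp_adj: "trace (sp_adj x) = trace x"
proof -
  have JJ: "Jmat ** Jmat = - mat 1"
    unfolding matrix_eq_iff_mult
    by (simp add: matrix_vector_mul_assoc[symmetric] Jmat_Jmat_vec neg_mat_mult_vec)
  have neg: "trace (- a) = - trace a" "(- a) ** b = - (a ** b)" for a b :: "'a^('b + 'b)^('b + 'b)"
    by (simp_all add: trace_def sum_negf vec_eq_iff matrix_matrix_mult_def)
  have "trace (sp_adj x) = - trace (Jmat ** Jmat ** transpose x)"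
    unfolding sp_adj_def neg using trace_mul_sym[of "Jmat ** transpose x" Jmat]
    by (simp add: matrix_mul_assoc)
  also have "\<dots> = trace (transpose x)" by (simp add: JJ neg)
  finally show ?thesis by (simp add: trace_def Finite_Cartesian_Product.transpose_def)
qed

lemma trace_smat: "trace (smat c x) = c * trace x"
  by (simp add: trace_def sum_distrib_left)

lemma linear_functional_trace:
  assumes sub: "mat.subspace q" and \<gamma>: "\<gamma> \<in> dual_sp q"
  shows "\<exists>\<xi>. \<forall>x\<in>q. \<gamma> x = trace (\<xi> ** x)"
proof -
  obtain B where B: "B \<subseteq> q" "mat.independent B" "q \<subseteq> mat.span B" by (rule mat.basis_exists)
  have fin: "finite B" using B(2) by (rule mat.finiteI_independent)
  interpret p: vector_space_pair "smat :: 'a \<Rightarrow> 'a^'b^'b \<Rightarrow> 'a^'b^'b" "(*) :: 'a \<Rightarrow> 'a \<Rightarrow> 'a" by unfold_locales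
  obtain g where g: "Vector_Spaces.linear smat (*) g" "\<forall>b\<in>B. g b = \<gamma> b"
    using p.linear_independent_extend[OF B(2), of \<gamma>] by blast
  interpret g: Vector_Spaces.linear smat "(*)" g by fact
  define \<xi> where "\<xi> = (\<chi> i j. g (mat_unit j i))"
  have tr: "trace (\<xi> ** x) = g x" for x
  proof -
    have "g x = (\<Sum>(i,j)\<in>UNIV. x $ i $ j * g (mat_unit i j))"
      by (subst mat_expand[of x]) (simp add: g.sum g.scale case_prod_unfold)
    also have "\<dots> = (\<Sum>i\<in>UNIV. \<Sum>j\<in>UNIV. x $ i $ j * g (mat_unit i j))"
      by (simp add: sum.cartesian_product)
    also have "\<dots> = (\<Sum>j\<in>UNIV. \<Sum>i\<in>UNIV. x $ i $ j * g (mat_unit i j))" by (rule sum.swap)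
    finally show ?thesis by (simp add: trace_def matrix_matrix_mult_def \<xi>_def mult.commute)
  qed
  have "\<gamma> x = trace (\<xi> ** x)" if x: "x \<in> q" for x
  proof -
    obtain c where c: "x = (\<Sum>b\<in>B. smat (c b) b)"
      using subsetD[OF B(3) x] unfolding mat.span_finite[OF fin] by blast
    have "\<gamma> x = (\<Sum>b\<in>B. c b * \<gamma> b)" unfolding c using B(1) by (intro dual_sum[OF \<gamma> sub]) auto
    also have "\<dots> = g x" unfolding c g.sum using g(2) by (intro sum.cong) (auto simp: g.scale)
    finally show ?thesis by (simp add: tr)
  qed
  then show ?thesis by blast
qed

text \<open>Self-adjoint and skew matrices are orthogonal for the trace form, so the representing
  matrix may be replaced by its skew part. Only then does perturbing \<open>e\<close> by it stay in
  \<open>sp\<close>.\<close>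

lemma sp_functional_trace:
  fixes q :: "('k::field^('n::finite + 'n)^('n + 'n)) set"
  assumes two: "(2::'k) \<noteq> 0" and sub: "mat.subspace q" and q: "q \<subseteq> sp" and \<gamma>: "\<gamma> \<in> dual_sp q"
  shows "\<exists>\<xi>\<in>sp. \<forall>x\<in>q. \<gamma> x = trace (\<xi> ** x)"
proof -
  obtain \<eta> where \<eta>: "\<forall>x\<in>q. \<gamma> x = trace (\<eta> ** x)" using linear_functional_trace[OF sub \<gamma>] by blast
  define \<xi> where "\<xi> = smat (inverse 2) (\<eta> - sp_adj \<eta>)"
  have "\<xi> \<in> sp"
    unfolding sp_iff \<xi>_def
    by (simp add: sp_adj_smat sp_adj_diff sp_adj_adj) (simp flip: mat.scale_minus_right)
  moreover have "\<gamma> x = trace (\<xi> ** x)" if x: "x \<in> q" for x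
  proof -
    have "trace (sp_adj \<eta> ** x) = trace (sp_adj (sp_adj x ** \<eta>))" by (simp add: sp_adj_mult sp_adj_adj)
    also have "\<dots> = trace (smat (- 1) x ** \<eta>)"
      using x q unfolding trace_sp_adj by (auto simp: sp_iff smat_minus_one)
    also have "\<dots> = - trace (\<eta> ** x)" unfolding smat_mult_left trace_smat using trace_mul_sym[of x \<eta>] by simp
    finally have "trace ((\<eta> - sp_adj \<eta>) ** x) = 2 * trace (\<eta> ** x)"
      by (simp add: matrix_diff_mult trace_sub)
    then show ?thesis using \<eta> x two by (simp add: \<xi>_def smat_mult_left trace_smat)
  qed
  ultimately show ?thesis by blast
qed

text \<open>Vinberg's inequality: kernels of the form of \<open>e + s \<xi>\<close> degenerate, as \<open>s\<close> tends to \<open>0\<close>,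
  into the kernel of the form of \<open>\<xi>\<close> on the centraliser of \<open>e\<close>.\<close>
lemma stabiliser_dim_ge:
  fixes e :: "'k::field^('n::finite + 'n)^('n + 'n)"
  assumes ac: "alg_closed TYPE('k)" and two: "(2::'k) \<noteq> 0" and e: "e \<in> sp" and \<epsilon>: "\<epsilon> = 1 \<or> \<epsilon> = - 1"
    and \<gamma>: "\<gamma> \<in> dual_sp (centraliser sp e)"
  shows "CARD('n) \<le> mat.dim {x \<in> centraliser (eps_space \<epsilon>) e.
    \<forall>y\<in>centraliser (eps_space \<epsilon>) e. \<gamma> (lie_br x y) = 0}" (is "_ \<le> mat.dim ?K")
proof -
  let ?W = "eps_space \<epsilon> :: ('k^('n + 'n)^('n + 'n)) set"
  let ?We = "centraliser ?W e"
  have \<epsilon>2: "\<epsilon> * \<epsilon> = 1" using \<epsilon> by auto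
  obtain \<xi> where \<xi>: "\<xi> \<in> sp" "\<And>x. x \<in> centraliser sp e \<Longrightarrow> \<gamma> x = trace (\<xi> ** x)"
    using sp_functional_trace[OF two subspace_centraliser[OF subspace_sp] centraliser_subset \<gamma>] by blast
  have br: "lie_br x y \<in> centraliser sp e" if "x \<in> ?We" "y \<in> ?We" for x y
    using that \<epsilon>2 by (rule lie_br_eps_centraliser)
  note sWe = subspace_centraliser[OF subspace_eps, of \<epsilon> e]
  have \<gamma>_tr: "\<gamma> (lie_br x y) = trace (lie_br \<xi> x ** y)" if "x \<in> ?We" "y \<in> ?We" for x y
    using \<xi>(2)[OF br[OF that]] by (simp add: trace_lie_br)
  have sK: "mat.subspace ?K"
    using sWe subspace_centraliser[OF subspace_sp] br \<gamma> by (rule subspace_form_kernel)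
  have KW: "?K \<subseteq> ?We" by blast
  \<comment> \<open>\<open>R\<close> complements the kernel in the centraliser and \<open>C\<close>
    complements the centraliser in \<open>?W\<close>, so \<open>card R + card C\<close> is the
    codimension of the kernel in \<open>?W\<close>.\<close>
  obtain R where R: "mat.independent R" "finite R" "R \<subseteq> ?We" "mat.span R \<inter> ?K = {0}"
    "card R + mat.dim ?K = mat.dim ?We"
    by (rule mat.complement_exists[OF sWe sK KW])
  obtain C where C: "mat.independent C" "finite C" "C \<subseteq> ?W" "mat.span C \<inter> ?We = {0}"
    "card C + mat.dim ?We = mat.dim ?W"
    by (rule mat.complement_exists[OF subspace_eps sWe centraliser_subset])
  have disj: "R \<inter> C = {}"
  proof -
    have "R \<inter> C \<subseteq> {0}" using R(3) C(4) mat.span_base by blast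
    moreover have "0 \<notin> R" using R(1) mat.dependent_zero by blast
    ultimately show ?thesis by blast
  qed
  have spR: "mat.span R \<subseteq> ?We" using R(3) sWe by (rule mat.span_minimal)
  have spC: "mat.span C \<subseteq> ?W" using C(3) subspace_eps by (rule mat.span_minimal)
  have inR: "(\<Sum>r\<in>R. smat (c r) r) \<in> mat.span R" for c by (intro mat.span_sum mat.span_scale mat.span_base)
  have inC: "(\<Sum>r\<in>C. smat (c r) r) \<in> mat.span C" for c by (intro mat.span_sum mat.span_scale mat.span_base)
  have zero: "\<forall>b\<in>R \<union> C. c b = 0" if "(\<Sum>r\<in>R. smat (c r) r) = 0" "(\<Sum>b\<in>C. smat (c b) b) = 0" for c
    using mat.independentD[OF R(1,2) order.refl that(1)] mat.independentD[OF C(1,2) order.refl that(2)] by blast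
  have indep: "mat.independent (R \<union> C)"
  proof (rule mat.independent_if_scalars_zero)
    fix c x assume s: "(\<Sum>b\<in>R \<union> C. smat (c b) b) = 0" and x: "x \<in> R \<union> C"
    have "(\<Sum>b\<in>R. smat (c b) b) + (\<Sum>b\<in>C. smat (c b) b) = 0"
      using s sum.union_disjoint[OF R(2) C(2) disj, of "\<lambda>b. smat (c b) b"] by simp
    then have eq: "(\<Sum>b\<in>C. smat (c b) b) = - (\<Sum>b\<in>R. smat (c b) b)" by (simp add: eq_neg_iff_add_eq_0 add.commute)
    have "- (\<Sum>b\<in>R. smat (c b) b) \<in> ?We" using inR spR mat.subspace_neg[OF sWe] by blast
    then have "(\<Sum>b\<in>C. smat (c b) b) = 0" using inC[of c] C(4) unfolding eq by blast
    then show "c x = 0" using zero[of c] eq x by simp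
  qed (use R C in simp)
  let ?bad = "{s. s \<noteq> 0 \<and> card (R \<union> C) + mat.dim (centraliser ?W (e + smat s \<xi>)) > mat.dim ?W}"
  have fin: "finite ?bad"
  proof (rule generic_centraliser_dim[OF subspace_eps _ C(3) disj indep])
    show "R \<subseteq> ?W" using R(3) centraliser_subset by blast
    show "lie_br e r = 0" if "r \<in> R" for r
      using that R(3) lie_br_skew[of e r] by (auto simp: centraliser_def)
    fix c assume H: "(\<Sum>r\<in>R. smat (c r) (lie_br \<xi> r)) + (\<Sum>b\<in>C. smat (c b) (lie_br e b)) = 0"
    define r where "r = (\<Sum>r\<in>R. smat (c r) r)"
    define b where "b = (\<Sum>b\<in>C. smat (c b) b)"
    have rb: "lie_br \<xi> r + lie_br e b = 0" using H unfolding r_def b_def lie_br_sum_right .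
    have rW: "r \<in> ?We" using inR spR by (auto simp: r_def)
    have bW: "b \<in> ?W" using inC spC by (auto simp: b_def)
    \<comment> \<open>Pairing the relation with \<open>y\<close> under the trace removes the term
      with \<open>e\<close>, because the trace form is invariant and \<open>y\<close> commutes with
      \<open>e\<close>.\<close>
    have "\<gamma> (lie_br r y) = 0" if y: "y \<in> ?We" for y
    proof -
      have "trace (lie_br e b ** y) = - trace (lie_br b e ** y)"
        using trace_smat[of "- 1" "lie_br b e ** y"] lie_br_skew[of e b]
        by (simp add: smat_mult_left[symmetric] smat_minus_one)
      also have "\<dots> = - trace (b ** lie_br e y)" by (simp add: trace_lie_br)
      also have "lie_br e y = 0" using y lie_br_skew[of e y] by (simp add: centraliser_def)
      finally have "trace (lie_br e b ** y) = 0" by (simp add: trace_def)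
      moreover have "trace (lie_br \<xi> r ** y) + trace (lie_br e b ** y) = 0"
        using rb by (simp add: trace_add[symmetric] matrix_add_rdistrib[symmetric]) (simp add: trace_def)
      ultimately show ?thesis using \<gamma>_tr[OF rW y] by simp
    qed
    then have "r \<in> ?K" using rW by simp
    then have r0: "r = 0" using inR[of c] R(4) unfolding r_def by blast
    then have "lie_br b e = 0" using rb lie_br_skew[of b e] by simp
    then have "b \<in> ?We" using bW by (simp add: centraliser_def)
    then have "b = 0" using inC[of c] C(4) unfolding b_def by blast
    then show "\<forall>b\<in>R \<union> C. c b = 0" using zero[of c] r0 by (simp add: r_def b_def)
  qed
  obtain s where s: "s \<notin> insert 0 ?bad"
    using ex_new_if_finite[OF infinite_alg_closed[OF ac], of "insert 0 ?bad"] fin by auto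
  have "e + smat s \<xi> \<in> sp" using e \<xi>(1) subspace_sp by (auto intro: mat.subspace_add mat.subspace_scale)
  then have "CARD('n) \<le> mat.dim (centraliser ?W (e + smat s \<xi>))"
    by (rule eps_centraliser_dim_ge[OF ac two _ \<epsilon>])
  moreover have "card (R \<union> C) = card R + card C" using R(2) C(2) disj by (rule card_Un_disjoint)
  ultimately show ?thesis using s R(5) C(5) by auto
qed

section \<open>Jordan strings\<close>

lemma mpow_add: "mpow x (s + t) = mpow x s ** mpow x t"
  by (induction s) (simp_all add: matrix_mul_assoc)

lemma mpow_mult_right: "((\<lambda>A. A ** x) ^^ k) x = mpow x (Suc k)"
proof (induction k)
  case (Suc k)
  then show ?case using mpow_commute[of x "Suc k"] by simp
qed simp

lemma minus_one_power_cancel [simp]: "(- 1 :: 'a::comm_ring_1) ^ n * ((- 1) ^ n * x) = x"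
  by (simp flip: mult.assoc power_mult_distrib)

locale nilpotent_sp =
  fixes e :: "'k::field^('n::finite + 'n)^('n + 'n)"
  assumes two: "(2 :: 'k) \<noteq> 0" and sp: "e \<in> sp" and nilp: "nilpotent_mat e"
begin

lemma nilpotent_power: "\<exists>N. mpow e N = 0"
  using nilp unfolding nilpotent_mat_def mpow_mult_right by blast

text \<open>As \<open>e\<close> is skew, \<open>H s\<close> is alternating for even \<open>s\<close>
  and symmetric for odd \<open>s\<close>. A string of length \<open>l\<close> is paired by
  \<open>H (l - 1)\<close>, so it can be dual to itself only for even \<open>l\<close>.\<close>

definition H :: "nat \<Rightarrow> 'k^('n + 'n) \<Rightarrow> 'k^('n + 'n) \<Rightarrow> 'k" where
  "H s u v = bil u (mpow e s *v v)"

lemma H_add_left: "H s (u + u') v = H s u v + H s u' v"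
  and H_add_right: "H s v (u + u') = H s v u + H s v u'"
  and H_scale_left: "H s (c *s u) v = c * H s u v"
  and H_scale_right: "H s v (c *s u) = c * H s v u"
  by (simp_all add: H_def bil_add_left bil_add_right bil_scale_left bil_scale_right
      matrix_vector_right_distrib vector_scalar_commute)

lemma H_zero [simp]: "H s 0 v = 0" "H s v 0 = 0"
  by (simp_all add: H_def)

lemma H_diff_left: "H s (u - u') v = H s u v - H s u' v"
  and H_diff_right: "H s v (u - u') = H s v u - H s v u'"
  using H_add_left[of s "u - u'" u' v] H_add_right[of s v "u - u'" u'] by simp_all

lemma H_sum_right: "H s v (\<Sum>i\<in>I. f i) = (\<Sum>i\<in>I. H s v (f i))"
  by (induction I rule: infinite_finite_induct) (auto simp: H_add_right)

lemma H_sum_left: "H s (\<Sum>i\<in>I. f i) v = (\<Sum>i\<in>I. H s (f i) v)"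
  by (induction I rule: infinite_finite_induct) (auto simp: H_add_left)

lemma bil_mpow: "bil (mpow e s *v u) v = (- 1) ^ s * bil u (mpow e s *v v)"
  by (simp add: bil_adj sp_adj_mpow[OF sp] smat_mult_vec bil_scale_right)

lemma H_mpow_right: "H s u (mpow e t *v v) = H (s + t) u v"
  by (simp add: H_def matrix_vector_mul_assoc mpow_add)

lemma H_mpow_left: "H s (mpow e t *v u) v = (- 1) ^ t * H (s + t) u v"
proof -
  have "mpow e t ** mpow e s = mpow e (s + t)" by (metis mpow_add add.commute)
  then show ?thesis by (simp add: H_def bil_mpow matrix_vector_mul_assoc)
qed

lemma H_skew: "H s v u = - ((- 1) ^ s * H s u v)"
  unfolding H_def using bil_skew[of v "mpow e s *v u"] bil_mpow[of s u v] by simp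

lemma H_even_self:
  assumes "even s"
  shows "H s u u = 0"
proof -
  have "H s u u = - H s u u" using H_skew[of s u u] assms by simp
  then have "2 * H s u u = 0" by (metis add.right_inverse mult_2)
  then show ?thesis using two by simp
qed

lemma H_nondegenerate:
  assumes "v \<noteq> 0"
  shows "\<exists>u. H 0 u v \<noteq> 0"
  using assms bil_nondegenerate[of v] by (auto simp: H_def)

definition perp :: "nat \<Rightarrow> (nat \<Rightarrow> 'k^('n + 'n)) \<Rightarrow> ('k^('n + 'n)) set" where
  "perp k w = {v. \<forall>i<k. \<forall>s. H s (w i) v = 0}"

lemma subspace_perp: "vec.subspace (perp k w)"
  by (intro vec.subspaceI) (auto simp: perp_def H_add_right H_scale_right)

lemma perp_mpow: "v \<in> perp k w \<Longrightarrow> mpow e s *v v \<in> perp k w"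
  by (auto simp: perp_def H_mpow_right)

text \<open>Jordan strings \<open>w i, e (w i), \<dots>\<close> of decreasing lengths \<open>lam i\<close>; the string dual to \<open>i\<close> is \<open>pr i\<close>,
  which is equal or adjacent to \<open>i\<close>.\<close>
definition strings :: "nat \<Rightarrow> (nat \<Rightarrow> nat) \<Rightarrow> (nat \<Rightarrow> 'k^('n + 'n)) \<Rightarrow> (nat \<Rightarrow> nat) \<Rightarrow> (nat \<Rightarrow> 'k) \<Rightarrow> bool" where
  "strings k lam w pr eta \<longleftrightarrow>
     (\<forall>i<k. 0 < lam i \<and> mpow e (lam i) *v w i = 0 \<and> pr i < k \<and> pr (pr i) = i \<and> lam (pr i) = lam i
        \<and> pr i \<le> Suc i \<and> i \<le> Suc (pr i) \<and> eta i \<noteq> 0 \<and> (pr i \<noteq> i \<longrightarrow> eta (pr i) = - eta i)) \<and>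
     (\<forall>i j. i \<le> j \<longrightarrow> j < k \<longrightarrow> lam j \<le> lam i) \<and>
     (\<forall>a<k. \<forall>b<k. \<forall>s. H s (w a) (w b) = (if b = pr a \<and> Suc s = lam a then eta a else 0))"

text \<open>Each string pairs with exactly one other, in complementary positions. So the component
  \<open>p\<close> of \<open>z\<close> along the strings is read off by pairing \<open>z\<close>
  with the dual strings, and \<open>z - p\<close> is the projection.\<close>

lemma perp_projection:
  assumes g: "strings k lam w pr eta"
  shows "\<exists>z'\<in>perp k w. \<forall>v\<in>perp k w. \<forall>s. H s z' v = H s z v"
proof -
  define \<kappa> where "\<kappa> i s = H (lam i - Suc s) (w (pr i)) z / eta (pr i)" for i s
  define p where "p = (\<Sum>i<k. \<Sum>s<lam i. \<kappa> i s *s (mpow e s *v w i))"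
  have perp0: "H s p v = 0" if "v \<in> perp k w" for s v
    unfolding p_def H_sum_left
  proof (intro sum.neutral ballI)
    fix i t assume "i \<in> {..<k}" "t \<in> {..<lam i}"
    then show "H s (\<kappa> i t *s (mpow e t *v w i)) v = 0"
      using that by (simp add: H_scale_left H_mpow_left perp_def)
  qed
  have rep: "H r (w a) p = H r (w a) z" if a: "a < k" for a r
  proof -
    have pa: "pr a < k" "pr (pr a) = a" "lam (pr a) = lam a" "eta a \<noteq> 0"
      using g a unfolding strings_def by auto
    have "H r (w a) p = (\<Sum>i<k. \<Sum>s<lam i. \<kappa> i s * H (r + s) (w a) (w i))"
      by (simp add: p_def H_sum_right H_scale_right H_mpow_right)
    also have "\<dots> = (\<Sum>i<k. if i = pr a then \<Sum>s<lam i. \<kappa> i s * (if Suc (r + s) = lam a then eta a else 0) else 0)"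
      using g a unfolding strings_def by (intro sum.cong refl) (auto intro!: sum.neutral)
    also have "\<dots> = (\<Sum>s<lam a. \<kappa> (pr a) s * (if Suc (r + s) = lam a then eta a else 0))"
      using pa by simp
    also have "\<dots> = H r (w a) z"
    proof (cases "r < lam a")
      case True
      have "(\<Sum>s<lam a. \<kappa> (pr a) s * (if Suc (r + s) = lam a then eta a else 0))
          = (\<Sum>s<lam a. if s = lam a - Suc r then H r (w a) z else 0)"
        using True pa by (intro sum.cong refl) (auto simp: \<kappa>_def)
      then show ?thesis using True by simp
    next
      case False
      then obtain t where t: "r = t + lam a" by (metis le_add_diff_inverse2 not_less)
      have "mpow e r *v w a = 0"
        using g a unfolding t mpow_add strings_def by (simp add: matrix_vector_mul_assoc[symmetric])
      then have "H r (w a) z = 0"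
        using H_mpow_left[of 0 r "w a" z] by simp
      moreover have "(\<Sum>s<lam a. \<kappa> (pr a) s * (if Suc (r + s) = lam a then eta a else 0)) = 0"
        using False by (intro sum.neutral) auto
      ultimately show ?thesis by simp
    qed
    finally show ?thesis .
  qed
  have "z - p \<in> perp k w"
    using rep by (simp add: perp_def H_diff_right)
  moreover have "\<forall>v\<in>perp k w. \<forall>s. H s (z - p) v = H s z v"
    using perp0 by (simp add: H_diff_left)
  ultimately show ?thesis by blast
qed

context
  fixes U :: "('k^('n + 'n)) set" and l :: nat
  assumes U: "vec.subspace U" and U_mpow: "\<And>s v. v \<in> U \<Longrightarrow> mpow e s *v v \<in> U"
    and l: "0 < l" and U_l: "\<And>v. v \<in> U \<Longrightarrow> mpow e l *v v = 0"
begin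

lemma H_high:
  assumes "v \<in> U" "l \<le> s"
  shows "H s u v = 0"
proof -
  obtain t where "s = t + l" using assms(2) by (metis le_add_diff_inverse2)
  then show ?thesis using U_l[OF assms(1)] by (simp add: H_def mpow_add matrix_vector_mul_assoc[symmetric])
qed

text \<open>A correction by \<open>e^r\<close> leaves \<open>H s\<close> unchanged for
  \<open>s \<ge> l - r\<close> and changes \<open>H (l - 1 - r)\<close> linearly. Unwanted values
  can thus be removed one by one, downwards from \<open>s = l - 2\<close>.\<close>

lemma H_perturb:
  assumes "x \<in> U" "y \<in> U" "p \<in> U" "q \<in> U"
  shows "l \<le> s + r \<Longrightarrow> H s (x + mpow e r *v p) (y + mpow e r *v q) = H s x y"
    and "Suc (s + r) = l \<Longrightarrow> 0 < r \<Longrightarrow> H s (x + mpow e r *v p) (y + mpow e r *v q)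
      = H s x y + H (l - 1) x q + (- 1) ^ r * H (l - 1) p y"
proof -
  have e: "H s (x + mpow e r *v p) (y + mpow e r *v q)
    = H s x y + H (s + r) x q + (- 1) ^ r * (H (s + r) p y + H (s + r + r) p q)"
    by (simp add: H_add_left H_add_right H_mpow_left H_mpow_right algebra_simps)
  show "l \<le> s + r \<Longrightarrow> H s (x + mpow e r *v p) (y + mpow e r *v q) = H s x y"
    unfolding e using assms by (simp add: H_high)
  show "H s (x + mpow e r *v p) (y + mpow e r *v q)
      = H s x y + H (l - 1) x q + (- 1) ^ r * H (l - 1) p y" if "Suc (s + r) = l" "0 < r"
  proof -
    have "H (s + r + r) p q = 0" using assms that by (intro H_high) auto
    moreover have "s + r = l - 1" using that by simp
    ultimately show ?thesis unfolding e by simp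
  qed
qed

lemma even_string:
  assumes even: "even l" and u: "u \<in> U" "H (l - 1) u u \<noteq> 0"
  shows "\<exists>u\<in>U. H (l - 1) u u \<noteq> 0 \<and> (\<forall>s. Suc s \<noteq> l \<longrightarrow> H s u u = 0)"
proof -
  have "\<exists>u\<in>U. H (l - 1) u u \<noteq> 0 \<and> (\<forall>s. l \<le> s + Suc m \<and> Suc s < l \<longrightarrow> H s u u = 0)" for m
  proof (induction m)
    case 0
    then show ?case using u by (intro bexI[of _ u]) auto
  next
    case (Suc m)
    then obtain u where u: "u \<in> U" "H (l - 1) u u \<noteq> 0"
      and z: "\<And>s. l \<le> s + Suc m \<Longrightarrow> Suc s < l \<Longrightarrow> H s u u = 0" by blast
    show ?case
    proof (cases "Suc (Suc m) \<le> l")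
      case False
      then show ?thesis using u z by (intro bexI[of _ u]) auto
    next
      case True
      define r where "r = Suc m"
      define s0 where "s0 = l - Suc r"
      have s0: "Suc (s0 + r) = l" "0 < r" using True by (auto simp: s0_def r_def)
      \<comment> \<open>For even \<open>r\<close> the value changes by
        \<open>2 * c * H (l - 1) u u\<close>, which fixes \<open>c\<close>. For odd \<open>r\<close>
        the index \<open>s0\<close> is even, and both values vanish anyway.\<close>
      define c where "c = - H s0 u u / (2 * H (l - 1) u u)"
      define u' where "u' = u + mpow e r *v (c *s u)"
      have cu: "c *s u \<in> U" using U u(1) by (rule vec.subspace_scale)
      have u'U: "u' \<in> U" unfolding u'_def using U u(1) U_mpow[OF cu] by (rule vec.subspace_add)
      have high: "H s u' u' = H s u u" if "l \<le> s + r" for s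
        unfolding u'_def using H_perturb(1)[OF u(1) u(1) cu cu that] .
      have "H s0 u' u' = H s0 u u + c * (1 + (- 1) ^ r) * H (l - 1) u u"
        unfolding u'_def using H_perturb(2)[OF u(1) u(1) cu cu s0]
        by (simp add: H_scale_left H_scale_right algebra_simps)
      also have "\<dots> = 0"
      proof (cases "even r")
        case True
        then show ?thesis using u(2) two by (simp add: c_def)
      next
        case False
        then have "even s0" using even s0(1) by (metis even_Suc even_add)
        then show ?thesis using False by (simp add: H_even_self)
      qed
      finally have s0z: "H s0 u' u' = 0" .
      have "H s u' u' = 0" if "l \<le> s + Suc (Suc m)" "Suc s < l" for s
      proof (cases "s = s0")
        case False
        then have "l \<le> s + r" using that by (auto simp: s0_def r_def)
        then show ?thesis using high z that by (simp add: r_def)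
      qed (simp add: s0z)
      moreover have "H (l - 1) u' u' \<noteq> 0" using high[of "l - 1"] u(2) s0(2) l by simp
      ultimately show ?thesis using u'U by blast
    qed
  qed
  from this[of l] obtain u where u: "u \<in> U" "H (l - 1) u u \<noteq> 0"
    "\<forall>s. l \<le> s + Suc l \<and> Suc s < l \<longrightarrow> H s u u = 0" by blast
  then have "H s u u = 0" if "Suc s \<noteq> l" for s
    using that H_high[OF u(1), of s u] by (cases "Suc s < l") auto
  then show ?thesis using u by blast
qed

lemma odd_strings:
  assumes odd: "odd l" and uv: "u \<in> U" "v \<in> U" "H (l - 1) u v \<noteq> 0"
  shows "\<exists>u\<in>U. \<exists>v\<in>U. H (l - 1) u v = 1 \<and> (\<forall>s. Suc s \<noteq> l \<longrightarrow> H s u v = 0) \<and>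
    (\<forall>s. H s u u = 0 \<and> H s v v = 0)"
proof -
  have ev: "even (l - 1)" using odd by simp
  have "\<exists>u\<in>U. \<exists>v\<in>U. H (l - 1) u v = 1 \<and>
    (\<forall>s. l \<le> s + Suc m \<and> Suc s < l \<longrightarrow> H s u v = 0 \<and> H s u u = 0 \<and> H s v v = 0)" for m
  proof (induction m)
    case 0
    have "inverse (H (l - 1) u v) *s u \<in> U" using U uv(1) by (rule vec.subspace_scale)
    then show ?case using uv by (intro bexI[of _ "inverse (H (l - 1) u v) *s u"] bexI[of _ v])
      (auto simp: H_scale_left)
  next
    case (Suc m)
    then obtain u v where uv: "u \<in> U" "v \<in> U" "H (l - 1) u v = 1"
      and z: "\<And>s. l \<le> s + Suc m \<Longrightarrow> Suc s < l \<Longrightarrow> H s u v = 0 \<and> H s u u = 0 \<and> H s v v = 0" by blast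
    show ?case
    proof (cases "Suc (Suc m) \<le> l")
      case False
      then show ?thesis using uv z by (intro bexI[of _ u] bexI[of _ v]) auto
    next
      case True
      define r where "r = Suc m"
      define s0 where "s0 = l - Suc r"
      have s0: "Suc (s0 + r) = l" "0 < r" using True by (auto simp: s0_def r_def)
      \<comment> \<open>For odd \<open>r\<close> the self-pairings of \<open>u\<close> and
        \<open>v\<close> change by \<open>2 * b\<close> and \<open>- 2 * c\<close>; for even
        \<open>r\<close> the index \<open>s0\<close> is even and they vanish anyway. The mixed value
        changes by \<open>d\<close> in both cases.\<close>
      define b where "b = - H s0 u u / 2"
      define c where "c = H s0 v v / 2"
      define d where "d = - H s0 u v"
      define p where "p = b *s v"
      define q where "q = c *s u + d *s v"
      have pU: "p \<in> U" unfolding p_def using U uv(2) by (rule vec.subspace_scale)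
      have qU: "q \<in> U" unfolding q_def using U uv(1,2) by (intro vec.subspace_add vec.subspace_scale)
      define u' where "u' = u + mpow e r *v p"
      define v' where "v' = v + mpow e r *v q"
      have U': "u' \<in> U" "v' \<in> U"
        unfolding u'_def v'_def using U uv(1,2) U_mpow[OF pU] U_mpow[OF qU] by (auto intro: vec.subspace_add)
      have high: "H s u' v' = H s u v" "H s u' u' = H s u u" "H s v' v' = H s v v" if "l \<le> s + r" for s
        unfolding u'_def v'_def using uv(1,2) pU qU that by (auto intro!: H_perturb(1))
      have uu: "H (l - 1) u u = 0" "H (l - 1) v v = 0" "H (l - 1) v u = - 1"
        using ev uv(3) H_skew[of "l - 1" v u] by (auto simp: H_even_self)
      have "H s0 u' v' = H s0 u v + d"
        unfolding u'_def v'_def H_perturb(2)[OF uv(1,2) pU qU s0] unfolding p_def q_def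
        by (simp add: H_scale_left H_scale_right H_add_left H_add_right uu uv(3) del: One_nat_def)
      then have z1: "H s0 u' v' = 0" by (simp add: d_def)
      have par: "r mod 2 = s0 mod 2" using s0(1) odd by presburger
      have "H s0 u' u' = H s0 u u + b * (1 - (- 1) ^ r)"
        unfolding u'_def H_perturb(2)[OF uv(1,1) pU pU s0] unfolding p_def
        by (simp add: H_scale_left H_scale_right uu uv(3) algebra_simps del: One_nat_def)
      then have z2: "H s0 u' u' = 0"
        using two H_even_self[of s0 u] par by (cases "even r") (auto simp: b_def even_iff_mod_2_eq_zero odd_iff_mod_2_eq_one)
      have "H s0 v' v' = H s0 v v + c * (- 1 + (- 1) ^ r)"
        unfolding v'_def H_perturb(2)[OF uv(2,2) qU qU s0] unfolding q_def
        by (simp add: H_scale_left H_scale_right H_add_left H_add_right uu uv(3) algebra_simps del: One_nat_def)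
      then have z3: "H s0 v' v' = 0"
        using two H_even_self[of s0 v] par by (cases "even r") (auto simp: c_def even_iff_mod_2_eq_zero odd_iff_mod_2_eq_one)
      have "H s u' v' = 0 \<and> H s u' u' = 0 \<and> H s v' v' = 0" if "l \<le> s + Suc (Suc m)" "Suc s < l" for s
      proof (cases "s = s0")
        case False
        then have "l \<le> s + r" using that by (auto simp: s0_def r_def)
        then show ?thesis using high z that by (simp add: r_def)
      qed (simp add: z1 z2 z3)
      moreover have "H (l - 1) u' v' = 1" using high(1)[of "l - 1"] uv(3) s0(2) l by simp
      ultimately show ?thesis using U' by blast
    qed
  qed
  from this[of l] obtain u v where uv: "u \<in> U" "v \<in> U" "H (l - 1) u v = 1"
    and z: "\<forall>s. l \<le> s + Suc l \<and> Suc s < l \<longrightarrow> H s u v = 0 \<and> H s u u = 0 \<and> H s v v = 0"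
    by blast
  have "H s u v = 0" if "Suc s \<noteq> l" for s
    using that z H_high[OF uv(2), of s u] by (cases "Suc s < l") auto
  moreover have "H s x x = 0" if "x = u \<or> x = v" for s x
  proof (cases "Suc s < l")
    case True
    then show ?thesis using that z by auto
  next
    case False
    show ?thesis
    proof (cases "Suc s = l")
      case True
      then show ?thesis using ev by (auto intro: H_even_self)
    next
      case False
      then have "l \<le> s" using \<open>\<not> Suc s < l\<close> by simp
      then show ?thesis using that H_high uv by blast
    qed
  qed
  ultimately show ?thesis using uv by blast
qed

end


lemma perp_antimono: "k \<le> k' \<Longrightarrow> (\<And>i. i < k \<Longrightarrow> w' i = w i) \<Longrightarrow> perp k' w' \<subseteq> perp k w"
proof
  fix v assume k: "k \<le> k'" and w: "\<And>i. i < k \<Longrightarrow> w' i = w i" and v: "v \<in> perp k' w'"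
  have "H s (w i) v = 0" if "i < k" for i s
  proof -
    have "H s (w' i) v = 0" using v k that by (simp add: perp_def)
    then show ?thesis using w[OF that] by simp
  qed
  then show "v \<in> perp k w" by (simp add: perp_def)
qed

lemma dim_perp_less:
  assumes "perp k' w' \<subseteq> perp k w" "v \<in> perp k w" "i < k'" "w' i = u" "H s u v \<noteq> 0"
  shows "vec.dim (perp k' w') < vec.dim (perp k w)"
proof (rule vec.dim_psubset)
  have "v \<notin> perp k' w'" using assms(3-5) by (auto simp: perp_def)
  then show "vec.span (perp k' w') \<subset> vec.span (perp k w)"
    using assms(1,2) subspace_perp by (auto simp: vec.span_eq_iff[THEN iffD2])
qed

lemma extend_even:
  assumes g: "strings k lam w pr eta" and u: "u \<in> perp k w" "mpow e l *v u = 0"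
    and l: "0 < l" "\<And>i. i < k \<Longrightarrow> l \<le> lam i"
    and H: "H (l - 1) u u \<noteq> 0" "\<And>s. Suc s \<noteq> l \<Longrightarrow> H s u u = 0"
  shows "strings (Suc k) (lam(k := l)) (w(k := u)) (pr(k := k)) (eta(k := H (l - 1) u u))"
proof -
  let ?lam = "lam(k := l)" and ?w = "w(k := u)" and ?pr = "pr(k := k)" and ?eta = "eta(k := H (l - 1) u u)"
  have wu: "H s (w a) u = 0" "H s u (w a) = 0" if "a < k" for a s
    using u(1) that H_skew[of s u "w a"] by (auto simp: perp_def)
  have prk: "pr a < k" if "a < k" for a using g that by (simp add: strings_def)
  have Huu: "H s u u = (if Suc s = l then H (l - 1) u u else 0)" for s
    using H(2)[of s] by auto
  show ?thesis
    unfolding strings_def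
  proof (intro conjI)
    show "\<forall>i<Suc k. 0 < ?lam i \<and> mpow e (?lam i) *v ?w i = 0 \<and> ?pr i < Suc k
        \<and> ?pr (?pr i) = i \<and> ?lam (?pr i) = ?lam i
        \<and> ?pr i \<le> Suc i \<and> i \<le> Suc (?pr i) \<and> ?eta i \<noteq> 0
        \<and> (?pr i \<noteq> i \<longrightarrow> ?eta (?pr i) = - ?eta i)"
      using g u(2) l(1) H(1) prk unfolding strings_def by (fastforce simp: less_Suc_eq)
    show "\<forall>i j. i \<le> j \<longrightarrow> j < Suc k \<longrightarrow> ?lam j \<le> ?lam i"
      using g l(2) unfolding strings_def by (auto simp: less_Suc_eq)
    show "\<forall>a<Suc k. \<forall>b<Suc k. \<forall>s. H s (?w a) (?w b) = (if b = ?pr a \<and> Suc s = ?lam a then ?eta a else 0)"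
      (is "\<forall>a<_. \<forall>b<_. \<forall>s. ?Q a b s")
    proof (intro allI impI)
      fix a b s assume ab: "a < Suc k" "b < Suc k"
      show "?Q a b s"
      proof (cases "a = k")
        case True
        then show ?thesis using ab wu Huu[of s] by auto
      next
        case a: False
        show ?thesis
        proof (cases "b = k")
          case True
          then show ?thesis using a ab wu prk[of a] by auto
        next
          case False
          then show ?thesis using a ab g unfolding strings_def by auto
        qed
      qed
    qed
  qed
qed

lemma extend_odd:
  assumes g: "strings k lam w pr eta" and u: "u \<in> perp k w" "mpow e l *v u = 0"
    and v: "v \<in> perp k w" "mpow e l *v v = 0"
    and l: "odd l" "\<And>i. i < k \<Longrightarrow> l \<le> lam i"
    and H: "H (l - 1) u v = 1" "\<And>s. Suc s \<noteq> l \<Longrightarrow> H s u v = 0" "\<And>s. H s u u = 0" "\<And>s. H s v v = 0"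
  shows "strings (Suc (Suc k)) (lam(k := l, Suc k := l)) (w(k := u, Suc k := v))
    (pr(k := Suc k, Suc k := k)) (eta(k := 1, Suc k := - 1))"
proof -
  let ?w = "w(k := u, Suc k := v)" and ?lam = "lam(k := l, Suc k := l)"
    and ?pr = "pr(k := Suc k, Suc k := k)" and ?eta = "eta(k := 1, Suc k := - 1)"
  have l0: "0 < l" using l(1) by (cases l) auto
  have wu: "H s (w a) x = 0" "H s x (w a) = 0" if "a < k" "x = u \<or> x = v" for a s x
    using u(1) v(1) that H_skew[of s x "w a"] by (auto simp: perp_def)
  have prk: "pr a < k" if "a < k" for a using g that by (simp add: strings_def)
  have Huv: "H s u v = (if Suc s = l then 1 else 0)" for s
    using H(1) H(2)[of s] by auto
  have Hvu: "H s v u = (if Suc s = l then - 1 else 0)" for s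
    using Huv[of s] H_skew[of s v u] l(1) by auto
  show ?thesis
    unfolding strings_def
  proof (intro conjI)
    let ?P = "\<lambda>i. 0 < ?lam i \<and> mpow e (?lam i) *v ?w i = 0 \<and> ?pr i < Suc (Suc k)
        \<and> ?pr (?pr i) = i \<and> ?lam (?pr i) = ?lam i
        \<and> ?pr i \<le> Suc i \<and> i \<le> Suc (?pr i) \<and> ?eta i \<noteq> 0
        \<and> (?pr i \<noteq> i \<longrightarrow> ?eta (?pr i) = - ?eta i)"
    show "\<forall>i<Suc (Suc k). ?P i"
    proof (intro allI impI)
      fix i assume "i < Suc (Suc k)"
      then consider "i < k" | "i = k" | "i = Suc k" by linarith
      then show "?P i"
      proof cases
        case 1
        then show ?thesis using g prk[of i] unfolding strings_def by auto
      qed (use u(2) v(2) l0 in auto)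
    qed
    show "\<forall>i j. i \<le> j \<longrightarrow> j < Suc (Suc k) \<longrightarrow> ?lam j \<le> ?lam i"
      using g l(2) unfolding strings_def by (auto simp: less_Suc_eq)
    show "\<forall>a<Suc (Suc k). \<forall>b<Suc (Suc k). \<forall>s. H s (?w a) (?w b) = (if b = ?pr a \<and> Suc s = ?lam a then ?eta a else 0)"
      (is "\<forall>a<_. \<forall>b<_. \<forall>s. ?Q a b s")
    proof (intro allI impI)
      fix a b s assume "a < Suc (Suc k)" "b < Suc (Suc k)"
      then consider "a < k" "b < k" | "a < k" "b = k \<or> b = Suc k" | "a = k \<or> a = Suc k" "b < k"
        | "a = k \<or> a = Suc k" "b = k \<or> b = Suc k" by linarith
      then show "?Q a b s"
      proof cases
        case 1
        then show ?thesis using g unfolding strings_def by auto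
      next
        case 2
        then show ?thesis using wu prk[of a] by auto
      next
        case 3
        then show ?thesis using wu by auto
      next
        case 4
        then show ?thesis using H(3,4)[of s] Huv[of s] Hvu[of s] by auto
      qed
    qed
  qed
qed

text \<open>Split off a longest string, or a dual pair of such strings, and continue in the
  orthogonal complement, whose dimension has dropped.\<close>

theorem strings_exist: "\<exists>k lam w pr eta. strings k lam w pr eta \<and> perp k w = {0}"
proof -
  have "\<exists>k lam w pr eta. strings k lam w pr eta \<and> perp k w = {0}"
    if "strings k lam w pr eta" "\<forall>i<k. \<forall>v\<in>perp k w. mpow e (lam i) *v v = 0" for k lam w pr eta
    using that
  proof (induction "vec.dim (perp k w)" arbitrary: k lam w pr eta rule: less_induct)
    case less
    note g = less.prems(1) and inv = less.prems(2)
    let ?U = "perp k w"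
    show ?case
    proof (cases "?U = {0}")
      case True
      then show ?thesis using g by blast
    next
      case False
      have U0: "0 \<in> ?U" using subspace_perp by (rule vec.subspace_0)
      obtain N where N: "mpow e N = 0" using nilpotent_power by blast
      \<comment> \<open>The length of the longest strings left. The invariant that
        \<open>e^(lam i)\<close> kills the complement makes the lengths decrease.\<close>
      define l where "l = (LEAST m. \<forall>v\<in>?U. mpow e m *v v = 0)"
      have Ul: "\<forall>v\<in>?U. mpow e l *v v = 0"
        unfolding l_def by (rule LeastI[of _ N]) (simp add: N)
      have l0: "0 < l"
      proof (rule ccontr)
        assume "\<not> 0 < l"
        then have "\<forall>v\<in>?U. v = 0" using Ul by simp
        then show False using False U0 by blast
      qed
      have llam: "l \<le> lam i" if "i < k" for i
        unfolding l_def using inv that by (intro Least_le) blast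
      have "\<not> (\<forall>v\<in>?U. mpow e (l - 1) *v v = 0)"
        using not_less_Least[of "l - 1" "\<lambda>m. \<forall>v\<in>?U. mpow e m *v v = 0"] l0 by (simp add: l_def)
      then obtain v where v: "v \<in> ?U" "mpow e (l - 1) *v v \<noteq> 0" by blast
      \<comment> \<open>\<open>z\<close> need not lie in the complement; projecting it there does
        not alter its pairings with the complement.\<close>
      then obtain z where z: "H 0 z (mpow e (l - 1) *v v) \<noteq> 0" using H_nondegenerate by blast
      obtain z' where z': "z' \<in> ?U" "\<forall>v\<in>?U. \<forall>s. H s z' v = H s z v"
        using perp_projection[OF g, of z] by blast
      have zv: "H (l - 1) z' v \<noteq> 0" using z z'(2) v(1) by (simp add: H_mpow_right)
      show ?thesis
      proof (cases "even l")
        case True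
        \<comment> \<open>Polarisation: a nonzero symmetric form in characteristic other than 2 has
          a vector with nonzero self-pairing.\<close>
        have "\<exists>u\<in>?U. H (l - 1) u u \<noteq> 0"
        proof (rule ccontr)
          assume a: "\<not> (\<exists>u\<in>?U. H (l - 1) u u \<noteq> 0)"
          have "z' + v \<in> ?U" using subspace_perp z'(1) v(1) by (rule vec.subspace_add)
          then have "H (l - 1) (z' + v) (z' + v) = 0" "H (l - 1) z' z' = 0" "H (l - 1) v v = 0"
            using a z'(1) v(1) by blast+
          then have "H (l - 1) z' v + H (l - 1) v z' = 0"
            by (simp add: H_add_left H_add_right add.commute del: One_nat_def)
          moreover have "H (l - 1) v z' = H (l - 1) z' v"
            using H_skew[of "l - 1" v z'] True l0 by simp
          ultimately have "2 * H (l - 1) z' v = 0" by simp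
          then show False using zv two by simp
        qed
        then obtain u where u: "u \<in> ?U" "H (l - 1) u u \<noteq> 0" "\<And>s. Suc s \<noteq> l \<Longrightarrow> H s u u = 0"
          using even_string[OF subspace_perp perp_mpow l0 _ True] Ul by blast
        have sub: "perp (Suc k) (w(k := u)) \<subseteq> ?U" by (rule perp_antimono) auto
        have lt: "vec.dim (perp (Suc k) (w(k := u))) < vec.dim ?U"
          by (rule dim_perp_less[where i = k, OF sub u(1) _ _ u(2)]) auto
        have ul: "mpow e l *v u = 0" using Ul u(1) by blast
        show ?thesis
          by (rule less.hyps[OF lt extend_even[OF g u(1) ul l0 llam u(2,3)]])
            (use sub Ul inv in \<open>auto simp: less_Suc_eq\<close>)
      next
        case False
        obtain u v where uv: "u \<in> ?U" "v \<in> ?U" "H (l - 1) u v = 1" "\<And>s. Suc s \<noteq> l \<Longrightarrow> H s u v = 0"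
          "\<And>s. H s u u = 0" "\<And>s. H s v v = 0"
          using odd_strings[OF subspace_perp perp_mpow l0 _ False z'(1) v(1) zv] Ul by blast
        let ?w = "w(k := u, Suc k := v)"
        have sub: "perp (Suc (Suc k)) ?w \<subseteq> ?U" by (rule perp_antimono) auto
        have lt: "vec.dim (perp (Suc (Suc k)) ?w) < vec.dim ?U"
          by (rule dim_perp_less[where i = k and u = u and s = "l - 1", OF sub uv(2)]) (auto simp: uv(3) simp del: One_nat_def)
        have ul: "mpow e l *v u = 0" "mpow e l *v v = 0" using Ul uv(1,2) by blast+
        show ?thesis
          by (rule less.hyps[OF lt extend_odd[OF g uv(1) ul(1) uv(2) ul(2) False llam uv(3-6)]])
            (use sub Ul inv in \<open>auto simp: less_Suc_eq\<close>)
      qed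
    qed
  qed
  from this[of 0] show ?thesis by (simp add: strings_def)
qed

end

section \<open>A regular plane\<close>

context nilpotent_sp
begin

text \<open>The rank one map from \<open>v\<close> to \<open>u\<close>, spread over the powers of
  \<open>e\<close> so that it commutes with \<open>e\<close>.\<close>

definition trunc_op :: "nat \<Rightarrow> 'k^('n + 'n) \<Rightarrow> 'k^('n + 'n) \<Rightarrow> 'k^('n + 'n)^('n + 'n)" where
  "trunc_op m u v = matrix (\<lambda>z. \<Sum>r<m. bil v (mpow e (m - Suc r) *v z) *s (mpow e r *v u))"

lemma trunc_op: "trunc_op m u v *v z = (\<Sum>r<m. bil v (mpow e (m - Suc r) *v z) *s (mpow e r *v u))"
  unfolding trunc_op_def
  by (rule matrix_works, unfold_locales)
    (simp_all add: matrix_vector_right_distrib bil_add_right vector_sadd_rdistrib sum.distrib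
      vector_scalar_commute bil_scale_right vec.scale_sum_right)

text \<open>Composing with \<open>e\<close> on either side gives the same sum with \<open>r\<close>
  shifted by one, and the two boundary terms vanish.\<close>

lemma trunc_op_commute:
  assumes "mpow e m *v u = 0" "mpow e m *v v = 0"
  shows "lie_br (trunc_op m u v) e = 0"
proof -
  define g where "g z r = bil v (mpow e (m - r) *v z) *s (mpow e r *v u)" for z r
  have a: "trunc_op m u v *v (e *v z) = (\<Sum>r<m. g z r)" for z
    unfolding trunc_op g_def
  proof (rule sum.cong)
    fix r assume "r \<in> {..<m}"
    then have "mpow e (m - Suc r) ** e = mpow e (m - r)"
      by (metis Suc_diff_Suc lessThan_iff mpow.simps(2) mpow_commute)
    then show "bil v (mpow e (m - Suc r) *v (e *v z)) *s (mpow e r *v u) = bil v (mpow e (m - r) *v z) *s (mpow e r *v u)"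
      by (simp add: matrix_vector_mul_assoc)
  qed simp
  have b: "e *v (trunc_op m u v *v z) = (\<Sum>r<m. g z (Suc r))" for z
    unfolding trunc_op g_def vec.linear_sum
    by (simp add: vec.sum vector_scalar_commute matrix_vector_mul_assoc)
  have "bil v (mpow e m *v z) = 0" for z
    using bil_mpow[of m v z] assms(2) by simp
  then have "g z 0 = 0" "g z m = 0" for z using assms(1) by (simp_all add: g_def)
  then have "(\<Sum>r<m. g z (Suc r)) = (\<Sum>r<m. g z r)" for z
    using sum.lessThan_Suc[of "g z" m] sum.lessThan_Suc_shift[of "g z" m] by simp
  then have "(trunc_op m u v ** e) *v z = (e ** trunc_op m u v) *v z" for z
    by (simp add: matrix_vector_mul_assoc[symmetric] a b)
  then have "trunc_op m u v ** e = e ** trunc_op m u v" unfolding matrix_eq_iff_mult by blast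
  then show ?thesis by (simp add: lie_br_def)
qed

lemma commute_mpow:
  assumes "lie_br x e = 0"
  shows "x *v (mpow e s *v v) = mpow e s *v (x *v v)"
proof -
  have xe: "x ** e = e ** x" using assms by (simp add: lie_br_def)
  have "x ** mpow e s = mpow e s ** x"
  proof (induction s)
    case (Suc s)
    have "x ** (e ** mpow e s) = e ** (x ** mpow e s)" by (simp add: matrix_mul_assoc xe)
    then show ?case by (simp add: Suc matrix_mul_assoc)
  qed simp
  then show ?thesis by (simp add: matrix_vector_mul_assoc)
qed

lemma sp_adj_commute:
  assumes "lie_br x e = 0"
  shows "lie_br (sp_adj x) e = 0"
proof -
  have "lie_br (sp_adj x) e = - lie_br (sp_adj x) (sp_adj e)"
    using sp lie_br_smat_right[of "sp_adj x" "- 1" e] by (simp add: sp_iff smat_minus_one)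
  also have "lie_br (sp_adj x) (sp_adj e) = sp_adj (lie_br e x)" by (simp add: sp_adj_lie_br)
  also have "lie_br e x = 0" using assms lie_br_skew[of e x] by simp
  finally show ?thesis using sp_adj_smat[of 0 0] by simp
qed

end

section \<open>Coordinates on the centraliser and the stabiliser equations\<close>

locale strings_sp = nilpotent_sp e for e :: "'k::field^('n::finite + 'n)^('n + 'n)" +
  fixes k :: nat and lam w pr eta
  assumes strings: "strings k lam w pr eta" and perp_zero: "perp k w = {0}"
begin

lemma pr: "i < k \<Longrightarrow> pr i < k" "i < k \<Longrightarrow> pr (pr i) = i" "i < k \<Longrightarrow> lam (pr i) = lam i"
  "i < k \<Longrightarrow> pr i \<le> Suc i" "i < k \<Longrightarrow> i \<le> Suc (pr i)"
  and eta: "i < k \<Longrightarrow> eta i \<noteq> 0" "i < k \<Longrightarrow> pr i \<noteq> i \<Longrightarrow> eta (pr i) = - eta i"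
  and lam: "i < k \<Longrightarrow> 0 < lam i" "i \<le> j \<Longrightarrow> j < k \<Longrightarrow> lam j \<le> lam i"
  and w: "i < k \<Longrightarrow> mpow e (lam i) *v w i = 0"
  and Hw: "a < k \<Longrightarrow> b < k \<Longrightarrow> H s (w a) (w b) = (if b = pr a \<and> Suc s = lam a then eta a else 0)"
  using strings unfolding strings_def by auto

lemma mpow_w: "i < k \<Longrightarrow> lam i \<le> s \<Longrightarrow> mpow e s *v w i = 0"
proof -
  assume i: "i < k" "lam i \<le> s"
  then obtain t where "s = t + lam i" by (metis le_add_diff_inverse2)
  then show ?thesis using w[OF i(1)] by (simp add: mpow_add matrix_vector_mul_assoc[symmetric])
qed

lemma sum_pr: "(\<Sum>a<k. f (pr a)) = (\<Sum>a<k. f a)"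
proof (rule sum.reindex_bij_betw)
  show "bij_betw pr {..<k} {..<k}"
    by (rule bij_betw_byWitness[of _ pr]) (auto simp: pr)
qed

definition func :: "(nat \<Rightarrow> nat \<Rightarrow> 'k) \<Rightarrow> 'k^('n + 'n)^('n + 'n) \<Rightarrow> 'k" where
  "func c x = (\<Sum>a<k. \<Sum>b<k. c a b * bil (w a) (x *v w b))"

lemma func_add: "func c (x + y) = func c x + func c y"
  by (simp add: func_def matrix_vector_mult_add_rdistrib bil_add_right sum.distrib distrib_left)

lemma func_smat: "func c (smat r x) = r * func c x"
  by (simp add: func_def smat_mult_vec bil_scale_right sum_distrib_left mult_ac)

lemma func_diff: "func c (x - y) = func c x - func c y"
  using func_add[of c "x - y" y] by simp

text \<open>For self-adjoint \<open>x\<close> the numbers \<open>bil (w a) (x *v w b)\<close> are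
  antisymmetric in \<open>a\<close> and \<open>b\<close>, so they sum to zero against a symmetric
  \<open>c\<close>.\<close>

lemma func_self_adjoint:
  assumes c: "\<And>a b. a < k \<Longrightarrow> b < k \<Longrightarrow> c a b = c b a" and x: "sp_adj x = x"
  shows "func c x = 0"
proof -
  have "func c x = (\<Sum>b<k. \<Sum>a<k. c a b * bil (w a) (x *v w b))"
    unfolding func_def by (rule sum.swap)
  also have "\<dots> = (\<Sum>b<k. \<Sum>a<k. - (c b a * bil (w b) (x *v w a)))"
  proof (intro sum.cong refl)
    fix a b assume "b \<in> {..<k}" "a \<in> {..<k}"
    moreover have "bil (w a) (x *v w b) = - bil (w b) (x *v w a)"
      using bil_adj'[of "w a" x "w b"] bil_skew[of "x *v w a" "w b"] x by simp
    ultimately show "c a b * bil (w a) (x *v w b) = - (c b a * bil (w b) (x *v w a))"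
      using c[of a b] by simp
  qed
  also have "\<dots> = - func c x" by (simp add: func_def sum_negf)
  finally have "2 * func c x = 0" by (metis add.right_inverse mult_2)
  then show ?thesis using two by simp
qed

text \<open>For \<open>s < lam a\<close> this is, up to the factor \<open>eta (pr a)\<close>, the
  coefficient of \<open>e^(lam a - Suc s) (w a)\<close> in \<open>x (w b)\<close>.\<close>

definition X :: "'k^('n + 'n)^('n + 'n) \<Rightarrow> nat \<Rightarrow> nat \<Rightarrow> nat \<Rightarrow> 'k" where
  "X x a b s = H s (w (pr a)) (x *v w b)"

lemma X_high:
  assumes "a < k" "lam a \<le> s"
  shows "X x a b s = 0"
proof -
  have "mpow e s *v w (pr a) = 0" using assms pr mpow_w by simp
  then show ?thesis using bil_mpow[of s "w (pr a)" "x *v w b"] by (simp add: X_def H_def)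
qed

text \<open>No basis expansion is needed: \<open>x\<close> kills every \<open>w b\<close>, so the
  adjoint sends every \<open>w a\<close> into the trivial \<open>perp k w\<close>, and then the
  whole image of \<open>x\<close> lies there too.\<close>

lemma zero_if_X_zero:
  assumes x: "lie_br x e = 0" and X0: "\<And>a b s. a < k \<Longrightarrow> b < k \<Longrightarrow> X x a b s = 0"
  shows "x = 0"
proof -
  have perp: "v = 0" if "\<And>a s. a < k \<Longrightarrow> H s (w a) v = 0" for v
  proof -
    have "v \<in> perp k w" using that by (simp add: perp_def)
    then show ?thesis using perp_zero by simp
  qed
  have xw: "x *v w b = 0" if b: "b < k" for b
  proof (rule perp)
    fix a s assume "a < k"
    then show "H s (w a) (x *v w b) = 0" using X0[of "pr a" b s] b by (simp add: X_def pr)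
  qed
  have aw: "sp_adj x *v w a = 0" if a: "a < k" for a
  proof (rule perp)
    fix b s assume b: "b < k"
    have "H s (w b) (sp_adj x *v w a) = bil (w b) (sp_adj x *v (mpow e s *v w a))"
      by (simp add: H_def commute_mpow[OF sp_adj_commute[OF x]])
    also have "\<dots> = 0" using xw[OF b] by (simp add: bil_adj[symmetric])
    finally show "H s (w b) (sp_adj x *v w a) = 0" .
  qed
  have "x *v v = 0" for v
  proof (rule perp)
    fix a s assume a: "a < k"
    have "H s (w a) (x *v v) = bil (w a) (x *v (mpow e s *v v))" by (simp add: H_def commute_mpow[OF x])
    also have "\<dots> = 0" using aw[OF a] by (simp add: bil_adj')
    finally show "H s (w a) (x *v v) = 0" .
  qed
  then show ?thesis unfolding matrix_eq_iff_mult by simp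
qed

text \<open>The stabiliser equations, obtained by testing with the map that sends \<open>w i\<close> to \<open>e\<^sup>s (w j)\<close>, up to a
  scalar, and the other strings to \<open>0\<close>.\<close>
lemma stabiliser_equation:
  assumes x: "lie_br x e = 0" and st: "\<And>y. lie_br y e = 0 \<Longrightarrow> func c (lie_br x y) = 0"
    and ij: "i < k" "j < k" and s: "lam j \<le> s + lam i"
  shows "eta (pr i) * (\<Sum>a<k. c (pr a) i * X x a j s)
    = eta (pr j) * (\<Sum>b<k. c (pr j) b * X x i b (s + lam i - lam j))"
proof -
  \<comment> \<open>With this \<open>m\<close>, and because \<open>lam j \<le> s + lam i\<close>,
    the power \<open>e^m\<close> kills both \<open>u\<close> and \<open>v\<close>, so
    \<open>T\<close> commutes with \<open>e\<close>.\<close>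
  define m where "m = min (lam i) (lam j)"
  have m: "0 < m" "m \<le> lam i" "m \<le> lam j" "lam j \<le> m + s" using lam ij s by (auto simp: m_def)
  define u where "u = mpow e s *v w j"
  define v where "v = mpow e (lam i - m) *v w (pr i)"
  define T where "T = trunc_op m u v"
  define \<sigma> :: 'k where "\<sigma> = (- 1) ^ (lam i - m)"
  have "mpow e m *v u = mpow e (m + s) *v w j" by (simp add: u_def mpow_add matrix_vector_mul_assoc)
  then have u0: "mpow e m *v u = 0" using mpow_w[OF ij(2)] m by simp
  have "mpow e m *v v = mpow e (m + (lam i - m)) *v w (pr i)"
    by (simp add: v_def mpow_add matrix_vector_mul_assoc)
  then have v0: "mpow e m *v v = 0" using mpow_w[of "pr i" "lam i"] m ij by (simp add: pr)
  have bv: "bil v (mpow e t *v z) = \<sigma> * H (lam i - m + t) (w (pr i)) z" for t z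
    using H_mpow_left[of t "lam i - m" "w (pr i)" z] by (simp add: v_def \<sigma>_def H_def add.commute)
  have Tw: "T *v w b = (if b = i then (\<sigma> * eta (pr i)) *s u else 0)" if b: "b < k" for b
  proof -
    have "T *v w b = (\<Sum>r<m. if r = 0 then (if b = i then (\<sigma> * eta (pr i)) *s u else 0) else 0)"
      unfolding T_def trunc_op bv
    proof (rule sum.cong)
      fix r assume r: "r \<in> {..<m}"
      have "Suc (lam i - m + (m - Suc r)) = lam i \<longleftrightarrow> r = 0" using r m by auto
      then show "(\<sigma> * H (lam i - m + (m - Suc r)) (w (pr i)) (w b)) *s (mpow e r *v u)
          = (if r = 0 then (if b = i then (\<sigma> * eta (pr i)) *s u else 0) else 0)"
        using Hw[of "pr i" b] b ij by (auto simp: pr)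
    qed simp
    then show ?thesis using m by (simp add: if_distrib cong: if_cong)
  qed
  have "func c (x ** T) = (\<Sum>a<k. \<Sum>b<k. if b = i then \<sigma> * eta (pr i) * (c a i * H s (w a) (x *v w j)) else 0)"
    unfolding func_def
    by (intro sum.cong refl)
      (auto simp: matrix_vector_mul_assoc[symmetric] Tw vector_scalar_commute bil_scale_right u_def
        commute_mpow[OF x] H_def)
  also have "\<dots> = \<sigma> * (eta (pr i) * (\<Sum>a<k. c a i * H s (w a) (x *v w j)))"
    using ij by (simp add: sum_distrib_left mult_ac)
  also have "(\<Sum>a<k. c a i * H s (w a) (x *v w j)) = (\<Sum>a<k. c (pr a) i * X x a j s)"
    unfolding X_def by (rule sum_pr[symmetric])
  finally have L: "func c (x ** T) = \<sigma> * (eta (pr i) * (\<Sum>a<k. c (pr a) i * X x a j s))" .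
  have Tx: "bil (w a) (T *v z) = (if a = pr j then \<sigma> * eta (pr j) * H (s + lam i - lam j) (w (pr i)) z else 0)"
    if a: "a < k" for a z
  proof -
    have "bil (w a) (T *v z) = (\<Sum>r<m. \<sigma> * H (lam i - m + (m - Suc r)) (w (pr i)) z * H (r + s) (w a) (w j))"
      unfolding T_def trunc_op bv
      by (simp add: bil_sum_right bil_scale_right u_def matrix_vector_mul_assoc mpow_add[symmetric] H_def)
    also have "\<dots> = (\<Sum>r<m. if Suc (r + s) = lam j then
        (if a = pr j then \<sigma> * eta (pr j) * H (s + lam i - lam j) (w (pr i)) z else 0) else 0)"
    proof (rule sum.cong)
      fix r assume r: "r \<in> {..<m}"
      show "\<sigma> * H (lam i - m + (m - Suc r)) (w (pr i)) z * H (r + s) (w a) (w j) = (if Suc (r + s) = lam j then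
        (if a = pr j then \<sigma> * eta (pr j) * H (s + lam i - lam j) (w (pr i)) z else 0) else 0)"
      proof (cases "a = pr j")
        case True
        have "lam i - m + (m - Suc r) = s + lam i - lam j" if "Suc (r + s) = lam j"
          using that r m by auto
        then show ?thesis using Hw[of a j "r + s"] a ij True by (auto simp: pr)
      next
        case False
        then have "j \<noteq> pr a" using a by (metis pr(2))
        then show ?thesis using Hw[of a j "r + s"] a ij False by simp
      qed
    qed simp
    also have "\<dots> = (if a = pr j then \<sigma> * eta (pr j) * H (s + lam i - lam j) (w (pr i)) z else 0)"
    proof (cases "s < lam j")
      case True
      have "Suc (r + s) = lam j \<longleftrightarrow> r = lam j - Suc s" for r using True by auto
      moreover have "lam j - Suc s < m" using True m by auto
      ultimately show ?thesis by simp
    next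
      case False
      then have "lam i \<le> s + lam i - lam j" by simp
      then have "mpow e (s + lam i - lam j) *v w (pr i) = 0" using mpow_w[of "pr i"] ij by (simp add: pr)
      then have "H (s + lam i - lam j) (w (pr i)) z = 0"
        using bil_mpow[of "s + lam i - lam j" "w (pr i)" z] by (simp add: H_def)
      then show ?thesis using False by (auto intro!: sum.neutral)
    qed
    finally show ?thesis .
  qed
  have "func c (T ** x) = (\<Sum>a<k. \<Sum>b<k. if a = pr j then \<sigma> * (eta (pr j) * (c (pr j) b * X x i b (s + lam i - lam j))) else 0)"
    unfolding func_def
    by (intro sum.cong refl) (auto simp: matrix_vector_mul_assoc[symmetric] Tx X_def)
  also have "\<dots> = (\<Sum>a<k. if a = pr j then (\<Sum>b<k. \<sigma> * (eta (pr j) * (c (pr j) b * X x i b (s + lam i - lam j)))) else 0)"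
    by (intro sum.cong refl) auto
  also have "\<dots> = \<sigma> * (eta (pr j) * (\<Sum>b<k. c (pr j) b * X x i b (s + lam i - lam j)))"
    using ij by (simp add: sum_distrib_left pr)
  finally have R: "func c (T ** x) = \<sigma> * (eta (pr j) * (\<Sum>b<k. c (pr j) b * X x i b (s + lam i - lam j)))" .
  have "func c (lie_br x T) = 0" using st trunc_op_commute[OF u0 v0] by (simp add: T_def)
  then have "func c (x ** T) = func c (T ** x)" by (simp add: lie_br_def func_diff)
  moreover have "\<sigma> \<noteq> 0" by (simp add: \<sigma>_def)
  ultimately show ?thesis unfolding L R by simp
qed

end

context strings_sp
begin

lemma sum_single:
  assumes "b < k" "\<And>i. i < k \<Longrightarrow> i \<noteq> b \<Longrightarrow> f i = 0"
  shows "(\<Sum>i<k. f i) = f b"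
  using assms sum.remove[of "{..<k}" b f] by simp

text \<open>In a Hessenberg pencil the equations determine the components of \<open>x\<close> diagonal by diagonal: those
  on and above the main diagonal from the first one of their diagonal, the others from the last one.\<close>
lemma hessenberg_X_zero:
  assumes x: "lie_br x e = 0" and st: "\<And>y. lie_br y e = 0 \<Longrightarrow> func c (lie_br x y) = 0"
    and hess: "\<And>a b. a < k \<Longrightarrow> Suc b < a \<Longrightarrow> c (pr a) b = 0"
    and sub: "\<And>b. Suc b < k \<Longrightarrow> c (pr (Suc b)) b \<noteq> 0"
    and zero: "\<And>b s. b < k \<Longrightarrow> X x 0 b s = 0"
  shows "a < k \<Longrightarrow> b < k \<Longrightarrow> X x a b s = 0"
proof (induction "(k + a - b, if a \<le> b then a else k - b)" arbitrary: a b s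
    rule: wf_induct_rule[OF wf_lex_prod[OF wf_less_than wf_less_than]])
  \<comment> \<open>The measure is the diagonal, counted from the upper right corner, and then the
    distance from the end at which that diagonal is started.\<close>
  case (1 a b t)
  note ab = 1(2,3)
  have IH1: "X x a' b' s = 0" if "a' < k" "b' < k" "k + a' - b' < k + a - b" for a' b' s
    using that by (intro 1(1)) auto
  have IH2: "X x a' b' s = 0" if "a' < k" "b' < k" "k + a' - b' = k + a - b"
    "(if a' \<le> b' then a' else k - b') < (if a \<le> b then a else k - b)" for a' b' s
    using that by (intro 1(1)) auto
  show ?case
  proof (cases "a \<le> b")
    case True
    show ?thesis
    proof (cases a)
      case 0
      then show ?thesis using zero ab by simp
    next
      case (Suc i)
      have ik: "i < k" using Suc ab by simp
      \<comment> \<open>On the left only \<open>X x a b t\<close> is not yet known to vanish. On the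
        right \<open>b'\<close> is at least \<open>b - 1\<close>, so the entries lie on earlier
        diagonals or one place earlier on the same one.\<close>
      have "eta (pr i) * (\<Sum>a<k. c (pr a) i * X x a b t)
          = eta (pr b) * (\<Sum>b'<k. c (pr b) b' * X x i b' (t + lam i - lam b))"
        using True Suc ab lam(2)[of i b] by (intro stabiliser_equation[OF x st]) auto
      also have "(\<Sum>b'<k. c (pr b) b' * X x i b' (t + lam i - lam b)) = 0"
      proof (rule sum.neutral, rule ballI)
        fix b' assume "b' \<in> {..<k}"
        then show "c (pr b) b' * X x i b' (t + lam i - lam b) = 0"
          using ab Suc True IH1[of i b' "t + lam i - lam b"] IH2[of i b' "t + lam i - lam b"] hess[of b b']
          by (cases "b \<le> b'"; cases "Suc b' = b") auto
      qed
      also have "(\<Sum>a'<k. c (pr a') i * X x a' b t) = c (pr a) i * X x a b t"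
      proof (rule sum_single[OF ab(1)])
        show "c (pr a') i * X x a' b t = 0" if "a' < k" "a' \<noteq> a" for a'
          using that ab Suc IH1[of a' b t] hess[of a' i] by (cases "a' < a") auto
      qed
      finally have "eta (pr i) * (c (pr a) i * X x a b t) = 0" by simp
      then show ?thesis using eta(1)[of "pr i"] sub[of i] Suc ab ik by (simp add: pr)
    qed
  next
    case False
    then have ba: "b < a" by simp
    \<comment> \<open>Chosen so that the right side of the equation for \<open>a\<close> and
      \<open>Suc b\<close> contains \<open>X x a b\<close> at exactly \<open>t\<close>. On the left
      \<open>a'\<close> is at most \<open>Suc a\<close>, so the entries are on earlier diagonals or
      one place closer to the end.\<close>
    define s where "s = t + lam (Suc b) - lam a"
    have bk: "Suc b < k" using ba ab by simp
    have le: "lam a \<le> lam (Suc b)" using ba ab lam(2)[of "Suc b" a] by simp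
    have t: "s + lam a - lam (Suc b) = t" using le by (simp add: s_def)
    have "eta (pr a) * (\<Sum>a'<k. c (pr a') a * X x a' (Suc b) s)
        = eta (pr (Suc b)) * (\<Sum>b'<k. c (pr (Suc b)) b' * X x a b' (s + lam a - lam (Suc b)))"
      using ab bk le by (intro stabiliser_equation[OF x st]) (auto simp: s_def)
    also have "(\<Sum>a'<k. c (pr a') a * X x a' (Suc b) s) = 0"
    proof (rule sum.neutral, rule ballI)
      fix a' assume "a' \<in> {..<k}"
      then show "c (pr a') a * X x a' (Suc b) s = 0"
        using ab bk ba IH1[of a' "Suc b" s] IH2[of a' "Suc b" s] hess[of a' a]
        by (cases "a' \<le> a"; cases "a' = Suc a") auto
    qed
    also have "(\<Sum>b'<k. c (pr (Suc b)) b' * X x a b' (s + lam a - lam (Suc b)))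
        = c (pr (Suc b)) b * X x a b (s + lam a - lam (Suc b))"
    proof (rule sum_single[OF ab(2)])
      show "c (pr (Suc b)) b' * X x a b' (s + lam a - lam (Suc b)) = 0" if "b' < k" "b' \<noteq> b" for b'
        using that ab bk t IH1[of a b' t] hess[of "Suc b" b'] by (cases "b < b'") auto
    qed
    finally show ?thesis using eta(1)[of "pr (Suc b)"] sub bk by (simp add: pr t)
  qed
qed

text \<open>The equation relates an entry to itself, shifted by the difference of the lengths. For
  equal lengths the distinct factors force it to vanish; otherwise iterating raises \<open>s\<close>
  until \<open>X_high\<close> applies.\<close>

lemma diagonal_X_zero:
  assumes x: "lie_br x e = 0" and st: "\<And>y. lie_br y e = 0 \<Longrightarrow> func c (lie_br x y) = 0"
    and diag: "\<And>a b. a < k \<Longrightarrow> b < k \<Longrightarrow> c (pr a) b = (if a = b then \<theta> a / eta (pr a) else 0)"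
    and \<theta>: "\<And>a. a < k \<Longrightarrow> \<theta> a \<noteq> 0" "\<And>a b. a < k \<Longrightarrow> b < k \<Longrightarrow> a \<noteq> b \<Longrightarrow> \<theta> a \<noteq> \<theta> b"
    and ij: "i < k" "j < k" "i \<noteq> j"
  shows "X x i j t = 0"
proof -
  have eq: "\<theta> i * X x i j s = \<theta> j * X x i j (s + lam i - lam j)" if "lam j \<le> s + lam i" for s
  proof -
    have "(\<Sum>a<k. c (pr a) i * X x a j s) = c (pr i) i * X x i j s"
      by (rule sum_single) (use ij in \<open>auto simp: diag\<close>)
    moreover have "(\<Sum>b<k. c (pr j) b * X x i b (s + lam i - lam j)) = c (pr j) j * X x i j (s + lam i - lam j)"
      by (rule sum_single) (use ij in \<open>auto simp: diag\<close>)
    ultimately show ?thesis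
      using stabiliser_equation[OF x st ij(1,2) that] ij eta(1)[of "pr i"] eta(1)[of "pr j"]
      by (simp add: pr diag)
  qed
  have shift: "X x i j s = 0" if d: "0 < d" and rel: "\<And>s. \<exists>q. X x i j s = q * X x i j (s + d)" for d s
  proof (induction "lam i - s" arbitrary: s rule: less_induct)
    case less
    show ?case
    proof (cases "lam i \<le> s")
      case True
      then show ?thesis using X_high ij by simp
    next
      case False
      then have "X x i j (s + d) = 0" using d by (intro less) auto
      then show ?thesis using rel[of s] by auto
    qed
  qed
  consider "lam i = lam j" | "lam j < lam i" | "lam i < lam j" by linarith
  then show ?thesis
  proof cases
    case 1
    then have "(\<theta> i - \<theta> j) * X x i j t = 0" using eq[of t] by (simp add: algebra_simps)
    then show ?thesis using \<theta>(2)[OF ij] by simp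
  next
    case 2
    show ?thesis
    proof (rule shift[of "lam i - lam j"])
      fix s
      have "\<theta> i * X x i j s = \<theta> j * X x i j (s + (lam i - lam j))" using eq[of s] 2 by simp
      then have "X x i j s = (\<theta> j / \<theta> i) * X x i j (s + (lam i - lam j))" using \<theta>(1)[OF ij(1)] by (simp add: field_simps)
      then show "\<exists>q. X x i j s = q * X x i j (s + (lam i - lam j))" by blast
    qed (use 2 in simp)
  next
    case 3
    show ?thesis
    proof (rule shift[of "lam j - lam i"])
      fix s
      have "\<theta> i * X x i j (s + (lam j - lam i)) = \<theta> j * X x i j s" using eq[of "s + (lam j - lam i)"] 3 by simp
      then have "X x i j s = (\<theta> i / \<theta> j) * X x i j (s + (lam j - lam i))" using \<theta>(1)[OF ij(2)] by (simp add: field_simps)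
      then show "\<exists>q. X x i j s = q * X x i j (s + (lam j - lam i))" by blast
    qed (use 3 in simp)
  qed
qed

section \<open>Dimensions of the stabilisers\<close>

definition gl_stab :: "(nat \<Rightarrow> nat \<Rightarrow> 'k) \<Rightarrow> ('k^('n + 'n)^('n + 'n)) set" where
  "gl_stab c = {x. lie_br x e = 0 \<and> (\<forall>y. lie_br y e = 0 \<longrightarrow> func c (lie_br x y) = 0)}"

lemma subspace_gl_stab: "mat.subspace (gl_stab c)"
proof (rule mat.subspaceI)
  have "func c 0 = 0" using func_smat[of c 0 0] by simp
  then show "0 \<in> gl_stab c" by (simp add: gl_stab_def)
qed (auto simp: gl_stab_def lie_br_add_left lie_br_smat_left func_add func_smat)

lemma dim_gl_stab_le:
  assumes lin: "Vector_Spaces.linear smat (*s) L"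
    and inj: "\<And>x. x \<in> gl_stab c \<Longrightarrow> L x = (0 :: 'k^('n + 'n)) \<Longrightarrow> x = 0"
  shows "mat.dim (gl_stab c) \<le> 2 * CARD('n)"
proof -
  interpret p: finite_dimensional_vector_space_pair_1 "smat :: 'k \<Rightarrow> 'k^('n + 'n)^('n + 'n) \<Rightarrow> _"
    "(\<lambda>(i, j). mat_unit i j) ` UNIV" "(*s) :: 'k \<Rightarrow> 'k^('n + 'n) \<Rightarrow> _"
    by unfold_locales
  interpret L: Vector_Spaces.linear smat "(*s)" L by fact
  have sp: "mat.span (gl_stab c) = gl_stab c" using subspace_gl_stab by simp
  have "inj_on L (mat.span (gl_stab c))"
    unfolding sp using inj by (subst L.inj_on_iff_eq_0[OF subspace_gl_stab]) auto
  then have "vec.dim (L ` gl_stab c) = mat.dim (gl_stab c)" by (rule p.dim_image_eq[OF lin])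
  moreover have "vec.dim (L ` gl_stab c) \<le> CARD('n + 'n)" by (rule dim_subset_UNIV_cart_gen)
  ultimately show ?thesis by simp
qed

text \<open>The vector \<open>sp_adj x *v w (pr 0)\<close> contains all entries
  \<open>X x 0 b s\<close>, which determine the remaining ones.\<close>

lemma dim_gl_stab_hessenberg:
  assumes hess: "\<And>a b. a < k \<Longrightarrow> Suc b < a \<Longrightarrow> c (pr a) b = 0"
    and sub: "\<And>b. Suc b < k \<Longrightarrow> c (pr (Suc b)) b \<noteq> 0"
  shows "mat.dim (gl_stab c) \<le> 2 * CARD('n)"
proof (rule dim_gl_stab_le)
  show "Vector_Spaces.linear smat (*s) (\<lambda>x. sp_adj x *v w (pr 0))"
    by unfold_locales (simp_all add: sp_adj_add sp_adj_smat matrix_vector_mult_add_rdistrib smat_mult_vec)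
  fix x assume x: "x \<in> gl_stab c" and z: "sp_adj x *v w (pr 0) = 0"
  have xe: "lie_br x e = 0" and st: "\<And>y. lie_br y e = 0 \<Longrightarrow> func c (lie_br x y) = 0"
    using x by (auto simp: gl_stab_def)
  have "X x 0 b s = 0" for b s
  proof -
    have "X x 0 b s = bil (w (pr 0)) (x *v (mpow e s *v w b))" by (simp add: X_def H_def commute_mpow[OF xe])
    then show ?thesis by (simp add: bil_adj' z)
  qed
  then show "x = 0"
    using hessenberg_X_zero[of x c] xe st hess sub by (intro zero_if_X_zero[OF xe]) blast
qed

text \<open>Only the entries \<open>X x a a s\<close> survive, and these can be read off from the
  image of the sum of all generators.\<close>

lemma dim_gl_stab_diagonal:
  assumes diag: "\<And>a b. a < k \<Longrightarrow> b < k \<Longrightarrow> c (pr a) b = (if a = b then \<theta> a / eta (pr a) else 0)"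
    and \<theta>: "\<And>a. a < k \<Longrightarrow> \<theta> a \<noteq> 0" "\<And>a b. a < k \<Longrightarrow> b < k \<Longrightarrow> a \<noteq> b \<Longrightarrow> \<theta> a \<noteq> \<theta> b"
  shows "mat.dim (gl_stab c) \<le> 2 * CARD('n)"
proof (rule dim_gl_stab_le)
  show "Vector_Spaces.linear smat (*s) (\<lambda>x. x *v (\<Sum>b<k. w b))"
    by unfold_locales (simp_all add: matrix_vector_mult_add_rdistrib smat_mult_vec)
  fix x assume x: "x \<in> gl_stab c" and z: "x *v (\<Sum>b<k. w b) = 0"
  have xe: "lie_br x e = 0" and st: "\<And>y. lie_br y e = 0 \<Longrightarrow> func c (lie_br x y) = 0"
    using x by (auto simp: gl_stab_def)
  have off: "X x a b s = 0" if "a < k" "b < k" "a \<noteq> b" for a b s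
    using diagonal_X_zero[OF xe st diag \<theta> that] by blast
  have "X x a a s = 0" if a: "a < k" for a s
  proof -
    have "X x a a s = (\<Sum>b<k. X x a b s)" by (rule sum_single[symmetric]) (use off a in auto)
    also have "\<dots> = H s (w (pr a)) (x *v (\<Sum>b<k. w b))"
      by (simp add: X_def vec.sum H_sum_right)
    finally show ?thesis by (simp add: z)
  qed
  then show "x = 0" using off by (intro zero_if_X_zero[OF xe]) blast
qed

text \<open>The self-adjoint part of the centraliser contributes at least \<open>n\<close> dimensions to the stabiliser in the
  whole centraliser, which leaves at most \<open>n\<close> for the skew part.\<close>
lemma dim_stab_le:
  assumes ac: "alg_closed TYPE('k)"
    and sym: "\<And>a b. a < k \<Longrightarrow> b < k \<Longrightarrow> c a b = c b a"
    and dim: "mat.dim (gl_stab c) \<le> 2 * CARD('n)"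
    and \<gamma>: "\<gamma> \<in> dual_sp (centraliser sp e)" "\<And>x. x \<in> centraliser sp e \<Longrightarrow> \<gamma> x = func c x"
  shows "mat.dim (stab (centraliser sp e) \<gamma>) \<le> CARD('n)"
proof -
  let ?q = "centraliser sp e" and ?p = "centraliser (eps_space 1) e"
  define P where "P = {x \<in> ?p. \<forall>y\<in>?p. \<gamma> (lie_br x y) = 0}"
  have P: "CARD('n) \<le> mat.dim P"
    unfolding P_def by (rule stabiliser_dim_ge[OF ac two sp _ \<gamma>(1)]) simp
  have qbr: "lie_br x y \<in> ?q" if "x \<in> ?q" "y \<in> ?q" for x y
    using that lie_br_eps_centraliser[of x "- 1" e y] by (simp add: sp_eq_eps)
  have pbr: "lie_br x y \<in> ?q" if "x \<in> ?p" "y \<in> ?p" for x y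
    using that by (rule lie_br_eps_centraliser) simp
  have mixed: "func c (lie_br x y) = 0" if "x \<in> ?q" "y \<in> ?p" for x y
  proof (rule func_self_adjoint[OF sym])
    show "sp_adj (lie_br x y) = lie_br x y"
      using that eps_lie_br_sp[of y 1 x] by (simp add: centraliser_def eps_space_def)
  qed
  have split: "\<exists>y1\<in>?q. \<exists>y2\<in>?p. y = y1 + y2" if y: "lie_br y e = 0" for y
  proof -
    define y1 where "y1 = smat (inverse 2) (y - sp_adj y)"
    define y2 where "y2 = smat (inverse 2) (y + sp_adj y)"
    note ay = sp_adj_commute[OF y]
    have br: "lie_br (y - sp_adj y) e = 0" "lie_br (y + sp_adj y) e = 0"
      using y ay lie_br_add_left[of "y - sp_adj y" "sp_adj y" e] by (simp_all add: lie_br_add_left)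
    have "y1 \<in> ?q"
      using br by (simp add: y1_def centraliser_def lie_br_smat_left sp_iff sp_adj_smat sp_adj_diff sp_adj_adj)
        (simp flip: mat.scale_minus_right)
    moreover have "y2 \<in> ?p"
      using br by (simp add: y2_def centraliser_def lie_br_smat_left eps_space_def sp_adj_smat sp_adj_add sp_adj_adj add.commute)
    moreover have "y = y1 + y2"
    proof -
      have "inverse 2 * (a - b) + inverse 2 * (a + b) = a" for a b :: 'k
      proof -
        have "inverse 2 * (a - b) + inverse 2 * (a + b) = inverse 2 * (2 * a)"
          by (simp only: distrib_left[symmetric]) simp
        then show ?thesis using two by simp
      qed
      then show ?thesis by (simp add: y1_def y2_def vec_eq_iff)
    qed
    ultimately show ?thesis by blast
  qed
  have A: "x \<in> gl_stab c" if x: "lie_br x e = 0" "\<forall>y\<in>?q. func c (lie_br x y) = 0" "\<forall>y\<in>?p. func c (lie_br x y) = 0" for x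
    unfolding gl_stab_def
  proof (safe intro!: x(1))
    fix y assume "lie_br y e = 0"
    then obtain y1 y2 where "y1 \<in> ?q" "y2 \<in> ?p" "y = y1 + y2" using split by blast
    then show "func c (lie_br x y) = 0" using x(2,3) by (simp add: lie_br_add_right func_add)
  qed
  have qA: "stab ?q \<gamma> \<subseteq> gl_stab c"
  proof
    fix x assume "x \<in> stab ?q \<gamma>"
    then have x: "x \<in> ?q" "\<forall>y\<in>?q. \<gamma> (lie_br x y) = 0" by (auto simp: stab_def)
    have "func c (lie_br x y) = 0" if "y \<in> ?q" for y
      using x(2) that \<gamma>(2)[OF qbr[OF x(1) that]] by simp
    moreover have "lie_br x e = 0" using x(1) by (simp add: centraliser_def)
    ultimately show "x \<in> gl_stab c" using mixed[OF x(1)] by (intro A) auto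
  qed
  have PA: "P \<subseteq> gl_stab c"
  proof
    fix x assume "x \<in> P"
    then have x: "x \<in> ?p" "\<forall>y\<in>?p. \<gamma> (lie_br x y) = 0" by (auto simp: P_def)
    have "func c (lie_br x y) = 0" if "y \<in> ?q" for y
      using mixed[OF that x(1)] func_smat[of c "- 1" "lie_br y x"] lie_br_skew[of x y]
      by (simp add: smat_minus_one)
    moreover have "func c (lie_br x y) = 0" if "y \<in> ?p" for y
      using x(2) that \<gamma>(2)[OF pbr[OF x(1) that]] by simp
    moreover have "lie_br x e = 0" using x(1) by (simp add: centraliser_def)
    ultimately show "x \<in> gl_stab c" by (intro A) auto
  qed
  note sq = subspace_centraliser[OF subspace_sp, of e]
  note sstab = subspace_stab[OF sq qbr \<gamma>(1)]
  have sP: "mat.subspace P"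
    unfolding P_def using subspace_centraliser[OF subspace_eps] sq pbr \<gamma>(1) by (rule subspace_form_kernel)
  obtain B where B: "B \<subseteq> stab ?q \<gamma>" "mat.independent B" "stab ?q \<gamma> \<subseteq> mat.span B" "card B = mat.dim (stab ?q \<gamma>)"
    by (rule mat.basis_exists)
  have spB: "mat.span B = stab ?q \<gamma>" by (rule mat.span_subspace[OF B(1,3) sstab])
  \<comment> \<open>Skew and self-adjoint at once means zero, as 2 is invertible; so the two
    dimensions add up inside \<open>gl_stab c\<close>.\<close>
  have "mat.span B \<inter> P \<subseteq> {0}"
  proof
    fix x assume "x \<in> mat.span B \<inter> P"
    then have "sp_adj x = - x" "sp_adj x = x"
      unfolding spB by (auto simp: stab_def P_def centraliser_def sp_iff eps_space_def)
    then have "- (x $ i $ j) = x $ i $ j" for i j by (metis vector_uminus_component)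
    then have "2 * x $ i $ j = 0" for i j by (metis add.right_inverse mult_2)
    then show "x \<in> {0}" using two by (simp add: vec_eq_iff)
  qed
  then have "card B + mat.dim P \<le> mat.dim (gl_stab c)"
    using B(1) qA by (intro mat.card_add_dim_le[OF B(2) _ subspace_gl_stab sP PA]) auto
  then show ?thesis using P dim B(4) by simp
qed

text \<open>\<open>diag_coeff\<close> and \<open>hess_coeff\<close> are the symmetric matrices of the two functionals that span the plane: up
  to the involution \<open>pr\<close> of the index, the first is diagonal with distinct entries and the second is
  Hessenberg.\<close>
definition diag_coeff :: "(nat \<Rightarrow> 'k) \<Rightarrow> nat \<Rightarrow> nat \<Rightarrow> 'k" where
  "diag_coeff \<theta> a b = (if pr a = b then \<theta> b / eta a else 0)"

definition hess_coeff :: "nat \<Rightarrow> nat \<Rightarrow> 'k" where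
  "hess_coeff a b = (if pr a = Suc b then 1 else 0) + (if pr b = Suc a then 1 else 0)"

text \<open>The summand added for symmetry sits where \<open>pr b = Suc (pr a)\<close>. As
  \<open>pr\<close> moves an index by at most one,
  \<open>pr b \<le> Suc b < a \<le> Suc (pr a)\<close> keeps it away from below the subdiagonal; on
  the subdiagonal the value is 1 or 2. This is why dual strings are kept adjacent.\<close>

lemma hess_coeff_pr:
  assumes "a < k"
  shows "Suc b < a \<Longrightarrow> hess_coeff (pr a) b = 0" "a = Suc b \<Longrightarrow> hess_coeff (pr a) b \<noteq> 0"
proof -
  show "hess_coeff (pr a) b = 0" if "Suc b < a"
    using assms that pr[of a] pr[of b] by (auto simp: hess_coeff_def)
  show "hess_coeff (pr a) b \<noteq> 0" if "a = Suc b"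
    using assms that pr[of a] two by (auto simp: hess_coeff_def)
qed

lemma regular_plane_functionals:
  assumes ac: "alg_closed TYPE('k)"
  shows "\<exists>c1 c2. \<forall>s t. (s, t) \<noteq> (0, 0) \<longrightarrow>
    (\<forall>a<k. \<forall>b<k. s * c1 a b + t * c2 a b = s * c1 b a + t * c2 b a) \<and>
    mat.dim (gl_stab (\<lambda>a b. s * c1 a b + t * c2 a b)) \<le> 2 * CARD('n)"
proof -
  obtain f :: "nat \<Rightarrow> 'k" where f: "inj f" "\<And>i j. f i \<noteq> - f j"
    using signed_distinct_values[OF ac two] by blast
  \<comment> \<open>\<open>eta\<close> changes sign between dual strings, so a symmetric
    \<open>diag_coeff\<close> requires \<open>\<theta> (pr i) = - \<theta> i\<close> whenever
    \<open>pr i \<noteq> i\<close>.\<close>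
  define \<theta> where "\<theta> i = (if i \<le> pr i then f i else - f (pr i))" for i
  have \<theta>0: "\<theta> i \<noteq> 0" for i
    using f(2)[of i i] f(2)[of "pr i" "pr i"] by (auto simp: \<theta>_def)
  have \<theta>d: "\<theta> i \<noteq> \<theta> j" if "i < k" "j < k" "i \<noteq> j" for i j
  proof
    assume eq: "\<theta> i = \<theta> j"
    have "- f a \<noteq> f b" for a b using f(2)[of b a] by metis
    then have "i \<le> pr i \<longleftrightarrow> j \<le> pr j"
      using eq f(2) by (auto simp: \<theta>_def split: if_splits)
    then have "i = j \<or> pr i = pr j"
      using eq injD[OF f(1)] by (auto simp: \<theta>_def split: if_splits)
    then show False using that pr(2) by metis
  qed
  have \<theta>pr: "\<theta> (pr i) = - \<theta> i" if "i < k" "pr i \<noteq> i" for i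
    using that pr(2)[OF that(1)] by (auto simp: \<theta>_def)
  have sym1: "diag_coeff \<theta> a b = diag_coeff \<theta> b a" if ab: "a < k" "b < k" for a b
  proof (cases "pr a = b")
    case True
    then have "pr b = a" using ab pr(2) by blast
    then show ?thesis using True \<theta>pr[of a] eta(2)[of a] ab by (cases "a = b") (auto simp: diag_coeff_def)
  next
    case False
    then have "pr b \<noteq> a" using ab pr(2) by blast
    then show ?thesis using False by (simp add: diag_coeff_def)
  qed
  have dc: "diag_coeff \<theta> (pr a) b = (if a = b then \<theta> a / eta (pr a) else 0)" if "a < k" for a b
    using that by (simp add: diag_coeff_def pr)
  have "(\<forall>a<k. \<forall>b<k. s * diag_coeff \<theta> a b + t * hess_coeff a b = s * diag_coeff \<theta> b a + t * hess_coeff b a) \<and>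
    mat.dim (gl_stab (\<lambda>a b. s * diag_coeff \<theta> a b + t * hess_coeff a b)) \<le> 2 * CARD('n)" (is "?sym \<and> ?dim")
    if st: "(s, t) \<noteq> (0, 0)" for s t
  proof
    show ?sym
      using sym1 by (simp add: hess_coeff_def add.commute)
    show ?dim
    proof (cases "t = 0")
      case True
      then have s: "s \<noteq> 0" using st by simp
      show ?thesis
      proof (rule dim_gl_stab_diagonal[of _ "\<lambda>a. s * \<theta> a"])
        show "s * diag_coeff \<theta> (pr a) b + t * hess_coeff (pr a) b = (if a = b then s * \<theta> a / eta (pr a) else 0)"
          if "a < k" for a b using dc[OF that] True by simp
      qed (use s \<theta>0 \<theta>d in auto)
    next
      \<comment> \<open>The diagonal part does not reach the subdiagonal, where \<open>t\<close>
        times a nonzero value remains.\<close>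
      case False
      show ?thesis
      proof (rule dim_gl_stab_hessenberg)
        show "s * diag_coeff \<theta> (pr a) b + t * hess_coeff (pr a) b = 0" if "a < k" "Suc b < a" for a b
          using dc[OF that(1)] hess_coeff_pr(1)[OF that] that by simp
        show "s * diag_coeff \<theta> (pr (Suc b)) b + t * hess_coeff (pr (Suc b)) b \<noteq> 0" if "Suc b < k" for b
          using dc[OF that] hess_coeff_pr(2)[OF that refl] False by simp
      qed
    qed
  qed
  then show ?thesis by blast
qed

end

theorem theorem3p11:
  fixes e :: "'k::field^('n::finite + 'n)^('n + 'n)"
  assumes "alg_closed TYPE('k)"
    and "(2::'k) \<noteq> 0"
    and "CARD('n) \<ge> 2"
    and "e \<in> sp"
    and "nilpotent_mat e"
  shows "codim_ge (centraliser sp e) (sing_dual (centraliser sp e)) 2"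
proof -
  interpret nilpotent_sp e using assms by unfold_locales
  obtain k lam w pr eta where "strings k lam w pr eta" "perp k w = {0}" using strings_exist by blast
  then interpret strings_sp e k lam w pr eta by unfold_locales
  let ?q = "centraliser sp e"
  note sq = subspace_centraliser[OF subspace_sp, of e]
  have qbr: "lie_br x y \<in> ?q" if "x \<in> ?q" "y \<in> ?q" for x y
    using that lie_br_eps_centraliser[of x "- 1" e y] by (simp add: sp_eq_eps)
  obtain c1 c2 where c: "\<And>s t. (s, t) \<noteq> (0, 0) \<Longrightarrow>
    (\<forall>a<k. \<forall>b<k. s * c1 a b + t * c2 a b = s * c1 b a + t * c2 b a) \<and>
    mat.dim (gl_stab (\<lambda>a b. s * c1 a b + t * c2 a b)) \<le> 2 * CARD('n)"
    using regular_plane_functionals[OF assms(1)] by blast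
  define \<phi> where "\<phi> c x = (if x \<in> ?q then func c x else 0)" for c x
  have \<phi>: "\<phi> c \<in> dual_sp ?q" for c
    using mat.subspace_add[OF sq] mat.subspace_scale[OF sq]
    by (auto simp: dual_sp_def \<phi>_def func_add func_smat)
  \<comment> \<open>Vinberg's inequality holds for every functional, hence for one that attains the
    index.\<close>
  have index: "CARD('n) \<le> lie_index ?q"
  proof -
    have "\<exists>\<gamma>\<in>dual_sp ?q. mdim (stab ?q \<gamma>) = lie_index ?q"
      unfolding lie_index_def by (rule LeastI_ex) (use \<phi> in blast)
    then obtain \<gamma> where \<gamma>: "\<gamma> \<in> dual_sp ?q" "mdim (stab ?q \<gamma>) = lie_index ?q" by blast
    have "CARD('n) \<le> mat.dim (stab ?q \<gamma>)"
      unfolding stab_def sp_eq_eps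
      by (rule stabiliser_dim_ge[OF assms(1,2,4) _ \<gamma>(1)]) simp
    then show ?thesis using \<gamma>(2) by (simp add: mdim_eq_dim)
  qed
  show ?thesis
  proof (rule codim_ge_regular_plane[OF assms(1) sq qbr \<phi> \<phi>])
    fix s t :: 'k assume st: "(s, t) \<noteq> (0, 0)"
    have "mat.dim (stab ?q (\<lambda>x. s * \<phi> c1 x + t * \<phi> c2 x)) \<le> CARD('n)"
    proof (rule dim_stab_le[OF assms(1)])
      show "(\<lambda>x. s * \<phi> c1 x + t * \<phi> c2 x) \<in> dual_sp ?q" by (rule dual_comb[OF \<phi> \<phi>])
      show "s * \<phi> c1 x + t * \<phi> c2 x = func (\<lambda>a b. s * c1 a b + t * c2 a b) x" if "x \<in> ?q" for x
        using that by (simp add: \<phi>_def func_def sum_distrib_left sum.distrib algebra_simps)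
    qed (use c[OF st] in auto)
    then show "mdim (stab ?q (\<lambda>x. s * \<phi> c1 x + t * \<phi> c2 x)) \<le> lie_index ?q"
      using index by (simp add: mdim_eq_dim)
  qed
qed

end
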